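(* The Min-Age problem is NP-hard.
   Context: Min-Age problem. Input: a positive integer $n$, an integer $T_0 \geq 0$, and for each $i \in \{1,\dots,n\}$ a positive integer $m_i$ and messages $M_i^0, M_i^1, \dots, M_i^{m_i}$ with integer birthdays $b(M_i^j)$ satisfying $0 \leq b(M_i^0) < b(M_i^1) < \cdots < b(M_i^{m_i}) \leq T_0$. Let $\mathcal{M}_i = \{M_i^1,\dots,M_i^{m_i}\}$ and $T = \sum_i m_i$. A feasible schedule $S$ is a bijection from $\mathcal{M}_1\cup\cdots\cup\mathcal{M}_n$ to $\{T_0+1,\dots,T_0+T\}$ with $S(M_i^1) < \cdots < S(M_i^{m_i})$ for every $i$. For an integer $t$, $lm(S,i,t)$ is $M_i^j$ where $j$ is the largest index in $\{0,\dots,m_i\}$ with $j=0$ or $S(M_i^j)\leq t$; $age(S,i,t) = t - b(lm(S,i,t))$ if $lm(S,i,t) \neq M_i^{m_i}$ and $0$ otherwise. $Age(S) = \sum_{i=1}^n \sum_{t=T_0}^{T_0+T} age(S,i,t)$; the problem asks for a feasible schedule minimizing $Age(S)$ (decision version: given also a number $Q$, decide whether some feasible schedule has $Age(S)\leq Q$). *)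

theory Defs
  imports "HOL-Computational_Algebra.Polynomial"
begin

section \<open>Deterministic multi-tape Turing machines\<close>

text \<open>
  States and tape symbols are initial segments of the natural numbers. State 0 is the start
  state and state 1 the halting state; symbol 0 is the blank, and the symbols 1 and 2 represent the
  bits. Tapes are infinite in both directions; a tape is its contents together with the
  position of its head.
\<close>

datatype direction = Go_Left | Stay | Go_Right

record tm =
  tapes :: nat
  states :: nat
  symbols :: nat
  trans :: "nat \<Rightarrow> nat list \<Rightarrow> nat \<times> (nat \<times> direction) list"

definition wf_tm :: "tm \<Rightarrow> bool" where
  "wf_tm M \<longleftrightarrow> 1 \<le> tapes M \<and> 2 \<le> states M \<and> 3 \<le> symbols M \<and>
    (\<forall>q ss. q < states M \<and> length ss = tapes M \<and> set ss \<subseteq> {..<symbols M} \<longrightarrow>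
      fst (trans M q ss) < states M \<and>
      length (snd (trans M q ss)) = tapes M \<and>
      fst ` set (snd (trans M q ss)) \<subseteq> {..<symbols M})"

type_synonym tape = "(int \<Rightarrow> nat) \<times> int"
type_synonym config = "nat \<times> tape list"

fun offset :: "direction \<Rightarrow> int" where
  "offset Go_Left = -1"
| "offset Stay = 0"
| "offset Go_Right = 1"

fun read_tape :: "tape \<Rightarrow> nat" where
  "read_tape (c, p) = c p"

fun act_tape :: "nat \<times> direction \<Rightarrow> tape \<Rightarrow> tape" where
  "act_tape (s, d) (c, p) = (c(p := s), p + offset d)"

fun step :: "tm \<Rightarrow> config \<Rightarrow> config" where
  "step M (q, ts) =
    (if q = 1 then (q, ts)
     else (case trans M q (map read_tape ts) of (q', as) \<Rightarrow> (q', map2 act_tape as ts)))"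

definition bit_symbol :: "bool \<Rightarrow> nat" where
  "bit_symbol x = (if x then 2 else 1)"

definition word_tape :: "bool list \<Rightarrow> tape" where
  "word_tape w =
    (\<lambda>p. if 0 \<le> p \<and> p < int (length w) then bit_symbol (w ! nat p) else 0, 0)"

definition start_config :: "tm \<Rightarrow> bool list \<Rightarrow> config" where
  "start_config M x = (0, word_tape x # replicate (tapes M - 1) (word_tape []))"

text \<open>An output word starts in cell 0 and extends up to the first blank to the right of it.\<close>

definition tape_output :: "tape \<Rightarrow> bool list \<Rightarrow> bool" where
  "tape_output tp w \<longleftrightarrow>
    (\<forall>i<length w. fst tp (int i) = bit_symbol (w ! i)) \<and> fst tp (int (length w)) = 0"

definition computes_in_time :: "tm \<Rightarrow> (bool list \<Rightarrow> bool list) \<Rightarrow> (nat \<Rightarrow> nat) \<Rightarrow> bool" where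
  "computes_in_time M f time \<longleftrightarrow>
    (\<forall>x. \<exists>t \<le> time (length x). \<exists>ts.
      (step M ^^ t) (start_config M x) = (1, ts) \<and> tape_output (last ts) (f x))"

section \<open>Polynomial time, NP, and NP-hardness\<close>

type_synonym language = "bool list set"

definition polytime_computable :: "(bool list \<Rightarrow> bool list) \<Rightarrow> bool" where
  "polytime_computable f \<longleftrightarrow> (\<exists>M (p :: nat poly). wf_tm M \<and> computes_in_time M f (poly p))"

definition class_P :: "language set" where
  "class_P = {L. polytime_computable (\<lambda>x. [x \<in> L])}"

definition self_delimiting :: "bool list \<Rightarrow> bool list" where
  "self_delimiting w = concat (map (\<lambda>x. [True, x]) w) @ [False]"

definition encode_pair :: "bool list \<Rightarrow> bool list \<Rightarrow> bool list" where
  "encode_pair x y = self_delimiting x @ y"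

definition class_NP :: "language set" where
  "class_NP = {L. \<exists>V \<in> class_P. \<exists>p :: nat poly. \<forall>x.
     x \<in> L \<longleftrightarrow> (\<exists>y. length y \<le> poly p (length x) \<and> encode_pair x y \<in> V)}"

definition polytime_reducible :: "language \<Rightarrow> language \<Rightarrow> bool" where
  "polytime_reducible L L' \<longleftrightarrow>
    (\<exists>f. polytime_computable f \<and> (\<forall>x. x \<in> L \<longleftrightarrow> f x \<in> L'))"

definition NP_hard :: "language \<Rightarrow> bool" where
  "NP_hard L' \<longleftrightarrow> (\<forall>L \<in> class_NP. polytime_reducible L L')"

section \<open>The Min-Age problem\<close>

text \<open>
  The pair \<open>(i, j)\<close> stands for the message $M_i^j$, and \<open>lm\<close> returns the index \<open>j\<close> only.
  Only the values \<open>msgs I i\<close> for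
  \<open>1 \<le> i \<le> senders I\<close> and \<open>birthday I i j\<close> for \<open>j \<le> msgs I i\<close> matter.
\<close>

record min_age_instance =
  senders :: nat
  T0 :: nat
  msgs :: "nat \<Rightarrow> nat"
  birthday :: "nat \<Rightarrow> nat \<Rightarrow> nat"

definition valid_instance :: "min_age_instance \<Rightarrow> bool" where
  "valid_instance I \<longleftrightarrow> 1 \<le> senders I \<and>
    (\<forall>i \<in> {1..senders I}. 1 \<le> msgs I i \<and>
      (\<forall>j < msgs I i. birthday I i j < birthday I i (Suc j)) \<and>
      birthday I i (msgs I i) \<le> T0 I)"

definition messages :: "min_age_instance \<Rightarrow> (nat \<times> nat) set" where
  "messages I = (SIGMA i:{1..senders I}. {1..msgs I i})"

definition total_msgs :: "min_age_instance \<Rightarrow> nat" where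
  "total_msgs I = (\<Sum>i = 1..senders I. msgs I i)"

definition feasible :: "min_age_instance \<Rightarrow> (nat \<times> nat \<Rightarrow> nat) \<Rightarrow> bool" where
  "feasible I S \<longleftrightarrow>
    bij_betw S (messages I) {T0 I + 1..T0 I + total_msgs I} \<and>
    (\<forall>i \<in> {1..senders I}. \<forall>j k. 1 \<le> j \<and> j < k \<and> k \<le> msgs I i \<longrightarrow> S (i, j) < S (i, k))"

definition lm :: "min_age_instance \<Rightarrow> (nat \<times> nat \<Rightarrow> nat) \<Rightarrow> nat \<Rightarrow> nat \<Rightarrow> nat" where
  "lm I S i t = Max {j. j \<le> msgs I i \<and> (j = 0 \<or> S (i, j) \<le> t)}"

definition age :: "min_age_instance \<Rightarrow> (nat \<times> nat \<Rightarrow> nat) \<Rightarrow> nat \<Rightarrow> nat \<Rightarrow> int" where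
  "age I S i t =
    (if lm I S i t \<noteq> msgs I i then int t - int (birthday I i (lm I S i t)) else 0)"

definition Age :: "min_age_instance \<Rightarrow> (nat \<times> nat \<Rightarrow> nat) \<Rightarrow> int" where
  "Age I S = (\<Sum>i = 1..senders I. \<Sum>t = T0 I..T0 I + total_msgs I. age I S i t)"

text \<open>Numbers are written in binary, least significant bit first.\<close>

fun binary :: "nat \<Rightarrow> bool list" where
  "binary k = (if k = 0 then [] else odd k # binary (k div 2))"

declare binary.simps [simp del]

definition encode_nat :: "nat \<Rightarrow> bool list" where
  "encode_nat k = self_delimiting (binary k)"

definition encode_instance :: "min_age_instance \<Rightarrow> nat \<Rightarrow> bool list" where
  "encode_instance I Q =
    encode_nat (senders I) @ encode_nat (T0 I) @ encode_nat Q @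
    concat (map (\<lambda>i. encode_nat (msgs I i) @
                     concat (map (\<lambda>j. encode_nat (birthday I i j)) [0..<Suc (msgs I i)]))
                [1..<Suc (senders I)])"

definition Min_Age :: language where
  "Min_Age = {encode_instance I Q | I Q.
     valid_instance I \<and> (\<exists>S. feasible I S \<and> Age I S \<le> int Q)}"

text \<open>The encoding is faithful: it determines all relevant data of an instance.\<close>

lemma self_delimiting_append_eq:
  "self_delimiting v @ xs = self_delimiting w @ ys \<longleftrightarrow> v = w \<and> xs = ys"
proof (induction v arbitrary: w)
  case Nil
  then show ?case by (cases w) (auto simp: self_delimiting_def)
next
  case (Cons a v)
  then show ?case by (cases w) (auto simp: self_delimiting_def)
qed

lemma binary_inject: "binary k = binary l \<longleftrightarrow> k = l"
proof (induction k arbitrary: l rule: less_induct)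
  case (less k)
  show ?case
  proof (cases "k = 0 \<or> l = 0")
    case True
    then show ?thesis by (auto simp: binary.simps[of k] binary.simps[of l])
  next
    case False
    then have "binary k = binary l \<longleftrightarrow> odd k = odd l \<and> k div 2 = l div 2"
      using less.IH[of "k div 2" "l div 2"] by (simp add: binary.simps[of k] binary.simps[of l])
    also have "\<dots> \<longleftrightarrow> k = l"
      by presburger
    finally show ?thesis .
  qed
qed

lemma encode_nat_append_eq: "encode_nat k @ xs = encode_nat l @ ys \<longleftrightarrow> k = l \<and> xs = ys"
  by (simp add: encode_nat_def self_delimiting_append_eq binary_inject)

lemma concat_encode_nat_append_eq:
  "concat (map (\<lambda>j. encode_nat (f j)) js) @ xs = concat (map (\<lambda>j. encode_nat (g j)) js) @ ys \<longleftrightarrow>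
    (\<forall>j \<in> set js. f j = g j) \<and> xs = ys"
  by (induction js) (auto simp: encode_nat_append_eq)

lemma encode_instance_inject:
  assumes "encode_instance I Q = encode_instance I' Q'"
  shows "senders I = senders I'" "T0 I = T0 I'" "Q = Q'"
    and "\<forall>i \<in> {1..senders I}. msgs I i = msgs I' i \<and>
           (\<forall>j \<le> msgs I i. birthday I i j = birthday I' i j)"
proof -
  define blk where "blk I i = encode_nat (msgs I i) @
    concat (map (\<lambda>j. encode_nat (birthday I i j)) [0..<Suc (msgs I i)])" for I :: min_age_instance and i
  have *: "concat (map (blk I) is) = concat (map (blk I') is) \<Longrightarrow>
    \<forall>i \<in> set is. msgs I i = msgs I' i \<and> (\<forall>j \<in> set [0..<Suc (msgs I i)]. birthday I i j = birthday I' i j)"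
    for "is"
  proof (induction "is")
    case (Cons i "is")
    have m: "msgs I i = msgs I' i"
      using Cons.prems by (simp add: blk_def encode_nat_append_eq del: upt_Suc)
    show ?case
      using Cons m
      by (simp add: blk_def[of _ i] encode_nat_append_eq concat_encode_nat_append_eq del: upt_Suc)
  qed simp
  show 1: "senders I = senders I'" "T0 I = T0 I'" "Q = Q'"
    using assms by (auto simp: encode_instance_def encode_nat_append_eq simp del: upt_Suc)
  have "concat (map (blk I) [1..<Suc (senders I)]) = concat (map (blk I') [1..<Suc (senders I)])"
    using assms 1 by (simp add: encode_instance_def encode_nat_append_eq blk_def[abs_def] del: upt_Suc)
  from *[OF this] show "\<forall>i \<in> {1..senders I}. msgs I i = msgs I' i \<and>
           (\<forall>j \<le> msgs I i. birthday I i j = birthday I' i j)"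
    by (auto simp: less_Suc_eq_le simp del: upt_Suc)
qed

end

theory Submission imports Defs begin

text \<open>
  Count slots from \<open>T0\<close>. Summation by parts turns the age of a sender into the sum of \<open>w j * x j\<close> over
  its messages, where \<open>x j\<close> is the slot and \<open>w j\<close> a difference of birthdays, plus \<open>x * (x - 1) / 2\<close> for the
  slot \<open>x\<close> of the last message. Divide each chain of messages into blocks and a last message with a
  target \<open>d\<close>; let the weights be 1, plus \<open>\<lambda>\<close> times the length of the block at its end, plus \<open>\<lambda> - d\<close> at the
  last message. As all slots are used, the total age is a constant plus \<open>\<lambda>\<close> times the excess of the spread of
  the blocks over its minimum plus the sum of \<open>(x - d) * (x - d - 1) / 2\<close> over the last messages. So a
  certain bound is met iff every block is contiguous and every last message is in slot \<open>d\<close> or \<open>d + 1\<close>.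
  Chains without blocks then act as separators; they cut the time into bins, each of which must hold exactly
  one block of a prescribed length.

  For satisfiability with \<open>V\<close> many-valued variables, the chain of the literal \<open>v = d\<close> consists of a block for
  \<open>v\<close> followed by blocks for the clauses that contain the literal. The first \<open>V\<close> bins select one literal for
  every variable. Then every clause has \<open>V + 1\<close> bins but only \<open>V\<close> filler blocks of the right length, so that a
  selected literal must satisfy it. Blocks that are not used up follow after the last separator.

  The Cook-Levin tableau reduces NP to this form of satisfiability. All numbers involved are polynomially
  bounded, so a machine that uses its head positions as counters can compute the reduction in unary.
\<close>

section \<open>Chains of blocks with targets\<close>

text \<open>Any positive \<open>\<lambda>\<close> would do to detect torn blocks: both penalties are
  nonnegative, and the bound is the value at which both vanish. It is taken to be the number of
  slots, so that \<open>\<lambda> - d\<close> keeps the gap between birthdays positive. The summand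
  \<open>\<lambda>\<close> on the last message lets it count as often as every other message, so
  that the slots enter only through their sum, which is the same for all schedules. The tolerance of
  one slot comes from integrality: the parabola of a last message has its vertex at
  \<open>d + 1/2\<close>, hence two neighbouring integer minima. Parity of the block lengths removes
  it. A clause needs \<open>V + 1\<close> bins because a chain is ordered: a literal that serves a
  late clause must first get rid of its blocks for all earlier clauses. So every clause has to
  accept any number of selected literals from 1 to \<open>V\<close>; fillers make up the rest.
  Many-valued variables let one variable stand for a head position or a tape cell of the tableau.
  That it takes exactly one value costs no clauses, since its selection bin holds exactly one
  block.\<close>

definition tri :: "nat \<Rightarrow> nat" where "tri k = (\<Sum>r<Suc k. r)"

lemma double_tri: "2 * int (tri k) = int k * (int k + 1)"
  by (induction k) (auto simp: tri_def algebra_simps)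

lemma sum_lessThan_double: "2 * (\<Sum>u<k. int u) = int k * (int k - 1)"
  by (induction k) (auto simp: algebra_simps)

text \<open>Up to the delivery of the last message, the age at time \<open>t\<close> is
  \<open>t - T0\<close> plus the sum of the jumps of \<open>B\<close> that are still outstanding.
  After an exchange of summations, jump \<open>j\<close> is counted once for each \<open>t\<close>
  from \<open>T0\<close> to just before \<open>S (i, j)\<close>. With \<open>B m = T0\<close> in
  place of the last birthday, the jumps telescope to the right value.\<close>

lemma sender_age:
  assumes v: "valid_instance I" and f: "feasible I S" and i: "i \<in> {1..senders I}"
  defines "m \<equiv> msgs I i"
  defines "B \<equiv> \<lambda>j. if j < m then int (birthday I i j) else int (T0 I)"
  shows "(\<Sum>t = T0 I..T0 I + total_msgs I. age I S i t) =
    (\<Sum>j = 1..m. (B j - B (j - 1)) * (int (S (i, j)) - int (T0 I))) + (\<Sum>u<S (i, m) - T0 I. int u)"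
proof -
  have m1: "1 \<le> m" using v i by (auto simp: valid_instance_def m_def)
  have bij: "bij_betw S (messages I) {T0 I + 1..T0 I + total_msgs I}"
    and ord: "\<And>j k. 1 \<le> j \<Longrightarrow> j < k \<Longrightarrow> k \<le> m \<Longrightarrow> S (i, j) < S (i, k)"
    using f i by (auto simp: feasible_def m_def)
  have rng: "T0 I < S (i, j)" "S (i, j) \<le> T0 I + total_msgs I" if "1 \<le> j" "j \<le> m" for j
  proof -
    have "(i, j) \<in> messages I" using that i by (auto simp: messages_def m_def)
    then have "S (i, j) \<in> {T0 I + 1..T0 I + total_msgs I}" using bij by (auto simp: bij_betw_def)
    then show "T0 I < S (i, j)" "S (i, j) \<le> T0 I + total_msgs I" by auto
  qed
  have ord': "S (i, j) \<le> S (i, k)" if "1 \<le> j" "j \<le> k" "k \<le> m" for j k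
    using ord[of j k] that by (cases "j = k") auto
  have age: "age I S i t = (\<Sum>j = 1..m. (B j - B (j - 1)) * of_bool (t < S (i, j))) + of_bool (t < S (i, m)) * (int t - int (T0 I))"
    for t
  proof -
    define q where "q = lm I S i t"
    let ?A = "{j. j \<le> msgs I i \<and> (j = 0 \<or> S (i, j) \<le> t)}"
    have fin: "finite ?A" by (rule finite_subset[of _ "{..m}"]) (auto simp: m_def)
    have q_in: "q \<in> ?A" unfolding q_def lm_def by (rule Max_in[OF fin]) auto
    have q_le: "j \<le> q" if "j \<in> ?A" for j unfolding q_def lm_def by (rule Max_ge[OF fin that])
    \<comment> \<open>The schedule is increasing along a sender, so the delivered indices form an
      initial segment and their maximum \<open>q\<close> decides which messages are
      outstanding.\<close>
    have q: "t < S (i, j) \<longleftrightarrow> q < j" if "1 \<le> j" "j \<le> m" for j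
    proof
      assume "t < S (i, j)"
      show "q < j"
      proof (rule ccontr)
        assume "\<not> q < j"
        then have "S (i, j) \<le> S (i, q)" using that q_in by (intro ord') (auto simp: m_def)
        then show False using \<open>t < S (i, j)\<close> q_in \<open>\<not> q < j\<close> that by auto
      qed
    next
      assume "q < j"
      then show "t < S (i, j)" using q_le[of j] that by (auto simp: m_def not_less[symmetric])
    qed
    have qm: "q \<le> m" using q_in by (simp add: m_def)
    have "(\<Sum>j = 1..m. (B j - B (j - 1)) * of_bool (t < S (i, j))) = (\<Sum>j = 1..m. (B j - B (j - 1)) * of_bool (q < j))"
      by (rule sum.cong) (auto simp: q)
    also have "\<dots> = (\<Sum>j\<in>{Suc q..m}. B j - B (j - 1))"
      by (rule sum.mono_neutral_cong_right) auto
    also have "\<dots> = B m - B q" using qm by (rule sum_telescope'')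
    finally have s: "(\<Sum>j = 1..m. (B j - B (j - 1)) * of_bool (t < S (i, j))) = B m - B q" .
    show ?thesis unfolding s using q[of m] m1 qm
      by (auto simp: age_def q_def[symmetric] m_def[symmetric] B_def)
  qed
  have cnt: "(\<Sum>t = T0 I..T0 I + total_msgs I. of_bool (t < s) :: int) = int s - int (T0 I)"
    if "T0 I < s" "s \<le> T0 I + total_msgs I" for s
  proof -
    have "(\<Sum>t = T0 I..T0 I + total_msgs I. of_bool (t < s) :: int) = (\<Sum>t\<in>{T0 I..<s}. 1)"
      using that by (intro sum.mono_neutral_cong_right) auto
    then show ?thesis using that by simp
  qed
  have "(\<Sum>t = T0 I..T0 I + total_msgs I. age I S i t) =
    (\<Sum>j = 1..m. (B j - B (j - 1)) * (\<Sum>t = T0 I..T0 I + total_msgs I. of_bool (t < S (i, j)))) +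
    (\<Sum>t = T0 I..T0 I + total_msgs I. of_bool (t < S (i, m)) * (int t - int (T0 I)))"
    unfolding age sum.distrib by (subst sum.swap) (simp only: sum_distrib_left)
  also have "(\<Sum>t = T0 I..T0 I + total_msgs I. of_bool (t < S (i, m)) * (int t - int (T0 I))) =
     (\<Sum>t\<in>{T0 I..<S (i, m)}. int t - int (T0 I))"
    using rng[of m] m1 by (intro sum.mono_neutral_cong_right) auto
  also have "\<dots> = (\<Sum>u<S (i, m) - T0 I. int u)"
    by (rule sum.reindex_bij_witness[of _ "\<lambda>u. u + T0 I" "\<lambda>t. t - T0 I"]) auto
  also have "(\<Sum>j = 1..m. (B j - B (j - 1)) * (\<Sum>t = T0 I..T0 I + total_msgs I. of_bool (t < S (i, j)))) =
    (\<Sum>j = 1..m. (B j - B (j - 1)) * (int (S (i, j)) - int (T0 I)))"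
    by (intro sum.cong refl, subst cnt) (auto intro: rng)
  finally show ?thesis .
qed

section \<open>Min-Age instances made of chains, and their ages\<close>

locale chains =
  fixes n K :: nat and l :: "nat \<Rightarrow> nat \<Rightarrow> nat" and d :: "nat \<Rightarrow> nat"
begin

definition pre :: "nat \<Rightarrow> nat \<Rightarrow> nat" where "pre i k = (\<Sum>k'<k. l i k')"
definition len :: "nat \<Rightarrow> nat" where "len i = pre i (Suc K)"
definition total :: nat where "total = (\<Sum>i<n. len i)"
text \<open>Jumps by the length of a block exactly when \<open>j\<close> reaches the end of that
  block. Adding a multiple of it to the birthdays puts the extra weight of a block on its last
  message.\<close>

definition finished :: "nat \<Rightarrow> nat \<Rightarrow> nat" where
  "finished i j = (\<Sum>k<K. of_bool (pre i (Suc k) \<le> j) * l i k)"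
text \<open>The term \<open>j\<close> yields weight 1, the term with \<open>finished\<close> the
  weight of block ends; the constant makes the gap from the last but one birthday to
  \<open>T0\<close> equal to \<open>total + 1 - d i\<close>. The value of \<open>T0\<close> keeps
  the subtraction from truncating, since a chain has at most \<open>total\<close> messages.\<close>

definition bday :: "nat \<Rightarrow> nat \<Rightarrow> nat" where
  "bday i j = (if j < len i then Suc total * total + d i + j + total * finished i j - Suc total * len i
     else Suc total * total)"
definition inst :: min_age_instance where
  "inst = \<lparr>senders = n, T0 = Suc total * total, msgs = (\<lambda>i. len (i - 1)), birthday = (\<lambda>i. bday (i - 1))\<rparr>"
text \<open>The age when all penalties vanish. All slots together carry weight
  \<open>total + 1\<close>; \<open>tri (l i k - 1)\<close> is the spread of a contiguous block, and
  \<open>- tri (d i)\<close> is the minimum of \<open>x * (x - 1) / 2 - d i * x\<close> over the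
  integers.\<close>

definition bound :: nat where
  "bound = Suc total * tri total + total * (\<Sum>i<n. \<Sum>k<K. tri (l i k - 1)) - (\<Sum>i<n. tri (d i))"

text \<open>The pieces of a chain are its blocks, numbered below \<open>K\<close>, and the last message, numbered \<open>K\<close>;
  piece \<open>k\<close> of chain \<open>i\<close> occupies the slots after \<open>st i k\<close>.\<close>
definition placed :: "(nat \<Rightarrow> nat \<Rightarrow> nat) \<Rightarrow> bool" where
  "placed st \<longleftrightarrow>
    (\<forall>i<n. \<forall>k\<le>K. 0 < l i k \<longrightarrow> st i k + l i k \<le> total) \<and>
    (\<forall>i<n. \<forall>i'<n. \<forall>k\<le>K. \<forall>k'\<le>K. (i, k) \<noteq> (i', k') \<and> 0 < l i k \<and> 0 < l i' k' \<longrightarrow>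
       st i k + l i k \<le> st i' k' \<or> st i' k' + l i' k' \<le> st i k) \<and>
    (\<forall>i<n. \<forall>k k'. k < k' \<and> k' \<le> K \<and> 0 < l i k \<and> 0 < l i k' \<longrightarrow> st i k + l i k \<le> st i k') \<and>
    (\<forall>i<n. d i = st i K \<or> d i = Suc (st i K))"

end

text \<open>The bound on \<open>d\<close> makes the gap \<open>total + 1 - d i\<close> at the end of
  a chain positive, so that the birthdays increase.\<close>

locale good_chains = chains +
  assumes n: "1 \<le> n" and l_last: "\<And>i. l i K = 1" and d_le: "\<And>i. i < n \<Longrightarrow> d i \<le> total"
begin

lemma pre_Suc: "pre i (Suc k) = pre i k + l i k" by (simp add: pre_def)

lemma pre_mono: "k \<le> k' \<Longrightarrow> pre i k \<le> pre i k'"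
  unfolding pre_def by (rule sum_mono2) auto

lemma len_eq: "len i = Suc (pre i K)" by (simp add: len_def pre_Suc l_last)

lemma len_le_total: "i < n \<Longrightarrow> len i \<le> total"
  unfolding total_def by (rule member_le_sum) auto

lemma n_le_total: "n \<le> total"
proof -
  have "(\<Sum>i<n. 1) \<le> (\<Sum>i<n. len i)" by (rule sum_mono) (simp add: len_eq)
  then show ?thesis by (simp add: total_def)
qed

lemma finished_mono: "j \<le> j' \<Longrightarrow> finished i j \<le> finished i j'"
  unfolding finished_def by (rule sum_mono) auto

lemma finished_last: "finished i (pre i K) = pre i K"
proof -
  have "finished i (pre i K) = (\<Sum>k<K. l i k)"
    unfolding finished_def using pre_mono[of "Suc _" K i] by (intro sum.cong) auto
  then show ?thesis by (simp add: pre_def)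
qed

lemma int_bday:
  assumes "i < n" "j < len i"
  shows "int (bday i j) = int (Suc total * total) + int (d i) + int j + int total * int (finished i j) - int (Suc total) * int (len i)"
proof -
  have "Suc total * len i \<le> Suc total * total" using len_le_total[OF assms(1)] by (rule mult_le_mono2)
  then have "Suc total * len i \<le> Suc total * total + d i + j + total * finished i j" by linarith
  then show ?thesis using assms(2) by (simp add: bday_def of_nat_diff algebra_simps)
qed

lemma bday_last: "bday i (len i) = Suc total * total" by (simp add: bday_def)

lemma inst_sel: "senders inst = n" "msgs inst i = len (i - 1)" "birthday inst i = bday (i - 1)"
  by (simp_all add: inst_def)

lemma valid: "valid_instance inst"
  unfolding valid_instance_def
proof (intro conjI ballI allI impI)
  show "1 \<le> senders inst" using n by (simp add: inst_def)
next
  fix i assume "i \<in> {1..senders inst}"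
  then have i: "i - 1 < n" by (auto simp: inst_def)
  show "1 \<le> msgs inst i" by (simp add: inst_def len_eq)
  show "birthday inst i (msgs inst i) \<le> T0 inst" by (simp add: inst_def bday_last)
  fix j assume j: "j < msgs inst i"
  show "birthday inst i j < birthday inst i (Suc j)"
  proof (cases "Suc j = len (i - 1)")
    case False
    then have "Suc j < len (i - 1)" using j by (simp add: inst_def)
    moreover have "int total * int (finished (i - 1) j) \<le> int total * int (finished (i - 1) (Suc j))"
      using finished_mono[of j "Suc j" "i - 1"] by (intro mult_left_mono) auto
    ultimately have "int (bday (i - 1) j) < int (bday (i - 1) (Suc j))"
      using int_bday[OF i] j by (simp add: inst_def)
    then show ?thesis by (simp add: inst_def)
  next
    case True
    then have jj: "j = pre (i - 1) K" by (simp add: len_eq)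
    have "int (bday (i - 1) j) = int (Suc total * total) + int (d (i - 1)) - int (Suc total)"
      using int_bday[OF i, of j] j jj finished_last[of "i - 1"] by (simp add: inst_def len_eq algebra_simps)
    also have "\<dots> < int (bday (i - 1) (Suc j))" using d_le[OF i] True bday_last[of "i - 1"] by simp
    finally show ?thesis by (simp add: inst_def)
  qed
qed

lemma total_msgs_inst: "total_msgs inst = total"
  unfolding total_msgs_def total_def inst_def
  by (simp, rule sum.reindex_bij_witness[of _ Suc "\<lambda>i. i - 1"]) auto

lemma sum_blocks:
  fixes g :: "nat \<Rightarrow> int"
  shows "(\<Sum>k<k'. \<Sum>r = 1..l i k. g (pre i k + r)) = (\<Sum>j = 1..pre i k'. g j)"
proof (induction k')
  case (Suc k')
  have "(\<Sum>r = 1..l i k'. g (pre i k' + r)) = (\<Sum>j = Suc (pre i k')..pre i (Suc k'). g j)"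
    by (rule sum.reindex_bij_witness[of _ "\<lambda>j. j - pre i k'" "\<lambda>r. pre i k' + r"]) (auto simp: pre_Suc)
  moreover have "(\<Sum>j = 1..pre i (Suc k'). g j) = (\<Sum>j = 1..pre i k'. g j) + (\<Sum>j = Suc (pre i k')..pre i (Suc k'). g j)"
    by (subst sum.union_disjoint[symmetric]) (auto simp: pre_Suc intro!: sum.cong)
  ultimately show ?case using Suc by simp
qed (simp add: pre_def)

definition spread :: "(nat \<Rightarrow> int) \<Rightarrow> nat \<Rightarrow> nat \<Rightarrow> int" where
  "spread x i k = (\<Sum>r = 1..l i k. x (pre i (Suc k)) - x (pre i k + r))"

text \<open>The increment of \<open>finished\<close> is the length of a block at its end and 0
  elsewhere. So each block contributes one copy of its end slot per message, and each copy splits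
  into the slot of that message and its distance from the end.\<close>

lemma weighted_sum:
  fixes x :: "nat \<Rightarrow> int"
  shows "(\<Sum>j = 1..pre i K. (int (finished i j) - int (finished i (j - 1))) * x j) =
    (\<Sum>k<K. spread x i k) + (\<Sum>j = 1..pre i K. x j)"
proof -
  have fin: "int (finished i j) - int (finished i (j - 1)) = (\<Sum>k<K. of_bool (pre i (Suc k) = j) * int (l i k))"
    if "1 \<le> j" for j
    unfolding finished_def of_nat_sum sum_subtractf[symmetric] using that
    by (intro sum.cong refl) auto
  have "(\<Sum>j = 1..pre i K. (int (finished i j) - int (finished i (j - 1))) * x j) =
    (\<Sum>j = 1..pre i K. \<Sum>k<K. of_bool (pre i (Suc k) = j) * int (l i k) * x j)"
    by (intro sum.cong refl) (simp only: fin atLeastAtMost_iff sum_distrib_right)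
  also have "\<dots> = (\<Sum>k<K. \<Sum>j = 1..pre i K. of_bool (pre i (Suc k) = j) * int (l i k) * x j)"
    by (rule sum.swap)
  also have "\<dots> = (\<Sum>k<K. int (l i k) * x (pre i (Suc k)))"
  proof (intro sum.cong refl)
    fix k assume k: "k \<in> {..<K}"
    show "(\<Sum>j = 1..pre i K. of_bool (pre i (Suc k) = j) * int (l i k) * x j) = int (l i k) * x (pre i (Suc k))"
    \<comment> \<open>The end of an empty block may be index 0, outside the range of
      \<open>j\<close>; its weight is 0 as well.\<close>
    proof (cases "l i k = 0")
      case False
      then have "pre i (Suc k) \<in> {1..pre i K}" using pre_mono[of "Suc k" K i] k by (auto simp: pre_Suc)
      then have "(\<Sum>j = 1..pre i K. of_bool (pre i (Suc k) = j) * int (l i k) * x j) =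
        (\<Sum>j\<in>{pre i (Suc k)}. of_bool (pre i (Suc k) = j) * int (l i k) * x j)"
        by (intro sum.mono_neutral_right) auto
      then show ?thesis by simp
    qed simp
  qed
  also have "\<dots> = (\<Sum>k<K. spread x i k + (\<Sum>r = 1..l i k. x (pre i k + r)))"
    by (intro sum.cong refl) (simp add: spread_def sum_subtractf)
  also have "\<dots> = (\<Sum>k<K. spread x i k) + (\<Sum>j = 1..pre i K. x j)"
    by (simp only: sum.distrib sum_blocks)
  finally show ?thesis .
qed

text \<open>By \<open>weighted_sum\<close> every block message ends up with weight
  \<open>total + 1\<close>, like the last message apart from its \<open>- d i\<close>. As the
  schedule is onto, the slots add up to \<open>tri total\<close>; what varies is the spread of the
  blocks and one parabola per chain. Doubling avoids halves.\<close>

lemma Age_inst: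
  assumes f: "feasible inst S"
  defines "x \<equiv> \<lambda>i j. int (S (Suc i, j)) - int (T0 inst)"
  shows "2 * Age inst S = 2 * int bound +
    2 * int total * (\<Sum>i<n. \<Sum>k<K. spread (x i) i k - int (tri (l i k - 1))) +
    (\<Sum>i<n. (x i (len i) - int (d i)) * (x i (len i) - int (d i) - 1))"
proof -
  let ?T = "int total"
  let ?Z = "T0 inst"
  have one: "(\<Sum>t = ?Z..?Z + total_msgs inst. age inst S (Suc i) t) =
     (?T + 1) * (\<Sum>j = 1..len i. x i j) + ?T * (\<Sum>k<K. spread (x i) i k) - int (d i) * x i (len i)
     + (\<Sum>u<S (Suc i, len i) - ?Z. int u)" if i: "i < n" for i
  proof -
    let ?B = "\<lambda>j. if j < len i then int (bday i j) else int ?Z"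
    have *: "(\<Sum>t = ?Z..?Z + total_msgs inst. age inst S (Suc i) t) =
       (\<Sum>j = 1..len i. (?B j - ?B (j - 1)) * x i j) + (\<Sum>u<S (Suc i, len i) - ?Z. int u)"
      using sender_age[OF valid f, of "Suc i"] i by (simp add: inst_sel x_def cong: if_cong)
    have "(\<Sum>j = 1..len i. (?B j - ?B (j - 1)) * x i j) =
        (\<Sum>j = 1..pre i K. (?B j - ?B (j - 1)) * x i j) + (?B (len i) - ?B (pre i K)) * x i (len i)"
      by (simp add: len_eq)
    also have "(\<Sum>j = 1..pre i K. (?B j - ?B (j - 1)) * x i j) =
        (\<Sum>j = 1..pre i K. x i j + ?T * ((int (finished i j) - int (finished i (j - 1))) * x i j))"
    proof (intro sum.cong refl)
      fix j assume j: "j \<in> {1..pre i K}"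
      then have "?B j - ?B (j - 1) = 1 + ?T * (int (finished i j) - int (finished i (j - 1)))"
        using int_bday[OF i, of j] int_bday[OF i, of "j - 1"] by (auto simp: len_eq algebra_simps of_nat_diff)
      then show "(?B j - ?B (j - 1)) * x i j = x i j + ?T * ((int (finished i j) - int (finished i (j - 1))) * x i j)"
        by (simp only: distrib_right mult_1 mult.assoc)
    qed
    also have "\<dots> = (\<Sum>j = 1..pre i K. x i j) + ?T * ((\<Sum>k<K. spread (x i) i k) + (\<Sum>j = 1..pre i K. x i j))"
      by (simp only: sum.distrib sum_distrib_left[symmetric] weighted_sum)
    also have "?B (len i) - ?B (pre i K) = ?T + 1 - int (d i)"
      using int_bday[OF i, of "pre i K"] finished_last[of i] by (simp add: len_eq inst_def algebra_simps)
    finally show ?thesis unfolding * by (simp add: len_eq algebra_simps)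
  qed
  have bij: "bij_betw S (messages inst) {?Z + 1..?Z + total}"
    using f by (simp add: feasible_def total_msgs_inst)
  have rng: "x i j \<ge> 1" "int (S (Suc i, j) - ?Z) = x i j" if "i < n" "1 \<le> j" "j \<le> len i" for i j
  proof -
    have "(Suc i, j) \<in> messages inst" using that by (auto simp: messages_def inst_def)
    then have "S (Suc i, j) \<in> {?Z + 1..?Z + total}" using bij by (auto simp: bij_betw_def)
    then show "x i j \<ge> 1" "int (S (Suc i, j) - ?Z) = x i j" by (auto simp: x_def)
  qed
  have "(\<Sum>i<n. \<Sum>j = 1..len i. x i j) = (\<Sum>p\<in>messages inst. int (S p) - int ?Z)"
  proof -
    have "(\<Sum>p\<in>messages inst. int (S p) - int ?Z) = (\<Sum>i = 1..n. \<Sum>j = 1..len (i - 1). int (S (i, j)) - int ?Z)"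
      unfolding messages_def by (subst sum.Sigma) (auto simp: inst_def)
    also have "\<dots> = (\<Sum>i<n. \<Sum>j = 1..len i. x i j)"
      by (rule sum.reindex_bij_witness[of _ Suc "\<lambda>i. i - 1"]) (auto simp: x_def)
    finally show ?thesis by simp
  qed
  also have "\<dots> = (\<Sum>s = ?Z + 1..?Z + total. int s - int ?Z)"
    using sum.reindex_bij_betw[OF bij, of "\<lambda>s. int s - int ?Z"] by simp
  also have "\<dots> = (\<Sum>r<Suc total. int r)"
  proof -
    have "(\<Sum>s = ?Z + 1..?Z + total. int s - int ?Z) = (\<Sum>r\<in>{1..total}. int r)"
      by (rule sum.reindex_bij_witness[of _ "\<lambda>r. r + ?Z" "\<lambda>s. s - ?Z"]) auto
    also have "\<dots> = (\<Sum>r<Suc total. int r)" by (rule sum.mono_neutral_left) auto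
    finally show ?thesis .
  qed
  finally have all: "(\<Sum>i<n. \<Sum>j = 1..len i. x i j) = int (tri total)" by (simp add: tri_def)
  \<comment> \<open>Completion of the square around \<open>d i + 1/2\<close>.\<close>
  have last: "2 * (- int (d i) * x i (len i) + (\<Sum>u<S (Suc i, len i) - ?Z. int u)) =
      (x i (len i) - int (d i)) * (x i (len i) - int (d i) - 1) - 2 * int (tri (d i))" if i: "i < n" for i
    using sum_lessThan_double[of "S (Suc i, len i) - ?Z"] rng(2)[OF i, of "len i"] double_tri[of "d i"]
    by (simp add: len_eq algebra_simps)
  have "Age inst S = (\<Sum>i = 1..n. \<Sum>t = ?Z..?Z + total_msgs inst. age inst S i t)"
    by (simp add: Age_def inst_def)
  also have "\<dots> = (\<Sum>i<n. \<Sum>t = ?Z..?Z + total_msgs inst. age inst S (Suc i) t)"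
    by (rule sum.reindex_bij_witness[of _ Suc "\<lambda>i. i - 1"]) auto
  also have "\<dots> = (\<Sum>i<n. (?T + 1) * (\<Sum>j = 1..len i. x i j) + ?T * (\<Sum>k<K. spread (x i) i k)
     + (- int (d i) * x i (len i) + (\<Sum>u<S (Suc i, len i) - ?Z. int u)))"
    by (intro sum.cong refl) (simp add: one)
  also have "\<dots> = (?T + 1) * int (tri total) + ?T * (\<Sum>i<n. \<Sum>k<K. spread (x i) i k)
     + (\<Sum>i<n. - int (d i) * x i (len i) + (\<Sum>u<S (Suc i, len i) - ?Z. int u))"
    by (simp only: sum.distrib sum_distrib_left[symmetric] all)
  finally have "2 * Age inst S = 2 * (?T + 1) * int (tri total) + 2 * ?T * (\<Sum>i<n. \<Sum>k<K. spread (x i) i k)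
     + (\<Sum>i<n. 2 * (- int (d i) * x i (len i) + (\<Sum>u<S (Suc i, len i) - ?Z. int u)))"
    by (simp add: sum_distrib_left algebra_simps)
  also have "(\<Sum>i<n. 2 * (- int (d i) * x i (len i) + (\<Sum>u<S (Suc i, len i) - ?Z. int u))) =
    (\<Sum>i<n. (x i (len i) - int (d i)) * (x i (len i) - int (d i) - 1)) - 2 * (\<Sum>i<n. int (tri (d i)))"
    unfolding sum_distrib_left sum_subtractf[symmetric]
    by (intro sum.cong refl) (simp only: last lessThan_iff flip: sum_distrib_left)
  finally have A: "2 * Age inst S = 2 * (?T + 1) * int (tri total) + 2 * ?T * (\<Sum>i<n. \<Sum>k<K. spread (x i) i k)
     + ((\<Sum>i<n. (x i (len i) - int (d i)) * (x i (len i) - int (d i) - 1)) - 2 * (\<Sum>i<n. int (tri (d i))))" .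
  \<comment> \<open>Since \<open>n\<close> and all \<open>d i\<close> are at most
    \<open>total\<close>, the natural subtraction in \<open>bound\<close> does not truncate.\<close>
  have "(\<Sum>i<n. tri (d i)) \<le> (\<Sum>i<n. tri total)"
    unfolding tri_def by (intro sum_mono sum_mono2) (use d_le in fastforce)+
  also have "\<dots> \<le> Suc total * tri total" by (auto intro!: mult_le_mono1 n_le_total trans_le_add2)
  finally have "int bound = int (Suc total * tri total + total * (\<Sum>i<n. \<Sum>k<K. tri (l i k - 1))) - int (\<Sum>i<n. tri (d i))"
    unfolding bound_def by (intro of_nat_diff) linarith
  then have "int bound = (?T + 1) * int (tri total) + ?T * (\<Sum>i<n. \<Sum>k<K. int (tri (l i k - 1))) - (\<Sum>i<n. int (tri (d i)))"
    by (simp only: of_nat_add of_nat_mult of_nat_Suc of_nat_sum add.commute[of 1])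
  moreover have "2 * (t + 1) * a + 2 * t * b + (e - 2 * c) = 2 * ((t + 1) * a + t * b' - c) + 2 * t * (b - b') + e"
    for t a b b' c e :: int by (simp add: algebra_simps)
  ultimately show ?thesis unfolding A sum_subtractf by (simp only:)
qed

text \<open>In an increasing integer sequence, the message \<open>r\<close> of a block is at least
  \<open>l i k - r\<close> slots ahead of the end. If the sums agree, so does every summand, which
  makes the slots consecutive.\<close>

lemma spread_ge:
  assumes inc: "\<And>r r'. 1 \<le> r \<Longrightarrow> r < r' \<Longrightarrow> r' \<le> l i k \<Longrightarrow> x (pre i k + r) < x (pre i k + r')"
  shows "int (tri (l i k - 1)) \<le> spread x i k"
    and "spread x i k = int (tri (l i k - 1)) \<Longrightarrow> r \<in> {1..l i k} \<Longrightarrow>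
      x (pre i k + r) = x (pre i k + 1) + int r - 1"
proof -
  have t: "(\<Sum>r = 1..l i k. int (l i k) - int r) = int (tri (l i k - 1))"
  proof -
    have "(\<Sum>r = 1..l i k. int (l i k) - int r) = (\<Sum>r<l i k. int r)"
      by (rule sum.reindex_bij_witness[of _ "\<lambda>r. l i k - r" "\<lambda>r. l i k - r"]) auto
    then show ?thesis by (cases "l i k") (auto simp: tri_def)
  qed
  have ge: "int (l i k) - int r \<le> x (pre i (Suc k)) - x (pre i k + r)" if "r \<in> {1..l i k}" for r
  proof -
    have "x (pre i k + r) + int q \<le> x (pre i k + (r + q))" if "r + q \<le> l i k" for q
      using that
    proof (induction q)
      case (Suc q)
      then show ?case using inc[of "r + q" "r + Suc q"] \<open>r \<in> _\<close> by auto
    qed simp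
    from this[of "l i k - r"] that show ?thesis by (auto simp: pre_Suc of_nat_diff)
  qed
  show "int (tri (l i k - 1)) \<le> spread x i k"
    unfolding spread_def t[symmetric] by (rule sum_mono) (rule ge)
  assume eq: "spread x i k = int (tri (l i k - 1))"
  have z: "x (pre i (Suc k)) - x (pre i k + r) = int (l i k) - int r" if r: "r \<in> {1..l i k}" for r
  proof -
    have "(\<Sum>r = 1..l i k. (x (pre i (Suc k)) - x (pre i k + r)) - (int (l i k) - int r)) = 0"
      using eq t unfolding spread_def by (simp add: sum_subtractf)
    then have "\<forall>r\<in>{1..l i k}. (x (pre i (Suc k)) - x (pre i k + r)) - (int (l i k) - int r) = 0"
      using ge by (subst (asm) sum_nonneg_eq_0_iff) auto
    then show ?thesis using r by auto
  qed
  assume r: "r \<in> {1..l i k}"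
  then have "1 \<in> {1..l i k}" by auto
  from z[OF r] z[OF this] show "x (pre i k + r) = x (pre i k + 1) + int r - 1" by linarith
qed

section \<open>Equivalence of the age bound with the existence of a placement\<close>

lemma consecutive_product_nonneg: "0 \<le> (a :: int) * (a - 1)"
  by (cases "a \<le> 0") (auto intro: mult_nonpos_nonpos)

theorem placed_if_bounded:
  assumes f: "feasible inst S" and A: "Age inst S \<le> int bound"
  shows "\<exists>st. placed st"
proof -
  define x where "x i j = int (S (Suc i, j)) - int (T0 inst)" for i j
  have bij: "bij_betw S (messages inst) {T0 inst + 1..T0 inst + total}"
    using f by (simp add: feasible_def total_msgs_inst)
  have mem: "(Suc i, j) \<in> messages inst" if "i < n" "1 \<le> j" "j \<le> len i" for i j
    using that by (auto simp: messages_def inst_def)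
  have rng: "1 \<le> x i j" "x i j \<le> int total" if "i < n" "1 \<le> j" "j \<le> len i" for i j
  proof -
    have "S (Suc i, j) \<in> {T0 inst + 1..T0 inst + total}" using mem[OF that] bij by (auto simp: bij_betw_def)
    then show "1 \<le> x i j" "x i j \<le> int total" by (auto simp: x_def)
  qed
  have inj: "i = i' \<and> j = j'" if "x i j = x i' j'" "i < n" "1 \<le> j" "j \<le> len i" "i' < n" "1 \<le> j'" "j' \<le> len i'" for i j i' j'
  proof -
    have "S (Suc i, j) = S (Suc i', j')" using that(1) by (simp add: x_def)
    with bij mem[OF that(2-4)] mem[OF that(5-7)] have "(Suc i, j) = (Suc i', j')"
      unfolding bij_betw_def by (meson inj_onD)
    then show ?thesis by simp
  qed
  have inc: "x i j < x i j'" if "i < n" "1 \<le> j" "j < j'" "j' \<le> len i" for i j j'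
    using f that unfolding feasible_def x_def by (auto simp: inst_sel)
  have inc': "x i (pre i k + r) < x i (pre i k + r')"
    if "i < n" "k \<le> K" "1 \<le> r" "r < r'" "r' \<le> l i k" for i k r r'
    using that pre_mono[of "Suc k" "Suc K" i] by (intro inc) (auto simp: pre_Suc len_def)
  let ?s = "\<Sum>i<n. \<Sum>k<K. spread (x i) i k - int (tri (l i k - 1))"
  let ?e = "\<Sum>i<n. (x i (len i) - int (d i)) * (x i (len i) - int (d i) - 1)"
  have s: "0 \<le> spread (x i) i k - int (tri (l i k - 1))" if "i < n" "k < K" for i k
    using spread_ge(1)[of i k "x i"] inc'[OF that(1), of k] that by simp
  have s0: "0 \<le> ?s" using s by (intro sum_nonneg) auto
  have e0: "0 \<le> ?e" by (intro sum_nonneg) (auto intro: consecutive_product_nonneg)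
  have tpos: "0 < int total" using n n_le_total by linarith
  have le: "2 * int total * ?s + ?e \<le> 0"
    using Age_inst[OF f, folded x_def] A by linarith
  have "0 \<le> 2 * int total * ?s" using s0 tpos by simp
  with le e0 have "?e = 0" "2 * int total * ?s = 0" by linarith+
  then have e: "?e = 0" and s': "?s = 0" using tpos by auto
  have "\<forall>i\<in>{..<n}. (\<Sum>k<K. spread (x i) i k - int (tri (l i k - 1))) = 0"
    using s' s by (subst (asm) sum_nonneg_eq_0_iff) (auto intro!: sum_nonneg)
  then have sp: "spread (x i) i k = int (tri (l i k - 1))" if "i < n" "k < K" for i k
    using that s[OF that(1)] sum_nonneg_eq_0_iff[of "{..<K}" "\<lambda>k. spread (x i) i k - int (tri (l i k - 1))"] by auto
  have "\<forall>i\<in>{..<n}. (x i (len i) - int (d i)) * (x i (len i) - int (d i) - 1) = 0"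
    using e by (subst (asm) sum_nonneg_eq_0_iff) (auto intro: consecutive_product_nonneg)
  then have tgt: "x i (len i) = int (d i) \<or> x i (len i) = int (d i) + 1" if "i < n" for i
    using that by fastforce
  \<comment> \<open>A piece occupies the slots after \<open>st\<close>, hence the subtraction of 1.
    Empty pieces receive some value too; \<open>placed\<close> constrains nonempty ones.\<close>
  define st where "st i k = nat (x i (pre i k + 1) - 1)" for i k
  have X: "x i (pre i k + r) = int (st i k) + int r" if "i < n" "k \<le> K" "r \<in> {1..l i k}" for i k r
  proof -
    have "x i (pre i k + r) = x i (pre i k + 1) + int r - 1"
    proof (cases "k = K")
      case True
      then show ?thesis using that l_last by auto
    next
      case False
      then show ?thesis using spread_ge(2)[of i k "x i" r] inc'[OF that(1), of k] that sp[of i k] by simp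
    qed
    moreover have "1 \<le> x i (pre i k + 1)"
      using that pre_mono[of "Suc k" "Suc K" i] by (intro rng) (auto simp: pre_Suc len_def)
    ultimately show ?thesis by (simp add: st_def)
  qed
  have inl: "1 \<le> pre i k + r" "pre i k + r \<le> len i" if "k \<le> K" "r \<in> {1..l i k}" for i k r
    using that pre_mono[of "Suc k" "Suc K" i] by (auto simp: pre_Suc len_def)
  have ordered: "st i k + l i k \<le> st i k'" if "i < n" "k < k'" "k' \<le> K" "0 < l i k" "0 < l i k'" for i k k'
  proof -
    have "x i (pre i k + l i k) < x i (pre i k' + 1)"
      using that pre_mono[of "Suc k" k' i] inl[of k "l i k" i] inl[of k' 1 i]
      by (intro inc) (auto simp: pre_Suc)
    then show ?thesis using X[of i k "l i k"] X[of i k' 1] that by simp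
  qed
  have disj: "\<not> (st i k \<le> st i' k' \<and> st i' k' < st i k + l i k)"
    if "i < n" "i' < n" "k \<le> K" "k' \<le> K" "i \<noteq> i'" "0 < l i k" "0 < l i' k'" for i i' k k'
  proof
    assume a: "st i k \<le> st i' k' \<and> st i' k' < st i k + l i k"
    \<comment> \<open>The message of piece \<open>(i, k)\<close> that would share its slot with the
      first message of \<open>(i', k')\<close>.\<close>
    let ?r = "Suc (st i' k') - st i k"
    have r: "?r \<in> {1..l i k}" using a by auto
    have "x i (pre i k + ?r) = x i' (pre i' k' + 1)"
      using X[OF that(1,3) r] X[of i' k' 1] that a by simp
    then have "i = i'" using inj inl[OF that(3) r] inl[of k' 1 i'] that by auto
    then show False using that by simp
  qed
  have "placed st"
    unfolding placed_def
  proof (intro conjI allI impI)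
    fix i k assume "i < n" "k \<le> K" "0 < l i k"
    then show "st i k + l i k \<le> total"
      using X[of i k "l i k"] rng(2)[of i "pre i k + l i k"] inl[of k "l i k" i] by simp
  next
    fix i i' k k' assume a: "i < n" "i' < n" "k \<le> K" "k' \<le> K" "(i, k) \<noteq> (i', k') \<and> 0 < l i k \<and> 0 < l i' k'"
    show "st i k + l i k \<le> st i' k' \<or> st i' k' + l i' k' \<le> st i k"
    proof (cases "i = i'")
      case True
      then show ?thesis using ordered[of i k k'] ordered[of i k' k] a by (cases "k < k'") auto
    next
      case False
      then show ?thesis using disj[of i i' k k'] disj[of i' i k' k] a by linarith
    qed
  next
    fix i k k' assume "i < n" "k < k' \<and> k' \<le> K \<and> 0 < l i k \<and> 0 < l i k'"
    then show "st i k + l i k \<le> st i k'" using ordered by auto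
  next
    fix i assume i: "i < n"
    have "x i (len i) = int (st i K) + 1" using X[OF i, of K 1] l_last by (simp add: len_eq)
    then show "d i = st i K \<or> d i = Suc (st i K)" using tgt[OF i] by linarith
  qed
  then show ?thesis by blast
qed

theorem bounded_if_placed:
  assumes st: "placed st"
  shows "\<exists>S. feasible inst S \<and> Age inst S \<le> int bound"
proof -
  \<comment> \<open>The first block whose end reaches \<open>j\<close>; taking the least one skips
    empty blocks.\<close>
  define blk where "blk i j = (LEAST k. j \<le> pre i (Suc k))" for i j
  have blk: "blk i j \<le> K" "pre i (blk i j) < j" "j \<le> pre i (blk i j) + l i (blk i j)" if "1 \<le> j" "j \<le> len i" for i j
  proof -
    show "blk i j \<le> K" unfolding blk_def using that by (intro Least_le) (simp add: len_def)
    show "j \<le> pre i (blk i j) + l i (blk i j)"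
      using LeastI[of "\<lambda>k. j \<le> pre i (Suc k)" K] that by (simp add: blk_def len_def pre_Suc)
    show "pre i (blk i j) < j"
    proof (cases "blk i j")
      case 0
      then show ?thesis using that by (simp add: pre_def)
    next
      case (Suc k)
      then have "\<not> j \<le> pre i (Suc k)" using not_less_Least[of k "\<lambda>k. j \<le> pre i (Suc k)"] by (simp add: blk_def)
      then show ?thesis using Suc by simp
    qed
  qed
  have blk_eq: "blk i (pre i k + r) = k" if "r \<in> {1..l i k}" "k \<le> K" for i k r
    unfolding blk_def
  proof (rule Least_equality)
    show "pre i k + r \<le> pre i (Suc k)" using that by (auto simp: pre_Suc)
    fix k' assume "pre i k + r \<le> pre i (Suc k')"
    then have "\<not> pre i (Suc k') \<le> pre i k" using that by auto
    then show "k \<le> k'" using pre_mono[of "Suc k'" k i] by (meson not_less_eq_eq)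
  qed
  have blk_pos: "0 < l i (blk i j)" if "1 \<le> j" "j \<le> len i" for i j
    using blk(2,3)[OF that] by linarith
  note P = st[unfolded placed_def]
  note st1 = conjunct1[OF P, rule_format]
  note st2 = conjunct1[OF conjunct2[OF P], rule_format]
  note st3 = conjunct1[OF conjunct2[OF conjunct2[OF P]], rule_format]
  note st4 = conjunct2[OF conjunct2[OF conjunct2[OF P]], rule_format]
  define y where "y i j = st i (blk i j) + (j - pre i (blk i j))" for i j
  define S where "S = (\<lambda>(i, j). T0 inst + y (i - 1) j)"
  have rng: "1 \<le> y i j" "y i j \<le> total" if "i < n" "1 \<le> j" "j \<le> len i" for i j
    using blk[OF that(2,3)] blk_pos[OF that(2,3)] st1[of i "blk i j"] that by (auto simp: y_def)
  have inc: "y i j < y i j'" if "i < n" "1 \<le> j" "j < j'" "j' \<le> len i" for i j j'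
  proof -
    have j: "1 \<le> j" "j \<le> len i" and j': "1 \<le> j'" "j' \<le> len i" using that by auto
    show ?thesis
    proof (cases "blk i j = blk i j'")
      case True
      then show ?thesis using blk(2)[OF j] that by (simp add: y_def)
    next
      case False
      have "blk i j < blk i j'"
      proof (rule ccontr)
        assume "\<not> blk i j < blk i j'"
        then have "Suc (blk i j') \<le> blk i j" using False by auto
        from pre_mono[OF this, of i] have "pre i (blk i j') + l i (blk i j') \<le> pre i (blk i j)"
          by (simp add: pre_Suc)
        then show False using blk[OF j] blk[OF j'] that by linarith
      qed
      then have "st i (blk i j) + l i (blk i j) \<le> st i (blk i j')"
        using st3[OF that(1)] blk_pos[OF j] blk_pos[OF j'] blk(1)[OF j'] by blast
      then show ?thesis using blk[OF j] blk[OF j'] by (simp add: y_def)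
    qed
  qed
  have inj: "i = i' \<and> j = j'" if "y i j = y i' j'" "i < n" "1 \<le> j" "j \<le> len i" "i' < n" "1 \<le> j'" "j' \<le> len i'" for i j i' j'
  proof (cases "i = i'")
    case True
    then show ?thesis using inc[of i j j'] inc[of i j' j] that by (metis less_irrefl linorder_neqE_nat)
  next
    case False
    then show ?thesis
      using st2[of i i' "blk i j" "blk i' j'"] blk[OF that(3,4)] blk[OF that(6,7)] blk_pos[OF that(3,4)] blk_pos[OF that(6,7)] that
      by (auto simp: y_def)
  qed
  have card: "card (messages inst) = total"
  proof -
    have "card (messages inst) = (\<Sum>i = 1..n. len (i - 1))"
      unfolding messages_def by (subst card_SigmaI) (auto simp: inst_sel)
    also have "\<dots> = total" unfolding total_def
      by (rule sum.reindex_bij_witness[of _ Suc "\<lambda>i. i - 1"]) auto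
    finally show ?thesis .
  qed
  have fin: "finite (messages inst)" unfolding messages_def by auto
  have S: "S (i, j) = T0 inst + y (i - 1) j" for i j by (simp add: S_def)
  have memD: "i - 1 < n \<and> 1 \<le> i \<and> 1 \<le> j \<and> j \<le> len (i - 1)" if "(i, j) \<in> messages inst" for i j
    using that by (auto simp: messages_def inst_sel)
  have injS: "inj_on S (messages inst)"
  proof (rule inj_onI, clarify)
    fix i j i' j' assume a: "(i, j) \<in> messages inst" "(i', j') \<in> messages inst" "S (i, j) = S (i', j')"
    then have "i - 1 = i' - 1 \<and> j = j'"
      using inj[of "i - 1" j "i' - 1" j'] memD[OF a(1)] memD[OF a(2)] by (simp add: S)
    then show "i = i' \<and> j = j'" using memD[OF a(1)] memD[OF a(2)] by auto
  qed
  have "S ` messages inst \<subseteq> {T0 inst + 1..T0 inst + total}"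
  proof clarify
    fix i j assume "(i, j) \<in> messages inst"
    from memD[OF this] show "S (i, j) \<in> {T0 inst + 1..T0 inst + total}"
      using rng[of "i - 1" j] by (simp add: S)
  qed
  moreover have "card (S ` messages inst) = card {T0 inst + 1..T0 inst + total}"
    using card_image[OF injS] card by simp
  ultimately have "S ` messages inst = {T0 inst + 1..T0 inst + total}"
    by (intro card_subset_eq) auto
  then have bij: "bij_betw S (messages inst) {T0 inst + 1..T0 inst + total_msgs inst}"
    using injS by (simp add: bij_betw_def total_msgs_inst)
  have f: "feasible inst S"
    unfolding feasible_def
  proof (intro conjI bij ballI allI impI)
    fix i j k assume "i \<in> {1..senders inst}" "1 \<le> j \<and> j < k \<and> k \<le> msgs inst i"
    then show "S (i, j) < S (i, k)" using inc[of "i - 1" j k] by (auto simp: S inst_sel)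
  qed
  define x where "x i j = int (S (Suc i, j)) - int (T0 inst)" for i j
  have x: "x i j = int (y i j)" for i j by (simp add: x_def S)
  have "spread (x i) i k = int (tri (l i k - 1))" if "i < n" "k < K" for i k
  proof -
    have "spread (x i) i k = (\<Sum>r = 1..l i k. int (l i k) - int r)"
      unfolding spread_def
    proof (intro sum.cong refl)
      fix r assume r: "r \<in> {1..l i k}"
      then have "l i k \<in> {1..l i k}" by auto
      with r show "x i (pre i (Suc k)) - x i (pre i k + r) = int (l i k) - int r"
        using blk_eq[of r i k] blk_eq[of "l i k" i k] that by (simp add: x y_def pre_Suc)
    qed
    also have "\<dots> = (\<Sum>r<l i k. int r)"
      by (rule sum.reindex_bij_witness[of _ "\<lambda>r. l i k - r" "\<lambda>r. l i k - r"]) auto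
    also have "\<dots> = int (tri (l i k - 1))" by (cases "l i k") (auto simp: tri_def)
    finally show ?thesis .
  qed
  moreover have "(x i (len i) - int (d i)) * (x i (len i) - int (d i) - 1) = 0" if "i < n" for i
    using st4[OF that] blk_eq[of 1 i K] l_last by (auto simp: x y_def len_eq)
  ultimately have "(\<Sum>i<n. \<Sum>k<K. spread (x i) i k - int (tri (l i k - 1))) = 0"
    "(\<Sum>i<n. (x i (len i) - int (d i)) * (x i (len i) - int (d i) - 1)) = 0"
    by (auto intro!: sum.neutral)
  then have "2 * Age inst S = 2 * int bound"
    using Age_inst[OF f, folded x_def] by simp
  then show ?thesis using f by auto
qed

end

section \<open>From satisfiability to chains\<close>

context good_chains
begin

section \<open>Tilings of the time axis by pieces\<close>

definition pieces :: "(nat \<times> nat) set" where "pieces = {..<n} \<times> {..K}"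

abbreviation pl :: "nat \<times> nat \<Rightarrow> nat" where "pl p \<equiv> l (fst p) (snd p)"

lemma total_pieces: "total = (\<Sum>p\<in>pieces. pl p)"
proof -
  have "(\<Sum>p\<in>pieces. pl p) = (\<Sum>i<n. \<Sum>k\<in>{..K}. l i k)"
    unfolding pieces_def by (simp add: sum.cartesian_product case_prod_beta)
  also have "\<dots> = total"
    unfolding total_def len_def pre_def lessThan_Suc_atMost ..
  finally show ?thesis by simp
qed

lemma finite_pieces: "finite pieces" by (simp add: pieces_def)

text \<open>The nonempty pieces are disjoint intervals inside \<open>{..<total}\<close> of total
  length \<open>total\<close>, so they tile it. No piece straddles the start of a last message, and
  the time before it is filled by complete pieces.\<close>

lemma placed_cut:
  assumes st: "placed st" and i: "i < n"
  shows "st i K = (\<Sum>p | p \<in> pieces \<and> 0 < pl p \<and> st (fst p) (snd p) + pl p \<le> st i K. pl p)"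
proof -
  note P = st[unfolded placed_def]
  note st1 = conjunct1[OF P, rule_format]
  note st2 = conjunct1[OF conjunct2[OF P], rule_format]
  define J where "J p = {st (fst p) (snd p)..<st (fst p) (snd p) + pl p}" for p
  let ?P = "{p \<in> pieces. 0 < pl p}"
  let ?B = "{p. p \<in> pieces \<and> 0 < pl p \<and> st (fst p) (snd p) + pl p \<le> st i K}"
  have fin: "finite ?P" "finite ?B" using finite_pieces by auto
  have disj: "J p \<inter> J q = {}" if "p \<in> ?P" "q \<in> ?P" "p \<noteq> q" for p q
    using st2[of "fst p" "fst q" "snd p" "snd q"] that unfolding J_def pieces_def
    by (cases p; cases q) auto
  have cardJ: "card (\<Union>p\<in>A. J p) = (\<Sum>p\<in>A. pl p)" if "A \<subseteq> ?P" for A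
  proof -
    have "card (\<Union>p\<in>A. J p) = (\<Sum>p\<in>A. card (J p))"
    proof (rule card_UN_disjoint)
      show "finite A" using that fin(1) by (rule finite_subset)
      show "\<forall>p\<in>A. finite (J p)" by (simp add: J_def)
      show "\<forall>p\<in>A. \<forall>q\<in>A. p \<noteq> q \<longrightarrow> J p \<inter> J q = {}" using disj that by blast
    qed
    then show ?thesis by (simp add: J_def)
  qed
  have "(\<Sum>p\<in>?P. pl p) = total"
    unfolding total_pieces by (rule sum.mono_neutral_left) (auto simp: finite_pieces)
  then have "card (\<Union>p\<in>?P. J p) = card {..<total}" using cardJ[of ?P] by simp
  moreover have "(\<Union>p\<in>?P. J p) \<subseteq> {..<total}"
  proof
    fix t assume "t \<in> (\<Union>p\<in>?P. J p)"
    then obtain i k where "t \<in> J (i, k)" "(i, k) \<in> pieces" "0 < l i k" by auto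
    then show "t \<in> {..<total}" using st1[of i k] by (auto simp: J_def pieces_def)
  qed
  ultimately have tile: "(\<Union>p\<in>?P. J p) = {..<total}" by (intro card_subset_eq) auto
  have iK: "(i, K) \<in> ?P" using i l_last by (auto simp: pieces_def)
  have "(\<Union>p\<in>?B. J p) = {..<st i K}"
  proof (intro equalityI subsetI)
    fix t assume "t \<in> {..<st i K}"
    then have t: "t < st i K" by simp
    then have "t \<in> (\<Union>p\<in>?P. J p)" unfolding tile using st1[of i K] i l_last by simp
    then obtain p where p: "p \<in> ?P" "t \<in> J p" by blast
    have "st (fst p) (snd p) + pl p \<le> st i K \<or> st i K + l i K \<le> st (fst p) (snd p) \<or> p = (i, K)"
      using st2[of "fst p" i "snd p" K] p i l_last[of i] by (cases p) (auto simp: pieces_def)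
    then have "p \<in> ?B" using p t by (auto simp: J_def)
    then show "t \<in> (\<Union>p\<in>?B. J p)" using p by blast
  qed (auto simp: J_def)
  then have "st i K = card (\<Union>p\<in>?B. J p)" by simp
  also have "\<dots> = (\<Sum>p\<in>?B. pl p)" by (rule cardJ) auto
  finally show ?thesis .
qed

lemma placed_by_key:
  fixes key :: "nat \<times> nat \<Rightarrow> nat"
  defines "st \<equiv> \<lambda>i k. \<Sum>p | p \<in> pieces \<and> key p < key (i, k). pl p"
  assumes inj: "inj_on key {p \<in> pieces. 0 < pl p}"
    and ord: "\<And>i k k'. i < n \<Longrightarrow> k < k' \<Longrightarrow> k' \<le> K \<Longrightarrow> 0 < l i k \<Longrightarrow> 0 < l i k' \<Longrightarrow> key (i, k) < key (i, k')"
    and tgt: "\<And>i. i < n \<Longrightarrow> d i = Suc (st i K)"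
  shows "placed st"
proof -
  have ins: "st i k + l i k = (\<Sum>p\<in>insert (i, k) {p. p \<in> pieces \<and> key p < key (i, k)}. pl p)" for i k
    unfolding st_def by (subst sum.insert) (auto simp: finite_pieces)
  have lt: "st i k + l i k \<le> st i' k'" if "(i, k) \<in> pieces" "key (i, k) < key (i', k')" for i k i' k'
    unfolding ins unfolding st_def using that by (intro sum_mono2) (auto simp: finite_pieces)
  show ?thesis
    unfolding placed_def
  proof (intro conjI allI impI)
    fix i k assume "i < n" "k \<le> K"
    then show "st i k + l i k \<le> total"
      unfolding ins total_pieces by (intro sum_mono2) (auto simp: finite_pieces pieces_def)
  next
    fix i i' k k' assume a: "i < n" "i' < n" "k \<le> K" "k' \<le> K" "(i, k) \<noteq> (i', k') \<and> 0 < l i k \<and> 0 < l i' k'"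
    then have "key (i, k) \<noteq> key (i', k')" using inj_onD[OF inj, of "(i, k)" "(i', k')"] by (auto simp: pieces_def)
    then consider "key (i, k) < key (i', k')" | "key (i', k') < key (i, k)" by linarith
    then show "st i k + l i k \<le> st i' k' \<or> st i' k' + l i' k' \<le> st i k"
      using lt[of i k i' k'] lt[of i' k' i k] a by cases (auto simp: pieces_def)
  next
    fix i k k' assume "i < n" "k < k' \<and> k' \<le> K \<and> 0 < l i k \<and> 0 < l i k'"
    then show "st i k + l i k \<le> st i k'" using ord[of i k k'] lt[of i k i k'] by (auto simp: pieces_def)
  next
    fix i assume "i < n"
    then show "d i = st i K \<or> d i = Suc (st i K)" using tgt by simp
  qed
qed

end

text \<open>Satisfiability over the domain \<open>{..<D}\<close>: \<open>C j v d\<close> means that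
  clause \<open>j\<close> contains the literal \<open>v = d\<close>.\<close>

definition msat :: "nat \<Rightarrow> nat \<Rightarrow> nat \<Rightarrow> (nat \<Rightarrow> nat \<Rightarrow> nat \<Rightarrow> bool) \<Rightarrow> bool" where
  "msat V D m C \<longleftrightarrow> (\<exists>\<alpha>. (\<forall>v<V. \<alpha> v < D) \<and> (\<forall>j<m. \<exists>v<V. C j v (\<alpha> v)))"

section \<open>Bins, separators and fillers\<close>

locale clauses =
  fixes V D m :: nat and C :: "nat \<Rightarrow> nat \<Rightarrow> nat \<Rightarrow> bool"
begin

text \<open>For \<open>c < V + m\<close> these are distinct even numbers from
  \<open>2 * (V + m)\<close> to below twice that, so two blocks never fit where one is prescribed,
  and the length identifies the kind \<open>c\<close>.\<close>

definition size :: "nat \<Rightarrow> nat" where "size c = 2 * (V + m + c)"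
definition items :: nat where "items = V * D + m * V"
definition bins :: nat where "bins = V + m * Suc V"
text \<open>At least the joint length of all bins, each of which is shorter than
  \<open>4 * (V + m)\<close>.\<close>

definition big :: nat where "big = 4 * (V + m) * Suc bins"
text \<open>The kind of block that bin \<open>b\<close> must hold: kind \<open>v\<close> for
  variable \<open>v\<close>, kind \<open>V + j\<close> for clause \<open>j\<close>.\<close>

definition letter :: "nat \<Rightarrow> nat" where "letter b = (if b < V then b else V + (b - V) div Suc V)"

text \<open>Chains \<open>i < V * D\<close> belong to the literals (variable \<open>i div D\<close>, value \<open>i mod D\<close>), the next \<open>m * V\<close>
  chains are the fillers, \<open>V\<close> for each clause, and all further chains are separators. The blocks of length
  \<open>big\<close> fit into no bin; they ensure that the last messages of the literals and fillers come after all
  separators. Block lengths are even so that a separator cannot be late by one slot.\<close>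
definition blen :: "nat \<Rightarrow> nat \<Rightarrow> nat" where
  "blen i k = (if k = m + 2 then 1 else if items \<le> i then 0 else if k = m + 1 then big
    else if k = 0 then (if i < V * D then size (i div D) else 0)
    else if i < V * D then (if C (k - 1) (i div D) (i mod D) then size (V + (k - 1)) else 0)
    else if (i - V * D) div V = k - 1 then size (V + (k - 1)) else 0)"

definition load :: nat where "load = (\<Sum>i<items. \<Sum>k<m + 2. blen i k)"

text \<open>The last messages of the items close the schedule, in the order of \<open>i\<close>,
  behind all blocks and all separators. The separator with index \<open>b = i - items\<close> has
  \<open>b + 1\<close> bins and \<open>b\<close> separators in front of it.\<close>

definition target :: "nat \<Rightarrow> nat" where
  "target i = (if i < items then load + bins + 1 + i
    else (\<Sum>b<Suc (i - items). size (letter b)) + Suc (i - items))"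

end

locale pos_clauses = clauses +
  assumes V: "1 \<le> V" and D: "1 \<le> D"
begin

abbreviation "Z \<equiv> V + m"

declare add_2_eq_Suc' [simp del]

lemma letter_less: "b < bins \<Longrightarrow> letter b < Z"
proof -
  assume b: "b < bins"
  show ?thesis
  proof (cases "b < V")
    case False
    then have "(b - V) div Suc V < m" using b by (simp add: bins_def less_mult_imp_div_less)
    then show ?thesis using False by (simp add: letter_def)
  qed (use V in \<open>simp add: letter_def\<close>)
qed

lemma size_bounds: "2 * Z \<le> size c" "c < Z \<Longrightarrow> size c < 4 * Z" "even (size c)"
  by (auto simp: size_def)

lemma size_inj: "size c = size c' \<longleftrightarrow> c = c'" by (auto simp: size_def)

lemma items_pos: "1 \<le> items" using V D by (simp add: items_def) (metis One_nat_def mult_le_mono nat_mult_1 trans_le_add1)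

lemma prefix_le: "b \<le> bins \<Longrightarrow> (\<Sum>b'<b. size (letter b')) \<le> big"
proof -
  assume b: "b \<le> bins"
  have "(\<Sum>b'<b. size (letter b')) \<le> (\<Sum>b'<b. 4 * Z)"
    by (rule sum_mono) (use letter_less size_bounds(2) b in \<open>force intro: less_imp_le\<close>)
  also have "\<dots> \<le> 4 * Z * Suc bins" using b by (simp add: mult.commute[of _ "4 * Z"] del: mult_Suc_right)
  finally show ?thesis by (simp add: big_def)
qed

text \<open>Together with \<open>prefix_le\<close> this places the targets of all items behind those
  of all separators.\<close>

lemma big_le_load: "big \<le> load"
proof -
  have "big = blen 0 (m + 1)" using items_pos by (simp add: blen_def)
  also have "\<dots> \<le> (\<Sum>k<m + 2. blen 0 k)" by (rule member_le_sum) auto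
  also have "\<dots> \<le> load" unfolding load_def using items_pos by (intro member_le_sum[of 0]) auto
  finally show ?thesis .
qed

lemma total_eq: "chains.total (items + bins) (m + 2) blen = load + items + bins"
proof -
  have "chains.len (m + 2) blen i = (\<Sum>k<m + 2. blen i k) + 1" for i
    unfolding chains.len_def chains.pre_def sum.lessThan_Suc by (simp add: blen_def[of i "m + 2"])
  moreover have "(\<Sum>i<items + bins. \<Sum>k<m + 2. blen i k) = load"
    unfolding load_def by (rule sum.mono_neutral_right) (auto simp: blen_def)
  ultimately show ?thesis unfolding chains.total_def
    by (simp add: sum_Suc del: sum.lessThan_Suc add_2_eq_Suc')
qed

sublocale good_chains "items + bins" "m + 2" blen target
proof
  show "1 \<le> items + bins" using items_pos by simp
  show "blen i (m + 2) = 1" for i by (simp add: blen_def)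
  fix i assume i: "i < items + bins"
  show "target i \<le> chains.total (items + bins) (m + 2) blen"
  proof (cases "i < items")
    case False
    then have "(\<Sum>b<Suc (i - items). size (letter b)) \<le> load"
      using prefix_le[of "Suc (i - items)"] big_le_load i by linarith
    then show ?thesis unfolding total_eq using False i by (simp add: target_def del: sum.lessThan_Suc)
  qed (simp only: target_def total_eq if_True)
qed

text \<open>\<open>size\<close> is injective and \<open>big\<close> exceeds every size of a kind
  below \<open>Z\<close>, so the length of a block tells which bins it is made for.\<close>

lemma item_block:
  assumes "i < items" "k < m + 2" "0 < blen i k"
  shows "even (blen i k)" "2 * Z \<le> blen i k"
    "c < Z \<Longrightarrow> blen i k = size c \<Longrightarrow>
      (k = 0 \<and> c < V \<and> i < V * D \<and> i div D = c) \<or>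
      (\<exists>j<m. k = Suc j \<and> c = V + j \<and> (i < V * D \<and> C j (i div D) (i mod D) \<or> V * D \<le> i \<and> (i - V * D) div V = j))"
proof -
  have d: "i div D < V" if "i < V * D" using that by (simp add: less_mult_imp_div_less)
  have big: "even big" "4 * Z \<le> big" by (auto simp: big_def)
  show "even (blen i k)" using assms(2) size_bounds(3) big by (auto simp: blen_def)
  show "2 * Z \<le> blen i k" using assms(2,3) size_bounds(1) big unfolding blen_def by (auto split: if_splits)
  assume c: "c < Z" "blen i k = size c"
  have nb: "size c \<noteq> big" using size_bounds(2)[OF c(1)] big by linarith
  show "(k = 0 \<and> c < V \<and> i < V * D \<and> i div D = c) \<or>
      (\<exists>j<m. k = Suc j \<and> c = V + j \<and> (i < V * D \<and> C j (i div D) (i mod D) \<or> V * D \<le> i \<and> (i - V * D) div V = j))"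
  proof (cases k)
    case 0
    then show ?thesis using assms c nb d by (auto simp: blen_def size_inj split: if_splits)
  next
    case (Suc j)
    then have "k \<noteq> m + 1" using assms c nb by (auto simp: blen_def)
    then have j: "j < m" using Suc assms(2) by auto
    then have "c = V + j" using Suc assms c by (auto simp: blen_def size_inj split: if_splits)
    then show ?thesis using Suc assms c j by (auto simp: blen_def split: if_splits)
  qed
qed

section \<open>From a placement to a satisfying assignment\<close>

theorem msat_if_placed:
  assumes st: "placed st"
  shows "msat V D m C"
proof -
  note P = st[unfolded placed_def]
  note st3 = conjunct1[OF conjunct2[OF conjunct2[OF P]], rule_format]
  note st4 = conjunct2[OF conjunct2[OF conjunct2[OF P]], rule_format]
  define X where "X b = st (items + b) (m + 2)" for b
  define Pr where "Pr b = (\<Sum>b'<b. size (letter b'))" for b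
  define At where "At t = {p. p \<in> {..<items} \<times> {..<m + 2} \<and> 0 < pl p \<and> st (fst p) (snd p) + pl p \<le> t}" for t
  have finA: "finite (At t)" for t unfolding At_def by (rule finite_subset[of _ "{..<items} \<times> {..<m + 2}"]) auto
  have Z: "1 \<le> Z" using V by simp
  have X: "X b = Pr (Suc b) + b \<or> X b = Pr (Suc b) + Suc b" if "b < bins" for b
    using st4[of "items + b"] that by (auto simp: X_def target_def Pr_def simp del: sum.lessThan_Suc)
  have Pr_mono: "Pr b + 2 * Z \<le> Pr b'" if "b < b'" for b b'
  proof -
    have "Pr b + size (letter b) = Pr (Suc b)" by (simp add: Pr_def)
    also have "\<dots> \<le> Pr b'" unfolding Pr_def using that by (intro sum_mono2) auto
    finally show ?thesis using size_bounds(1)[of "letter b"] by linarith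
  qed
  have X_mono: "X b < X b'" if "b < b'" "b' < bins" for b b'
    using X[of b] X[OF that(2)] Pr_mono[OF Suc_mono[OF that(1)]] that Z by auto
  have Pr_even: "even (Pr b)" for b unfolding Pr_def using size_bounds(3) by (intro dvd_sum) auto
  \<comment> \<open>By \<open>placed_cut\<close>, \<open>X b\<close> is the length of the item
    blocks in front of separator \<open>b\<close> plus the \<open>b\<close> earlier separators. Item
    blocks and \<open>Pr\<close> are even, so of the two possible values of \<open>X b\<close> only
    \<open>Pr (Suc b) + b\<close> remains.\<close>
  have sumA: "(\<Sum>p\<in>At (X b). pl p) = Pr (Suc b)" if b: "b < bins" for b
  proof -
    let ?B = "{p. p \<in> pieces \<and> 0 < pl p \<and> st (fst p) (snd p) + pl p \<le> X b}"
    let ?S = "(\<lambda>b'. (items + b', m + 2)) ` {..<b}"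
    have "?B = At (X b) \<union> ?S"
    proof (intro equalityI subsetI)
      fix p assume p: "p \<in> ?B"
      obtain i k where ik: "p = (i, k)" by (cases p)
      have k: "k \<le> m + 2" and i: "i < items + bins" and e: "st i k + blen i k \<le> X b" and pos: "0 < blen i k"
        using p ik by (auto simp: pieces_def)
      show "p \<in> At (X b) \<union> ?S"
      proof (cases "k = m + 2")
        case False
        then have "i < items" using pos by (auto simp: blen_def split: if_splits)
        then show ?thesis using False k e pos ik by (auto simp: At_def)
      next
        case True
        have e1: "st i k + 1 \<le> X b" using e True by (simp add: blen_def)
        show ?thesis
        proof (cases "i < items")
          case True
          \<comment> \<open>The last message of an item would start too late to be in front of a
            separator.\<close>
          then have "load + bins \<le> st i k" using st4[of i] \<open>k = m + 2\<close> by (auto simp: target_def)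
          moreover have "Pr (Suc b) \<le> load" using prefix_le[of "Suc b"] big_le_load b by (simp add: Pr_def)
          ultimately show ?thesis using e1 X[OF b] b by linarith
        next
          case False
          then obtain b' where b': "i = items + b'" by (metis le_add_diff_inverse not_less)
          have "X b' < X b" using e1 b' True by (simp add: X_def)
          then have "b' < b" using X_mono[of b b'] b' i by (cases b b' rule: linorder_cases) auto
          then show ?thesis using b' True ik by auto
        qed
      qed
    next
      fix p assume p: "p \<in> At (X b) \<union> ?S"
      then show "p \<in> ?B"
      proof
        assume "p \<in> At (X b)"
        then show ?thesis by (auto simp: At_def pieces_def)
      next
        assume "p \<in> ?S"
        then obtain b' where b': "b' < b" "p = (items + b', m + 2)" by auto
        then show ?thesis using X_mono[of b' b] b by (auto simp: pieces_def X_def blen_def)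
      qed
    qed
    moreover have "At (X b) \<inter> ?S = {}" by (auto simp: At_def)
    ultimately have "X b = (\<Sum>p\<in>At (X b). pl p) + (\<Sum>p\<in>?S. pl p)"
      using placed_cut[OF st, of "items + b"] b finA
      by (simp add: X_def sum.union_disjoint)
    also have "(\<Sum>p\<in>?S. pl p) = b"
      by (subst sum.reindex) (auto simp: inj_on_def blen_def)
    finally have eq: "X b = (\<Sum>p\<in>At (X b). pl p) + b" .
    have "even (\<Sum>p\<in>At (X b). pl p)"
      by (intro dvd_sum) (auto simp: At_def item_block(1))
    moreover have "s = q" if "even s" "x = s + b" "x = q + b \<or> x = q + Suc b" "even q" for s x q :: nat
      using that by presburger
    ultimately show ?thesis using eq X[OF b] Pr_even[of "Suc b"] by blast
  qed
  \<comment> \<open>The end of bin \<open>b - 1\<close>, where its separator starts; the first bin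
    begins at time 0.\<close>
  define cut where "cut b = (if b = 0 then 0 else X (b - 1))" for b
  have sumc: "(\<Sum>p\<in>At (cut b). pl p) = Pr b" if "b \<le> bins" for b
  proof (cases b)
    case 0
    then show ?thesis by (auto simp: cut_def At_def Pr_def)
  next
    case (Suc b')
    then show ?thesis using sumA[of b'] that by (simp add: cut_def)
  qed
  have cut_mono: "At (cut b) \<subseteq> At (cut b')" if "b \<le> b'" "b' \<le> bins" for b b'
  proof -
    have "cut b \<le> cut b'"
    proof (cases "b = 0 \<or> b = b'")
      case False
      then have "b - 1 < b' - 1" "b' - 1 < bins" using that by linarith+
      from X_mono[OF this] show ?thesis using False that by (simp add: cut_def)
    qed (auto simp: cut_def)
    then show ?thesis by (auto simp: At_def)
  qed
  \<comment> \<open>Between two cuts the new blocks have total length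
    \<open>size (letter b) < 4 * Z\<close>, while each has at least \<open>2 * Z\<close>; hence
    there is exactly one.\<close>
  have new: "\<exists>p. At (cut (Suc b)) - At (cut b) = {p} \<and> pl p = size (letter b)" if b: "b < bins" for b
  proof -
    let ?N = "At (cut (Suc b)) - At (cut b)"
    have sub: "At (cut b) \<subseteq> At (cut (Suc b))" using b by (intro cut_mono) auto
    have s: "(\<Sum>p\<in>?N. pl p) = size (letter b)"
      using sum_diff_nat[OF finA sub, of pl] sumc[of b] sumc[of "Suc b"] b by (simp add: Pr_def)
    have ge: "2 * Z \<le> pl p" if "p \<in> ?N" for p
      using that item_block(2)[of "fst p" "snd p"] by (auto simp: At_def)
    have finN: "finite ?N" using finA by auto
    have "card ?N * (2 * Z) \<le> (\<Sum>p\<in>?N. pl p)" using ge sum_bounded_below[of ?N "2 * Z" pl] by simp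
    also have "\<dots> < 2 * (2 * Z)" using s size_bounds(2)[OF letter_less[OF b]] by simp
    finally have "card ?N < 2" by (metis mult_less_cancel2)
    moreover have "?N \<noteq> {}"
    proof
      assume e: "?N = {}"
      have "size (letter b) = 0" using s unfolding e by simp
      then show False using size_bounds(1)[of "letter b"] Z by simp
    qed
    then have "card ?N \<noteq> 0" using finN by simp
    ultimately have "card ?N = 1" by simp
    then obtain p where p: "?N = {p}" by (rule card_1_singletonE)
    then show ?thesis using s by auto
  qed
  define bl where "bl b = (SOME p. At (cut (Suc b)) - At (cut b) = {p} \<and> pl p = size (letter b))" for b
  have bl: "At (cut (Suc b)) - At (cut b) = {bl b}" "pl (bl b) = size (letter b)" if "b < bins" for b
    using someI_ex[OF new[OF that]] unfolding bl_def by auto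
  have bl_ne: "bl b \<noteq> bl b'" if "b < b'" "b' < bins" for b b'
    using bl(1)[of b] bl(1)[of b'] cut_mono[of "Suc b" b'] that by auto
  have bl_in: "fst (bl b) < items \<and> snd (bl b) < m + 2 \<and> 0 < pl (bl b)" if "b < bins" for b
  proof -
    have "bl b \<in> At (cut (Suc b))" using bl(1)[OF that] by blast
    then show ?thesis by (auto simp: At_def)
  qed
  note bl_cases = item_block(3)[of "fst (bl b)" "snd (bl b)" "letter b" for b]
  \<comment> \<open>Bin \<open>v\<close> holds block 0 of a chain \<open>v * D + d\<close>; this
    selects the value \<open>d\<close>.\<close>
  define \<alpha> where "\<alpha> v = fst (bl v) mod D" for v
  have "\<exists>v<V. C j v (\<alpha> v)" if j: "j < m" for j
  proof -
    have bn: "V + j * Suc V + r < bins" if "r \<le> V" for r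
    proof -
      have "Suc j * Suc V \<le> m * Suc V" using j by (intro mult_le_mono1) simp
      then show ?thesis using that by (simp add: bins_def)
    qed
    have lt: "letter (V + j * Suc V + r) = V + j" if "r \<le> V" for r
      using that by (simp add: letter_def del: mult_Suc_right)
    let ?f = "\<lambda>r. fst (bl (V + j * Suc V + r))"
    have cs: "snd (bl (V + j * Suc V + r)) = Suc j \<and>
       (?f r < V * D \<and> C j (?f r div D) (?f r mod D) \<or> V * D \<le> ?f r \<and> (?f r - V * D) div V = j)" if "r \<le> V" for r
      using bl_cases[of "V + j * Suc V + r"] bl(2)[OF bn[OF that]] bl_in[OF bn[OF that]] lt[OF that] j
      by auto
    \<comment> \<open>Pigeonhole: clause \<open>j\<close> has \<open>V + 1\<close> bins, but only
      \<open>V\<close> filler chains, and each of these has one block of the right kind.\<close>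
    have "\<exists>r\<le>V. ?f r < V * D"
    proof (rule ccontr)
      assume "\<not> ?thesis"
      then have ge: "V * D \<le> ?f r \<and> (?f r - V * D) div V = j" if "r \<le> V" for r using cs[OF that] that by auto
      have sub: "?f ` {..V} \<subseteq> {V * D + j * V..<V * D + j * V + V}"
      proof (rule image_subsetI)
        fix r assume "r \<in> {..V}"
        then have g: "V * D \<le> ?f r" "(?f r - V * D) div V = j" using ge by auto
        have "?f r - V * D = j * V + (?f r - V * D) mod V" using g(2) by (metis div_mult_mod_eq)
        moreover have "(?f r - V * D) mod V < V" using V by simp
        ultimately show "?f r \<in> {V * D + j * V..<V * D + j * V + V}"
          unfolding atLeastLessThan_iff using g(1) by linarith
      qed
      have "inj_on ?f {..V}"
      proof (rule linorder_inj_onI)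
        fix r r' assume r: "r < r'" "r \<in> {..V}" "r' \<in> {..V}"
        then have "bl (V + j * Suc V + r) \<noteq> bl (V + j * Suc V + r')" using bn by (intro bl_ne) auto
        then show "?f r \<noteq> ?f r'" using cs r by (metis atMost_iff prod_eqI)
      qed auto
      then have "card (?f ` {..V}) = Suc V" by (simp add: card_image)
      moreover have "card (?f ` {..V}) \<le> V" using card_mono[OF _ sub] by simp
      ultimately show False by simp
    qed
    then obtain r where r: "r \<le> V" "?f r < V * D" by blast
    define b where "b = V + j * Suc V + r"
    define i where "i = fst (bl b)"
    have b: "b < bins" "bl b = (i, Suc j)" and i: "i < V * D" "C j (i div D) (i mod D)"
      using bn[OF r(1)] cs[OF r(1)] r(2) by (auto simp: b_def i_def prod_eq_iff)
    have v: "i div D < V" using i(1) by (simp add: less_mult_imp_div_less)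
    have ii: "i < items" using i(1) by (simp add: items_def)
    have l0: "blen i 0 = size (i div D)" using i(1) ii by (simp add: blen_def)
    then have l0p: "0 < blen i 0" using size_bounds(1)[of "i div D"] Z by simp
    have inA: "(i, Suc j) \<in> At (cut (Suc b))" using bl(1)[OF b(1)] b(2) by auto
    have "st i 0 + blen i 0 \<le> st i (Suc j)"
      using st3[of i 0 "Suc j"] inA l0p ii by (auto simp: At_def)
    then have i0: "(i, 0) \<in> At (cut (Suc b))" using inA l0p ii by (auto simp: At_def)
    \<comment> \<open>The bin that holds block 0 of the chain found. Its length is of a kind below
      \<open>V\<close>, and only the selection bin of the same variable asks for that kind, so the
      literal is the selected one.\<close>
    define b' where "b' = (LEAST b'. (i, 0) \<in> At (cut (Suc b')))"
    have b'1: "(i, 0) \<in> At (cut (Suc b'))" unfolding b'_def using i0 by (rule LeastI)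
    have b'2: "b' \<le> b" unfolding b'_def using i0 by (rule Least_le)
    have "(i, 0) \<notin> At (cut b')"
    proof (cases b')
      case 0
      then show ?thesis using l0p by (auto simp: cut_def At_def)
    next
      case (Suc c)
      then show ?thesis using not_less_Least[of c "\<lambda>b'. (i, 0) \<in> At (cut (Suc b'))"] by (simp add: b'_def[symmetric])
    qed
    then have "(i, 0) \<in> At (cut (Suc b')) - At (cut b')" using b'1 by blast
    then have bb: "bl b' = (i, 0)" using bl(1)[of b'] b'2 b(1) by simp
    have "letter b' = i div D" using bl(2)[of b'] b'2 b bb l0 by (simp add: size_inj)
    then have "b' = i div D" using v by (simp add: letter_def split: if_splits)
    then have "\<alpha> (i div D) = i mod D" using bb by (simp add: \<alpha>_def)
    then show ?thesis using v i by metis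
  qed
  moreover have "\<forall>v<V. \<alpha> v < D" using D by (simp add: \<alpha>_def)
  ultimately show ?thesis unfolding msat_def by blast
qed

section \<open>From a satisfying assignment to a placement\<close>

theorem placed_if_msat:
  assumes sat: "msat V D m C"
  shows "\<exists>st. placed st"
proof -
  obtain \<alpha> where \<alpha>: "\<And>v. v < V \<Longrightarrow> \<alpha> v < D" and ex: "\<And>j. j < m \<Longrightarrow> \<exists>v<V. C j v (\<alpha> v)"
    using sat unfolding msat_def by blast
  define wit where "wit j = (SOME v. v < V \<and> C j v (\<alpha> v))" for j
  have wit: "wit j < V" "C j (wit j) (\<alpha> (wit j))" if "j < m" for j
    using someI_ex[of "\<lambda>v. v < V \<and> C j v (\<alpha> v)"] ex[OF that] unfolding wit_def by auto
  define lit where "lit v = v * D + \<alpha> v" for v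
  define filler where "filler j r = V * D + j * V + r" for j r
  have lit: "lit v < V * D" "lit v div D = v" "lit v mod D = \<alpha> v" if "v < V" for v
  proof -
    have "lit v < v * D + D" using \<alpha>[OF that] by (simp add: lit_def)
    also have "\<dots> = Suc v * D" by simp
    also have "\<dots> \<le> V * D" using that by (intro mult_le_mono1) simp
    finally show "lit v < V * D" .
    show "lit v div D = v" "lit v mod D = \<alpha> v" using \<alpha>[OF that] by (auto simp: lit_def)
  qed
  have fil: "V * D \<le> filler j r" "filler j r < items" "(filler j r - V * D) div V = j" if "j < m" "r < V" for j r
  proof -
    have "j * V + r < Suc j * V" using that by simp
    also have "\<dots> \<le> m * V" using that by (intro mult_le_mono1) simp
    finally show "filler j r < items" by (simp add: filler_def items_def)
    show "V * D \<le> filler j r" "(filler j r - V * D) div V = j" using that by (auto simp: filler_def)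
  qed
  have fil_inj: "filler j r = filler j' r' \<longleftrightarrow> j = j' \<and> r = r'" if "r < V" "r' < V" for j r j' r'
  proof
    assume "filler j r = filler j' r'"
    then have e: "j * V + r = j' * V + r'" by (simp add: filler_def)
    have "(j * V + r) div V = j" "(j' * V + r') div V = j'" using that by auto
    then show "j = j' \<and> r = r'" using e by auto
  qed simp
  define bin where "bin j r = V + j * Suc V + r" for j r
  have bin: "bin j r < bins" if "j < m" "r \<le> V" for j r
  proof -
    have "Suc j * Suc V \<le> m * Suc V" using that by (intro mult_le_mono1) simp
    then show ?thesis using that by (simp add: bins_def bin_def)
  qed
  have bin_dm: "(bin j r - V) div Suc V = j" "(bin j r - V) mod Suc V = r" if "r \<le> V" for j r
    using that by (auto simp: bin_def simp del: mult_Suc_right)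
  have bin_cases: "\<exists>j r. j < m \<and> r \<le> V \<and> b = bin j r" if "V \<le> b" "b < bins" for b
  proof (intro exI conjI)
    show "(b - V) div Suc V < m" using that by (simp add: bins_def less_mult_imp_div_less)
    show "(b - V) mod Suc V \<le> V" by (simp add: less_Suc_eq_le[symmetric])
    show "b = bin ((b - V) div Suc V) ((b - V) mod Suc V)"
      using that div_mult_mod_eq[of "b - V" "Suc V"] by (simp add: bin_def del: mult_Suc_right div_mult_mod_eq)
  qed
  define own where "own j r \<longleftrightarrow> r < V \<and> C j r (\<alpha> r)" for j r
  \<comment> \<open>Bin \<open>r < V\<close> of clause \<open>j\<close> takes the block of the
    selected literal of variable \<open>r\<close> if that satisfies the clause, and filler
    \<open>r\<close> otherwise. The last bin takes filler \<open>wit j\<close>, which is free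
    because the literal of \<open>wit j\<close> occupies its own bin.\<close>
  define chain where "chain j r = (if own j r then lit r else filler j (if r < V then r else wit j))" for j r
  define \<beta> where "\<beta> b = (if b < V then (lit b, 0)
     else (chain ((b - V) div Suc V) ((b - V) mod Suc V), Suc ((b - V) div Suc V)))" for b
  have \<beta>_lit: "\<beta> b = (lit b, 0)" if "b < V" for b using that by (simp add: \<beta>_def)
  have \<beta>_bin: "\<beta> (bin j r) = (chain j r, Suc j)" if "r \<le> V" for j r
    using bin_dm[OF that, of j] by (simp add: \<beta>_def) (simp add: bin_def)
  have chain_items: "chain j r < items" if "j < m" "r \<le> V" for j r
    using that lit(1)[of r] fil(2)[of j] wit[of j] by (auto simp: chain_def own_def items_def)
  have chain_inj: "r = r'" if e: "chain j r = chain j r'" and j: "j < m" and r: "r \<le> V" "r' \<le> V" for j r r'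
  proof -
    have d: "lit v \<noteq> filler j v'" if "v < V" "v' < V" for v v' using lit(1)[of v] fil(1)[OF j, of v'] that by auto
    have li: "v = v'" if "lit v = lit v'" "v < V" "v' < V" for v v' using lit(2) that by metis
    let ?g = "\<lambda>r. if r < V then r else wit j"
    have g: "?g r < V" for r using wit[OF j] by simp
    consider "own j r" "own j r'" | "\<not> own j r" "\<not> own j r'" | "own j r" "\<not> own j r'" | "\<not> own j r" "own j r'" by blast
    then show ?thesis
    proof cases
      case 1
      then show ?thesis using e li by (auto simp: chain_def own_def)
    next
      case 2
      then have "filler j (?g r) = filler j (?g r')" using e by (simp add: chain_def)
      then have gg: "?g r = ?g r'" using fil_inj[OF g g] by blast
      show ?thesis
      proof (rule ccontr)
        assume "r \<noteq> r'"
        then have "\<not> r < V \<and> r' = wit j \<or> \<not> r' < V \<and> r = wit j" using gg r by (auto split: if_splits)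
        then show False using 2 wit[OF j] by (auto simp: own_def)
      qed
    next
      case 3
      then have "lit r = filler j (?g r')" using e by (simp add: chain_def)
      moreover have "r < V" using \<open>own j r\<close> by (simp add: own_def)
      ultimately show ?thesis using d[OF _ g] by blast
    next
      case 4
      then have "lit r' = filler j (?g r)" using e by (simp add: chain_def)
      moreover have "r' < V" using \<open>own j r'\<close> by (simp add: own_def)
      ultimately show ?thesis using d[OF _ g] by blast
    qed
  qed
  have \<beta>_inj: "inj_on \<beta> {..<bins}"
  proof (rule inj_onI)
    fix b b' assume b: "b \<in> {..<bins}" "b' \<in> {..<bins}" and e: "\<beta> b = \<beta> b'"
    show "b = b'"
    proof (cases "b < V")
      case True
      then have "b' < V" using e by (auto simp: \<beta>_def split: if_splits)
      then show ?thesis using e True lit(2) by (auto simp: \<beta>_lit) metis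
    next
      case False
      then have "\<not> b' < V" using e by (auto simp: \<beta>_def split: if_splits)
      then obtain j r j' r' where "j < m" "r \<le> V" "b = bin j r" "j' < m" "r' \<le> V" "b' = bin j' r'"
        using bin_cases[of b] bin_cases[of b'] b False by auto
      then show ?thesis using e chain_inj by (auto simp: \<beta>_bin)
    qed
  qed
  have \<beta>_in: "fst (\<beta> b) < items \<and> snd (\<beta> b) \<le> m" if b: "b < bins" for b
  proof (cases "b < V")
    case True
    then show ?thesis using lit(1)[OF True] by (simp add: \<beta>_lit items_def)
  next
    case False
    then obtain j r where "j < m" "r \<le> V" "b = bin j r" using bin_cases[of b] b by auto
    then show ?thesis using chain_items by (simp add: \<beta>_bin)
  qed
  have \<beta>_len: "pl (\<beta> b) = size (letter b)" if b: "b < bins" for b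
  proof (cases "b < V")
    case True
    then show ?thesis using lit[OF True] by (simp add: \<beta>_lit blen_def items_def letter_def)
  next
    case False
    then obtain j r where jr: "j < m" "r \<le> V" "b = bin j r" using bin_cases[of b] b by auto
    have "blen (chain j r) (Suc j) = size (V + j)"
    proof (cases "own j r")
      case True
      then show ?thesis using chain_items[OF jr(1,2)] lit[of r] jr by (simp add: chain_def own_def blen_def)
    next
      case False
      then show ?thesis using chain_items[OF jr(1,2)] fil[OF jr(1), of "if r < V then r else wit j"] wit[OF jr(1)] jr
        by (auto simp: chain_def blen_def)
    qed
    moreover have "letter b = V + j" using jr bin_dm(1)[of r j] by (simp add: letter_def) (simp add: bin_def)
    ultimately show ?thesis using jr by (simp add: \<beta>_bin)
  qed
  \<comment> \<open>Contents of bins get even keys, separators the odd keys between them. All other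
    pieces follow, ordered by piece number first: this respects the chains and leaves the last
    messages of the items, with the highest piece number, to the end.\<close>
  define key where "key p = (if p \<in> \<beta> ` {..<bins} then 2 * inv_into {..<bins} \<beta> p
     else if items \<le> fst p \<and> snd p = m + 2 then 2 * (fst p - items) + 1
     else 2 * bins + snd p * (items + bins) + fst p)" for p
  have key_\<beta>: "key (\<beta> b) = 2 * b" if "b < bins" for b
    using that \<beta>_inj by (simp add: key_def)
  have not\<beta>: "p \<notin> \<beta> ` {..<bins}" if "items \<le> fst p \<or> m < snd p" for p
    using \<beta>_in that by fastforce
  have key_sep: "key (items + b, m + 2) = 2 * b + 1" for b
    using not\<beta>[of "(items + b, m + 2)"] by (simp add: key_def)
  have key_other: "key p = 2 * bins + snd p * (items + bins) + fst p"
    if "p \<notin> \<beta> ` {..<bins}" "\<not> (items \<le> fst p \<and> snd p = m + 2)" for p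
    unfolding key_def using that by (simp only: if_False)
  have piece_cases: "(\<exists>b<bins. p = \<beta> b) \<or> (\<exists>b<bins. p = (items + b, m + 2)) \<or>
      (p \<notin> \<beta> ` {..<bins} \<and> \<not> (items \<le> fst p \<and> snd p = m + 2) \<and> key p = 2 * bins + snd p * (items + bins) + fst p)"
    if "p \<in> pieces" for p
  proof (cases "items \<le> fst p \<and> snd p = m + 2")
    case True
    then have "p = (items + (fst p - items), m + 2)" "fst p - items < bins"
      using that by (auto simp: pieces_def prod_eq_iff)
    then show ?thesis by blast
  next
    case False
    then show ?thesis using key_other[of p] by blast
  qed
  have "placed (\<lambda>i k. \<Sum>p | p \<in> pieces \<and> key p < key (i, k). pl p)"
  proof (rule placed_by_key)
    show "inj_on key {p \<in> pieces. 0 < pl p}"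
    proof (rule inj_onI)
      fix p q assume "p \<in> {p \<in> pieces. 0 < pl p}" "q \<in> {p \<in> pieces. 0 < pl p}" and e: "key p = key q"
      then have p: "p \<in> pieces" and q: "q \<in> pieces" by auto
      have dm: "fst p = fst q \<and> snd p = snd q"
        if "snd p * (items + bins) + fst p = snd q * (items + bins) + fst q"
      proof -
        have "fst p < items + bins" "fst q < items + bins" using p q by (auto simp: pieces_def)
        moreover have "(k * N + r) div N = k" if "r < N" for k N r :: nat using that by simp
        ultimately have "snd p = snd q" using that by metis
        then show ?thesis using that by simp
      qed
      have odd: "2 * b \<noteq> Suc (2 * b')" "Suc (2 * b') \<noteq> 2 * b" for b b' :: nat by presburger+
      from piece_cases[OF p] show "p = q"
      proof (elim disjE exE conjE)
        fix b assume b: "b < bins" "p = \<beta> b"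
        have kp: "key q = 2 * b" using e b key_\<beta> by simp
        from piece_cases[OF q] show ?thesis
        proof (elim disjE exE conjE)
          fix b' assume "b' < bins" "q = \<beta> b'"
          then show ?thesis using kp b key_\<beta>[of b'] by simp
        next
          fix b' assume "q = (items + b', m + 2)"
          then show ?thesis using kp key_sep[of b'] odd[of b b'] by simp
        next
          assume "key q = 2 * bins + snd q * (items + bins) + fst q"
          then show ?thesis using kp b by linarith
        qed
      next
        fix b assume b: "b < bins" "p = (items + b, m + 2)"
        have kp: "key q = Suc (2 * b)" using e b key_sep by simp
        from piece_cases[OF q] show ?thesis
        proof (elim disjE exE conjE)
          fix b' assume "b' < bins" "q = \<beta> b'"
          then show ?thesis using kp key_\<beta>[of b'] odd[of b' b] by simp
        next
          fix b' assume "q = (items + b', m + 2)"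
          then show ?thesis using kp b key_sep[of b'] by simp
        next
          assume "key q = 2 * bins + snd q * (items + bins) + fst q"
          then show ?thesis using kp b by linarith
        qed
      next
        assume kp: "key p = 2 * bins + snd p * (items + bins) + fst p"
        from piece_cases[OF q] show ?thesis
        proof (elim disjE exE conjE)
          fix b' assume "b' < bins" "q = \<beta> b'"
          then show ?thesis using kp e key_\<beta>[of b'] by simp
        next
          fix b' assume "b' < bins" "q = (items + b', m + 2)"
          then show ?thesis using kp e key_sep[of b'] by simp
        next
          assume "key q = 2 * bins + snd q * (items + bins) + fst q"
          then show ?thesis using kp e dm by (simp add: prod_eq_iff)
        qed
      qed
    qed
  next
    fix i k k' assume a: "i < items + bins" "k < k'" "k' \<le> m + 2" "0 < blen i k" "0 < blen i k'"
    then have i: "i < items" and k: "k \<le> m + 1" by (auto simp: blen_def split: if_splits)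
    have nk: "key (i, c) = 2 * bins + c * (items + bins) + i" if "(i, c) \<notin> \<beta> ` {..<bins}" for c
      using key_other[OF that] i by simp
    have lk: "key (i, c) < 2 * bins" if "(i, c) \<in> \<beta> ` {..<bins}" for c
      using that key_\<beta> by auto
    show "key (i, k) < key (i, k')"
    proof (cases "(i, k') \<in> \<beta> ` {..<bins}")
      case False
      show ?thesis
      proof (cases "(i, k) \<in> \<beta> ` {..<bins}")
        case True
        then show ?thesis using lk[OF True] nk[OF False] by linarith
      next
        case False': False
        have "k * (items + bins) < k' * (items + bins)" using a i by simp
        then show ?thesis using nk[OF False] nk[OF False'] by linarith
      qed
    next
      case True
      then obtain b where b: "b < bins" "\<beta> b = (i, k')" by auto
      \<comment> \<open>If a block is in a bin, so are the earlier blocks of its chain: a filler has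
        none, and a selected literal uses its selection bin and a bin of each clause that it
        satisfies.\<close>
      have "\<not> b < V" using b a by (auto simp: \<beta>_lit)
      then obtain j r where jr: "j < m" "r \<le> V" "b = bin j r" using bin_cases[of b] b by auto
      then have ik: "i = chain j r" "k' = Suc j" using b by (auto simp: \<beta>_bin)
      show ?thesis
      proof (cases "own j r")
        case False
        define g where "g = (if r < V then r else wit j)"
        have ig: "i = filler j g" "g < V" using ik False wit[OF jr(1)] by (auto simp: chain_def g_def)
        then have "\<not> i < V * D" "(i - V * D) div V = j" using fil[OF jr(1) ig(2)] by auto
        then have "k = Suc j" using a(2,4) i ik jr by (auto simp: blen_def split: if_splits)
        then show ?thesis using a ik by simp
      next
        case True
        then have ir: "i = lit r" and r: "r < V" using ik by (auto simp: chain_def own_def)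
        show ?thesis
        proof (cases k)
          case 0
          then have "(i, k) = \<beta> r" using ir r by (simp add: \<beta>_lit)
          then have "key (i, k) = 2 * r" using key_\<beta>[of r] r by (simp add: bins_def)
          moreover have "r < b" using r jr by (simp add: bin_def)
          ultimately show ?thesis using key_\<beta>[OF b(1)] b(2) by simp
        next
          case (Suc j')
          have j': "j' < j" using Suc a ik by simp
          then have "C j' r (\<alpha> r)" using a(4) Suc i ir lit[OF r] jr by (auto simp: blen_def split: if_splits)
          then have "(i, k) = \<beta> (bin j' r)" using Suc ir r by (simp add: \<beta>_bin chain_def own_def)
          then have "key (i, k) = 2 * bin j' r" using key_\<beta>[of "bin j' r"] bin[of j' r] j' jr by simp
          moreover have "bin j' r < b" using j' jr by (simp add: bin_def del: mult_Suc_right)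
          ultimately show ?thesis using key_\<beta>[OF b(1)] b(2) by simp
        qed
      qed
    qed
  next
    fix i assume i: "i < items + bins"
    show "target i = Suc (\<Sum>p | p \<in> pieces \<and> key p < key (i, m + 2). pl p)"
    proof (cases "i < items")
      case True
      have ki: "key (i, m + 2) = 2 * bins + (m + 2) * (items + bins) + i"
        using key_other[of "(i, m + 2)"] not\<beta>[of "(i, m + 2)"] True by simp
      have eq: "{p. p \<in> pieces \<and> key p < key (i, m + 2)} = pieces - (\<lambda>i'. (i', m + 2)) ` {i..<items}"
      proof (intro set_eqI iffI)
        fix p assume p: "p \<in> {p. p \<in> pieces \<and> key p < key (i, m + 2)}"
        have "key (i', m + 2) = 2 * bins + (m + 2) * (items + bins) + i'" if "i' < items" for i'
          using key_other[of "(i', m + 2)"] not\<beta>[of "(i', m + 2)"] that by simp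
        then show "p \<in> pieces - (\<lambda>i'. (i', m + 2)) ` {i..<items}" using p ki by auto
      next
        fix p assume p: "p \<in> pieces - (\<lambda>i'. (i', m + 2)) ` {i..<items}"
        then have pp: "p \<in> pieces" by blast
        have "key p < key (i, m + 2)"
          using piece_cases[OF pp]
        proof (elim disjE exE conjE)
          fix b assume "b < bins" "p = \<beta> b"
          then show ?thesis using key_\<beta>[of b] ki by simp
        next
          fix b assume "b < bins" "p = (items + b, m + 2)"
          then show ?thesis using key_sep[of b] ki items_pos by simp
        next
          assume o: "\<not> (items \<le> fst p \<and> snd p = m + 2)" "key p = 2 * bins + snd p * (items + bins) + fst p"
          show ?thesis
          proof (cases "snd p = m + 2")
            case True
            then have "fst p < i" using p o(1) by (cases p) auto
            then show ?thesis using o(2) ki True by simp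
          next
            case False
            then have "Suc (snd p) \<le> m + 2" "fst p < items + bins" using pp by (auto simp: pieces_def)
            then have "Suc (snd p) * (items + bins) \<le> (m + 2) * (items + bins)" by (intro mult_le_mono1)
            then show ?thesis using o(2) ki \<open>fst p < items + bins\<close> by simp
          qed
        qed
        then show "p \<in> {p. p \<in> pieces \<and> key p < key (i, m + 2)}" using pp by simp
      qed
      have sub: "(\<lambda>i'. (i', m + 2)) ` {i..<items} \<subseteq> pieces" by (auto simp: pieces_def)
      have "(\<Sum>p\<in>(\<lambda>i'. (i', m + 2)) ` {i..<items}. pl p) = items - i"
        by (subst sum.reindex) (auto simp: inj_on_def blen_def)
      then have "(\<Sum>p | p \<in> pieces \<and> key p < key (i, m + 2). pl p) = total - (items - i)"
        unfolding eq using sum_diff_nat[OF _ sub, of pl] total_pieces by simp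
      then show ?thesis using True by (simp add: target_def total_eq)
    next
      case False
      then obtain b where ib: "i = items + b" "b < bins" using i by (metis add_less_cancel_left le_add_diff_inverse not_less)
      have eq: "{p. p \<in> pieces \<and> key p < key (i, m + 2)} = \<beta> ` {..<Suc b} \<union> (\<lambda>b'. (items + b', m + 2)) ` {..<b}"
      proof (intro set_eqI iffI)
        fix p assume p: "p \<in> {p. p \<in> pieces \<and> key p < key (i, m + 2)}"
        then have pp: "p \<in> pieces" and lt: "key p < 2 * b + 1" using key_sep[of b] ib by auto
        show "p \<in> \<beta> ` {..<Suc b} \<union> (\<lambda>b'. (items + b', m + 2)) ` {..<b}"
          using piece_cases[OF pp] lt ib(2) by (elim disjE exE conjE) (auto simp: key_\<beta> key_sep)
      next
        fix p assume "p \<in> \<beta> ` {..<Suc b} \<union> (\<lambda>b'. (items + b', m + 2)) ` {..<b}"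
        then show "p \<in> {p. p \<in> pieces \<and> key p < key (i, m + 2)}"
        proof
          assume "p \<in> \<beta> ` {..<Suc b}"
          then obtain b' where "b' < Suc b" "p = \<beta> b'" by auto
          then show ?thesis using \<beta>_in[of b'] key_\<beta>[of b'] key_sep[of b] ib by (auto simp: pieces_def mem_Times_iff)
        next
          assume "p \<in> (\<lambda>b'. (items + b', m + 2)) ` {..<b}"
          then show ?thesis using key_sep ib by (auto simp: pieces_def)
        qed
      qed
      have dj: "\<beta> ` {..<Suc b} \<inter> (\<lambda>b'. (items + b', m + 2)) ` {..<b} = {}"
      proof -
        have "\<beta> b1 \<noteq> (items + b2, m + 2)" if "b1 < Suc b" for b1 b2
          using \<beta>_in[of b1] that ib(2) by auto
        then show ?thesis by blast
      qed
      have "inj_on \<beta> {..<Suc b}" using \<beta>_inj ib(2) by (auto intro: inj_on_subset)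
      then have "(\<Sum>p\<in>\<beta> ` {..<Suc b}. pl p) = (\<Sum>b'<Suc b. size (letter b'))"
        unfolding sum.reindex[OF \<open>inj_on \<beta> {..<Suc b}\<close>] using \<beta>_len ib(2) by (intro sum.cong) auto
      moreover have "(\<Sum>p\<in>(\<lambda>b'. (items + b', m + 2)) ` {..<b}. pl p) = b"
        by (subst sum.reindex) (auto simp: inj_on_def blen_def)
      ultimately have "(\<Sum>p | p \<in> pieces \<and> key p < key (i, m + 2). pl p) = (\<Sum>b'<Suc b. size (letter b')) + b"
        unfolding eq using dj by (subst sum.union_disjoint) auto
      then show ?thesis using ib by (simp add: target_def del: sum.lessThan_Suc)
    qed
  qed
  then show ?thesis by blast
qed

end

section \<open>Counter programs\<close>

datatype test = NZ nat | Sym bool | In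
datatype com = Skip | Inc nat | Dec nat | Out bool
  | Seq com com (infixr \<open>;;\<close> 60) | If test com com | While test com

type_synonym store = "(nat \<Rightarrow> nat) \<times> bool list"

fun holds :: "bool list \<Rightarrow> (nat \<Rightarrow> nat) \<Rightarrow> test \<Rightarrow> bool" where
  "holds x \<sigma> (NZ r) = (\<sigma> r \<noteq> 0)"
| "holds x \<sigma> (Sym b) = (\<sigma> 0 < length x \<and> x ! \<sigma> 0 = b)"
| "holds x \<sigma> In = (\<sigma> 0 < length x)"

text \<open>Control and effect are kept apart because they turn into different components of a
  machine transition: the next state and the actions on the tapes.\<close>

fun ctrl :: "(test \<Rightarrow> bool) \<Rightarrow> com list \<Rightarrow> com list" where
  "ctrl h [] = []"
| "ctrl h (Seq a b # K) = a # b # K"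
| "ctrl h (If t a b # K) = (if h t then a # K else b # K)"
| "ctrl h (While t c # K) = (if h t then c # While t c # K else K)"
| "ctrl h (_ # K) = K"

fun eff :: "com list \<Rightarrow> store \<Rightarrow> store" where
  "eff (Inc r # K) (\<sigma>, w) = (\<sigma>(r := Suc (\<sigma> r)), w)"
| "eff (Dec r # K) (\<sigma>, w) = (\<sigma>(r := \<sigma> r - 1), w)"
| "eff (Out b # K) (\<sigma>, w) = (\<sigma>, w @ [b])"
| "eff _ s = s"

definition sstep :: "bool list \<Rightarrow> com list \<times> store \<Rightarrow> com list \<times> store" where
  "sstep x = (\<lambda>(C, s). (ctrl (holds x (fst s)) C, eff C s))"

text \<open>Quantifying over the continuation \<open>K\<close> is what makes runs compose.\<close>

definition runs :: "bool list \<Rightarrow> com \<Rightarrow> store \<Rightarrow> nat \<Rightarrow> store \<Rightarrow> bool" where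
  "runs x c s t s' \<longleftrightarrow> (\<forall>K. (sstep x ^^ t) (c # K, s) = (K, s'))"

text \<open>The continuations that occur while \<open>c\<close> runs in front of \<open>K\<close>.
  They become the states of the machine, so there must be finitely many; a loop does not enlarge its
  continuation, because its body is followed by the loop itself.\<close>

fun residuals :: "com \<Rightarrow> com list \<Rightarrow> com list set" where
  "residuals (Seq a b) K = insert (Seq a b # K) (residuals a (b # K) \<union> residuals b K)"
| "residuals (If t a b) K = insert (If t a b # K) (residuals a K \<union> residuals b K)"
| "residuals (While t c) K = insert (While t c # K) (residuals c (While t c # K))"
| "residuals c K = {c # K}"

lemma finite_residuals: "finite (residuals c K)"
  by (induction c K rule: residuals.induct) auto

lemma residuals_start: "c # K \<in> residuals c K"
  by (cases c) auto

lemma residuals_nonempty: "[] \<notin> residuals c K"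
  by (induction c K rule: residuals.induct) auto

lemma residuals_closed: "C \<in> residuals c K \<Longrightarrow> ctrl h C \<in> insert K (residuals c K)"
  by (induction c K rule: residuals.induct) (auto simp: residuals_start split: if_splits)

fun fits_test :: "nat \<Rightarrow> test \<Rightarrow> bool" where
  "fits_test k (NZ r) = (r < k)"
| "fits_test k _ = (0 < k)"

fun fits :: "nat \<Rightarrow> com \<Rightarrow> bool" where
  "fits k (Inc r) = (r < k)"
| "fits k (Dec r) = (r < k)"
| "fits k (Seq a b) = (fits k a \<and> fits k b)"
| "fits k (If t a b) = (fits_test k t \<and> fits k a \<and> fits k b)"
| "fits k (While t c) = (fits_test k t \<and> fits k c)"
| "fits k _ = True"

lemma fits_test_mono: "fits_test k t \<Longrightarrow> k \<le> k' \<Longrightarrow> fits_test k' t"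
  by (cases t) auto

lemma fits_mono: "fits k c \<Longrightarrow> k \<le> k' \<Longrightarrow> fits k' c"
  by (induction c) (auto intro: fits_test_mono)

lemma ex_fits_test: "\<exists>k. fits_test k t"
  by (cases t) auto

lemma ex_fits: "\<exists>k. fits k c"
proof (induction c)
  case (Seq a b)
  then obtain k k' where "fits k a" "fits k' b" by blast
  then have "fits (max k k') (Seq a b)" by (auto intro: fits_mono)
  then show ?case by blast
next
  case (If t a b)
  then obtain k k' k'' where "fits k a" "fits k' b" "fits_test k'' t" using ex_fits_test by blast
  then have "fits (max k (max k' k'')) (If t a b)" by (auto intro: fits_mono fits_test_mono)
  then show ?case by blast
next
  case (While t c)
  then obtain k k'' where "fits k c" "fits_test k'' t" using ex_fits_test by blast
  then have "fits (max k k'') (While t c)" by (auto intro: fits_mono fits_test_mono)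
  then show ?case by blast
qed auto

lemma fits_residuals:
  "C \<in> residuals c K \<Longrightarrow> fits k c \<Longrightarrow> list_all (fits k) K \<Longrightarrow> list_all (fits k) C"
  by (induction c K rule: residuals.induct) auto

text \<open>
  A register is the head position of a tape whose cell 0 carries a mark (the symbols 3, 4, 5 are
  the marked versions of 0, 1, 2) and whose contents never change; register 0 lives on the input
  tape. The last tape holds the output.
\<close>

fun sym_holds :: "nat list \<Rightarrow> test \<Rightarrow> bool" where
  "sym_holds ss (NZ r) = (ss ! r < 3)"
| "sym_holds ss (Sym b) = (ss ! 0 mod 3 = bit_symbol b)"
| "sym_holds ss In = (ss ! 0 mod 3 \<noteq> 0)"

fun act :: "nat \<Rightarrow> com list \<Rightarrow> nat \<Rightarrow> nat \<Rightarrow> nat \<times> direction" where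
  "act k (Inc r # K) i s = (s, if i = r then Go_Right else Stay)"
| "act k (Dec r # K) i s = (s, if i = r \<and> s < 3 then Go_Left else Stay)"
| "act k (Out b # K) i s = (if i = k then (bit_symbol b, Go_Right) else (s, Stay))"
| "act k _ i s = (s, Stay)"

section \<open>Simulation of counter programs by Turing machines\<close>

definition store_tapes :: "bool list \<Rightarrow> nat \<Rightarrow> store \<Rightarrow> tape list" where
  "store_tapes x k s =
    map (\<lambda>i. if i < k
             then (\<lambda>p. fst (word_tape (if i = 0 then x else [])) p + (if p = 0 then 3 else 0), int (fst s i))
             else (fst (word_tape (snd s)), int (length (snd s)))) [0..<Suc k]"

text \<open>State 0 performs one preliminary step that marks cell 0 of all register tapes. Reducing
  modulo 3 first keeps this transition within the alphabet even on symbols that are already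
  marked.\<close>

definition com_tm :: "nat \<Rightarrow> (com list \<Rightarrow> nat) \<Rightarrow> (nat \<Rightarrow> com list) \<Rightarrow> nat \<Rightarrow> com \<Rightarrow> tm" where
  "com_tm k idx dec N c = \<lparr>tapes = Suc k, states = N, symbols = 6,
    trans = (\<lambda>q ss. if q = 0
      then (idx [c], map (\<lambda>i. (if i < k then ss ! i mod 3 + 3 else ss ! i, Stay)) [0..<Suc k])
      else (idx (ctrl (sym_holds ss) (dec q)), map (\<lambda>i. act k (dec q) i (ss ! i)) [0..<Suc k]))\<rparr>"

lemma word_tape_le: "fst (word_tape w) p \<le> 2"
  by (simp add: word_tape_def bit_symbol_def)

lemma word_tape_nat:
  "fst (word_tape w) (int n) = (if n < length w then bit_symbol (w ! n) else 0)"
  by (simp add: word_tape_def)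

lemma word_tape_snoc:
  "(fst (word_tape w))(int (length w) := bit_symbol b) = fst (word_tape (w @ [b]))"
  by (auto simp: word_tape_def nth_append fun_eq_iff nat_less_iff)

lemma read_store_tapes:
  assumes "i < k"
  shows "map read_tape (store_tapes x k s) ! i =
    fst (word_tape (if i = 0 then x else [])) (int (fst s i)) + (if fst s i = 0 then 3 else 0)"
proof -
  have "i < length [0..<Suc k]" "[0..<Suc k] ! i = i" using assms by (auto simp del: upt_Suc)
  then show ?thesis using assms by (simp add: store_tapes_def del: upt_Suc)
qed

lemma sym_holds_store_tapes:
  assumes "fits_test k t"
  shows "sym_holds (map read_tape (store_tapes x k s)) t = holds x (fst s) t"
proof (cases t)
  case (NZ r)
  then have r: "r < k" using assms by simp
  show ?thesis
    using NZ word_tape_le[of "if r = 0 then x else []" "int (fst s r)"]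
    by (auto simp: read_store_tapes[OF r])
next
  case (Sym b)
  then have r: "0 < k" using assms by simp
  show ?thesis
    using Sym by (auto simp: read_store_tapes[OF r] word_tape_nat bit_symbol_def)
next
  case In
  then have r: "0 < k" using assms by simp
  show ?thesis
    using In by (auto simp: read_store_tapes[OF r] word_tape_nat bit_symbol_def)
qed

text \<open>The mark stops \<open>Dec\<close> at cell 0, in accordance with the truncated
  subtraction of \<open>eff\<close>.\<close>

lemma act_store_tapes:
  assumes "list_all (fits k) C"
  shows "map2 act_tape (map (\<lambda>i. act k C i (map read_tape (store_tapes x k s) ! i)) [0..<Suc k])
           (store_tapes x k s) = store_tapes x k (eff C s)"
proof (rule nth_equalityI)
  show "length (map2 act_tape (map (\<lambda>i. act k C i (map read_tape (store_tapes x k s) ! i)) [0..<Suc k])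
           (store_tapes x k s)) = length (store_tapes x k (eff C s))"
    by (simp add: store_tapes_def)
next
  fix i
  assume "i < length (map2 act_tape (map (\<lambda>i. act k C i (map read_tape (store_tapes x k s) ! i)) [0..<Suc k])
           (store_tapes x k s))"
  then have i: "i < Suc k" by (simp add: store_tapes_def del: upt_Suc)
  have nth: "store_tapes x k s ! i = (if i < k
             then (\<lambda>p. fst (word_tape (if i = 0 then x else [])) p + (if p = 0 then 3 else 0), int (fst s i))
             else (fst (word_tape (snd s)), int (length (snd s))))" for s
    using i nth_map_upt[of i "Suc k" 0] by (simp add: store_tapes_def del: upt_Suc)
  have l: "length (store_tapes x k s) = Suc k" by (simp add: store_tapes_def)
  have *: "(map2 act_tape (map (\<lambda>i. act k C i (map read_tape (store_tapes x k s) ! i)) [0..<Suc k])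
           (store_tapes x k s)) ! i = act_tape (act k C i (map read_tape (store_tapes x k s) ! i)) (store_tapes x k s ! i)"
    using i l nth_map_upt[of i "Suc k" 0] by (simp del: upt_Suc)
  have rd: "map read_tape (store_tapes x k s) ! i = read_tape (store_tapes x k s ! i)"
    using i l by simp
  obtain \<sigma> w where s: "s = (\<sigma>, w)" by (cases s)
  have le: "\<not> fst (word_tape v) p + 3 < 3" "fst (word_tape v) p < 3" for v p
    using word_tape_le[of v p] by auto
  have "act_tape (act k C i (read_tape (store_tapes x k s ! i))) (store_tapes x k s ! i) = store_tapes x k (eff C s) ! i"
    unfolding nth s using i assms
    by (cases "(k, C, i, 0::nat)" rule: act.cases)
       (auto simp: le word_tape_snoc fun_upd_idem split: if_splits)
  then show "(map2 act_tape (map (\<lambda>i. act k C i (map read_tape (store_tapes x k s) ! i)) [0..<Suc k])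
           (store_tapes x k s)) ! i = store_tapes x k (eff C s) ! i"
    by (simp only: * rd)
qed

lemma com_tm_correct:
  assumes fits: "fits k c" and k: "0 < k"
    and idx: "bij_betw (f :: com list \<Rightarrow> nat) (residuals c []) {..<N}"
    and time: "\<And>x. \<exists>t \<le> time (length x). \<exists>\<sigma>. runs x c (\<lambda>_. 0, []) t (\<sigma>, g x)"
  shows "\<exists>M. wf_tm M \<and> computes_in_time M g (\<lambda>n. Suc (time n))"
proof -
  \<comment> \<open>The empty continuation is the halting state 1; numbers from 2 on encode the
    others, as state 0 is taken by the marking step.\<close>
  define idx where "idx C = (if C = [] then 1 else f C + 2)" for C
  define dec where "dec q = (if q < 2 then [] else inv_into (residuals c []) f (q - 2))" for q
  define M where "M = com_tm k idx dec (N + 2) c"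
  let ?R = "insert [] (residuals c [])"
  have dec_idx: "dec (idx C) = C" if "C \<in> ?R" for C
    using that idx residuals_nonempty[of c "[]"]
    by (auto simp: dec_def idx_def bij_betw_def)
  have idx_less: "idx C < N + 2" if "C \<in> ?R" for C
    using that idx by (auto simp: idx_def bij_betw_def)
  have idx_pos: "idx C \<noteq> 0" "idx C = 1 \<longleftrightarrow> C = []" for C
    by (auto simp: idx_def)
  have dec_R: "dec q \<in> ?R" if "q < N + 2" for q
    using that idx bij_betw_inv_into[OF idx] by (auto simp: dec_def bij_betw_def)
  have closed: "ctrl h C \<in> ?R" if "C \<in> ?R" for C h
    using that residuals_closed[of C c "[]" h] by auto
  have fitsR: "list_all (fits k) C" if "C \<in> ?R" for C
    using that fits fits_residuals[of C c "[]" k] by auto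
  have act_less: "fst (act k C i s) < 6" if "s < 6" for C i s
    using that by (cases "(k, C, i, s)" rule: act.cases) (auto simp: bit_symbol_def)
  have wf: "wf_tm M"
    unfolding wf_tm_def
  proof (intro conjI allI impI)
    fix q ss
    assume a: "q < states M \<and> length ss = tapes M \<and> set ss \<subseteq> {..<symbols M}"
    then have q: "q < N + 2" and l: "length ss = Suc k" and ss: "\<And>i. i < Suc k \<Longrightarrow> ss ! i < 6"
      by (auto simp: M_def com_tm_def dest!: subsetD[OF _ nth_mem])
    show "fst (trans M q ss) < states M"
      using idx_less[OF closed[OF dec_R[OF q]], of "sym_holds ss"] idx_less[of "[c]"] residuals_start[of c "[]"]
      by (auto simp: M_def com_tm_def)
    show "length (snd (trans M q ss)) = tapes M"
      by (simp add: M_def com_tm_def)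
    have "ss ! i mod 3 + 3 < 6" for i
      using mod_less_divisor[of 3 "ss ! i"] by linarith
    then show "fst ` set (snd (trans M q ss)) \<subseteq> {..<symbols M}"
      using ss by (auto simp: M_def com_tm_def act_less simp del: upt_Suc)
  qed (auto simp: M_def com_tm_def)
  have step: "step M (idx C, store_tapes x k s) =
      (case sstep x (C, s) of (C', s') \<Rightarrow> (idx C', store_tapes x k s'))" if C: "C \<in> ?R" for x C s
  proof (cases "C = []")
    case True
    then show ?thesis by (cases s) (simp add: idx_def sstep_def)
  next
    case False
    have "ctrl (sym_holds (map read_tape (store_tapes x k s))) C = ctrl (holds x (fst s)) C"
      using fitsR[OF C]
      by (cases "(undefined :: test \<Rightarrow> bool, C)" rule: ctrl.cases)
         (auto simp: sym_holds_store_tapes)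
    then have tr: "trans M (idx C) (map read_tape (store_tapes x k s)) =
       (idx (ctrl (holds x (fst s)) C),
        map (\<lambda>i. act k C i (map read_tape (store_tapes x k s) ! i)) [0..<Suc k])"
      by (simp add: M_def com_tm_def idx_pos dec_idx[OF C] del: upt_Suc)
    show ?thesis
      unfolding step.simps tr using False idx_pos(2)[of C]
      by (simp add: act_store_tapes[OF fitsR[OF C]] sstep_def del: upt_Suc)
  qed
  have steps: "(step M ^^ t) (idx C, store_tapes x k s) =
      (case (sstep x ^^ t) (C, s) of (C', s') \<Rightarrow> (idx C', store_tapes x k s')) \<and>
      fst ((sstep x ^^ t) (C, s)) \<in> ?R" if "C \<in> ?R" for x C s t
    using that
  proof (induction t)
    case (Suc t)
    obtain C' s' where eq: "(sstep x ^^ t) (C, s) = (C', s')" by (rule prod.exhaust)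
    then have C': "C' \<in> ?R" and IH: "(step M ^^ t) (idx C, store_tapes x k s) = (idx C', store_tapes x k s')"
      using Suc by simp_all
    have "(sstep x ^^ Suc t) (C, s) = sstep x (C', s')" by (simp only: funpow.simps o_apply eq)
    moreover have "(step M ^^ Suc t) (idx C, store_tapes x k s) = step M (idx C', store_tapes x k s')"
      by (simp only: funpow.simps o_apply IH)
    moreover have "fst (sstep x (C', s')) \<in> ?R"
      using closed[OF C', of "holds x (fst s')"] by (simp add: sstep_def)
    ultimately show ?case by (simp only: step[OF C'] simp_thms)
  qed simp
  have first: "step M (start_config M x) = (idx [c], store_tapes x k (\<lambda>_. 0, []))" for x
  proof -
    define ts where "ts = word_tape x # replicate k (word_tape [])"
    have nth: "ts ! i = word_tape (if i = 0 then x else [])" if "i < Suc k" for i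
      using that by (cases i) (auto simp: ts_def)
    have "map2 act_tape (map (\<lambda>i. (if i < k then map read_tape ts ! i mod 3 + 3 else map read_tape ts ! i, Stay)) [0..<Suc k]) ts
      = store_tapes x k (\<lambda>_. 0, [])" (is "map2 act_tape ?as ts = _")
    proof (rule nth_equalityI)
      fix i assume "i < length (map2 act_tape ?as ts)"
      then have i: "i < Suc k" by (simp add: ts_def del: upt_Suc)
      have l: "length ts = Suc k" by (simp add: ts_def)
      have rd: "read_tape (word_tape v) = fst (word_tape v) 0" for v by (simp add: word_tape_def)
      have "map2 act_tape ?as ts ! i = act_tape (?as ! i) (ts ! i)"
        using i l by (simp del: upt_Suc)
      also have "?as ! i = (if i < k then fst (ts ! i) 0 mod 3 + 3 else fst (ts ! i) 0, Stay)"
        using i l nth_map_upt[of i "Suc k" 0] by (simp add: nth rd del: upt_Suc)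
      finally have 1: "map2 act_tape ?as ts ! i = act_tape (if i < k then fst (ts ! i) 0 mod 3 + 3 else fst (ts ! i) 0, Stay) (ts ! i)" .
      have 2: "store_tapes x k (\<lambda>_. 0, []) ! i = (if i < k
             then (\<lambda>p. fst (word_tape (if i = 0 then x else [])) p + (if p = 0 then 3 else 0), 0)
             else (fst (word_tape []), 0))"
        using i nth_map_upt[of i "Suc k" 0] by (simp add: store_tapes_def del: upt_Suc)
      have m: "fst (word_tape v) 0 mod 3 = fst (word_tape v) 0" for v
        using word_tape_le[of v 0] by simp
      have a: "act_tape (s, Stay) (word_tape v) = ((fst (word_tape v))(0 := s), 0)" for s v
        by (simp add: word_tape_def)
      show "map2 act_tape ?as ts ! i = store_tapes x k (\<lambda>_. 0, []) ! i"
        unfolding 1 2 using i k by (auto simp: nth m a fun_eq_iff)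
    qed (simp add: ts_def store_tapes_def)
    moreover have "start_config M x = (0, ts)"
      by (simp add: start_config_def M_def com_tm_def ts_def)
    ultimately show ?thesis
      by (simp add: M_def com_tm_def del: upt_Suc)
  qed
  have "computes_in_time M g (\<lambda>n. Suc (time n))"
    unfolding computes_in_time_def
  proof
    fix x
    obtain t \<sigma> where t: "t \<le> time (length x)" and r: "runs x c (\<lambda>_. 0, []) t (\<sigma>, g x)"
      using time by blast
    have "(step M ^^ Suc t) (start_config M x) = (step M ^^ t) (idx [c], store_tapes x k (\<lambda>_. 0, []))"
      by (simp only: funpow_Suc_right first o_apply)
    also have "\<dots> = (1, store_tapes x k (\<sigma>, g x))"
      using steps[of "[c]" t x "(\<lambda>_. 0, [])"] residuals_start[of c "[]"] r
      by (auto simp: runs_def idx_def)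
    finally have run: "(step M ^^ Suc t) (start_config M x) = (1, store_tapes x k (\<sigma>, g x))" .
    have "tape_output (last (store_tapes x k (\<sigma>, g x))) (g x)"
      by (simp add: store_tapes_def tape_output_def word_tape_nat)
    then show "\<exists>t\<le>Suc (time (length x)). \<exists>ts. (step M ^^ t) (start_config M x) = (1, ts) \<and> tape_output (last ts) (g x)"
      using run t by (intro exI[of _ "Suc t"]) auto
  qed
  with wf show ?thesis by blast
qed

theorem polytime_computable_com:
  fixes p :: "nat poly"
  assumes time: "\<And>x. \<exists>t \<le> poly p (length x). \<exists>\<sigma>. runs x c (\<lambda>_. 0, []) t (\<sigma>, g x)"
  shows "polytime_computable g"
proof -
  obtain k where "fits k c" using ex_fits by blast
  then have k: "fits (Suc k) c" by (rule fits_mono) simp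
  obtain f where "bij_betw f (residuals c []) {0..<card (residuals c [])}"
    using ex_bij_betw_finite_nat[OF finite_residuals] by blast
  then have "bij_betw f (residuals c []) {..<card (residuals c [])}"
    by (simp add: lessThan_atLeast0)
  from com_tm_correct[OF k _ this time] obtain M where M: "wf_tm M" "computes_in_time M g (\<lambda>n. Suc (poly p n))"
    by auto
  have "(\<lambda>n. Suc (poly p n)) = poly (p + 1)" by auto
  with M show ?thesis unfolding polytime_computable_def by metis
qed

section \<open>Polynomially bounded arithmetic\<close>

definition runs_le :: "bool list \<Rightarrow> com \<Rightarrow> store \<Rightarrow> nat \<Rightarrow> store \<Rightarrow> bool" where
  "runs_le x c s n s' \<longleftrightarrow> (\<exists>t\<le>n. runs x c s t s')"

lemma runs_le_mono: "runs_le x c s n s' \<Longrightarrow> n \<le> n' \<Longrightarrow> runs_le x c s n' s'"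
  unfolding runs_le_def by (meson le_trans)

lemma runs_atomic:
  assumes "\<And>K. sstep x (c # K, s) = (K, s')"
  shows "runs_le x c s 1 s'"
  using assms unfolding runs_le_def runs_def by (intro exI[of _ 1]) simp

lemma runs_Skip: "runs_le x Skip s 1 s"
  by (cases s) (rule runs_atomic, simp add: sstep_def)
lemma runs_Inc: "runs_le x (Inc r) (\<sigma>, w) 1 (\<sigma>(r := Suc (\<sigma> r)), w)"
  by (rule runs_atomic) (simp add: sstep_def)
lemma runs_Dec: "runs_le x (Dec r) (\<sigma>, w) 1 (\<sigma>(r := \<sigma> r - 1), w)"
  by (rule runs_atomic) (simp add: sstep_def)
lemma runs_Out: "runs_le x (Out b) (\<sigma>, w) 1 (\<sigma>, w @ [b])"
  by (rule runs_atomic) (simp add: sstep_def)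

text \<open>Compound commands and loops start with one step that rewrites the continuation and
  leaves the store alone.\<close>

lemma runs_prefix:
  assumes "\<And>K. sstep x (c # K, s) = (C @ K, s)" "\<And>K. (sstep x ^^ t) (C @ K, s) = (K, s')"
  shows "runs x c s (Suc t) s'"
  using assms by (simp add: runs_def funpow_Suc_right del: funpow.simps)

lemma funpow_chain: "(f ^^ m) a = b \<Longrightarrow> (f ^^ n) b = c \<Longrightarrow> (f ^^ (m + n)) a = c"
  by (metis add.commute comp_apply funpow_add)

lemma runs_Seq:
  assumes "runs_le x a s n s'" "runs_le x b s' n' s''"
  shows "runs_le x (a ;; b) s (n + n' + 1) s''"
proof -
  obtain t t' where t: "t \<le> n" "t' \<le> n'" "runs x a s t s'" "runs x b s' t' s''"
    using assms unfolding runs_le_def by blast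
  have "runs x (a ;; b) s (Suc (t + t')) s''"
  proof (rule runs_prefix)
    show "sstep x ((a ;; b) # K, s) = ([a, b] @ K, s)" for K by (simp add: sstep_def)
    show "(sstep x ^^ (t + t')) ([a, b] @ K, s) = (K, s'')" for K
      using t(3,4) unfolding runs_def by (auto intro!: funpow_chain)
  qed
  then show ?thesis unfolding runs_le_def using t(1,2) by (intro exI[of _ "Suc (t + t')"]) simp
qed

lemma runs_If:
  assumes "if holds x (fst s) b then runs_le x a s n s' else runs_le x c s n s'"
  shows "runs_le x (If b a c) s (n + 1) s'"
proof -
  define d where "d = (if holds x (fst s) b then a else c)"
  obtain t where t: "t \<le> n" "runs x d s t s'"
    using assms unfolding runs_le_def d_def by (auto split: if_splits)
  have "runs x (If b a c) s (Suc t) s'"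
  proof (rule runs_prefix)
    show "sstep x (If b a c # K, s) = ([d] @ K, s)" for K by (simp add: sstep_def d_def)
    show "(sstep x ^^ t) ([d] @ K, s) = (K, s')" for K
      using t(2) unfolding runs_def by auto
  qed
  then show ?thesis unfolding runs_le_def using t(1) by (intro exI[of _ "Suc t"]) simp
qed

lemma runs_While_False: "\<not> holds x (fst s) b \<Longrightarrow> runs_le x (While b c) s 1 s"
  by (cases s) (rule runs_atomic, simp add: sstep_def)

lemma runs_While_True:
  assumes "holds x (fst s) b" "runs_le x c s n s'" "runs_le x (While b c) s' n' s''"
  shows "runs_le x (While b c) s (n + n' + 1) s''"
proof -
  obtain t t' where t: "t \<le> n" "t' \<le> n'" "runs x c s t s'" "runs x (While b c) s' t' s''"
    using assms unfolding runs_le_def by blast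
  have "runs x (While b c) s (Suc (t + t')) s''"
  proof (rule runs_prefix)
    show "sstep x (While b c # K, s) = ([c, While b c] @ K, s)" for K
      using assms(1) by (simp add: sstep_def)
    show "(sstep x ^^ (t + t')) ([c, While b c] @ K, s) = (K, s'')" for K
      using t(3,4) unfolding runs_def by (auto intro!: funpow_chain)
  qed
  then show ?thesis unfolding runs_le_def using t(1,2) by (intro exI[of _ "Suc (t + t')"]) simp
qed

text \<open>In place of an invariant, the store after each iteration is given explicitly by the
  sequence \<open>s\<close>.\<close>

lemma runs_While:
  assumes "\<And>i. i < n \<Longrightarrow> holds x (fst (s i)) b" "\<And>i. i < n \<Longrightarrow> runs_le x c (s i) k (s (Suc i))"
    and "\<not> holds x (fst (s n)) b"
  shows "runs_le x (While b c) (s 0) (n * (k + 1) + 1) (s n)"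
proof -
  have "runs_le x (While b c) (s (n - m)) (m * (k + 1) + 1) (s n)" if "m \<le> n" for m
    using that
  proof (induction m)
    case 0
    then show ?case using runs_While_False[OF assms(3)] by simp
  next
    case (Suc m)
    let ?i = "n - Suc m"
    have i: "?i < n" "Suc ?i = n - m" using Suc.prems by auto
    have "runs_le x (While b c) (s ?i) (k + (m * (k + 1) + 1) + 1) (s n)"
      by (rule runs_While_True[OF assms(1)[OF i(1)] assms(2)[OF i(1)]]) (use Suc i in simp)
    then show ?case by (rule runs_le_mono) simp
  qed
  from this[of n] show ?thesis by simp
qed

definition "clear a = While (NZ a) (Dec a)"
definition "move a b = While (NZ a) (Dec a ;; Inc b)"
definition "subtract a b = While (NZ a) (Dec a ;; Dec b)"
text \<open>Adding a counter to another one by counting it down destroys it, so a second target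
  \<open>c\<close> is needed to restore \<open>a\<close>.\<close>

definition "copy a b c = While (NZ a) (Dec a ;; Inc b ;; Inc c) ;; move c a"

lemma runs_clear: "runs_le x (clear a) (\<sigma>, w) (2 * \<sigma> a + 1) (\<sigma>(a := 0), w)"
proof -
  let ?s = "\<lambda>i. (\<sigma>(a := \<sigma> a - i), w)"
  have "runs_le x (clear a) (?s 0) (\<sigma> a * (1 + 1) + 1) (?s (\<sigma> a))"
    unfolding clear_def
  proof (rule runs_While)
    fix i
    show "runs_le x (Dec a) (?s i) 1 (?s (Suc i))"
      using runs_Dec[of x a "\<sigma>(a := \<sigma> a - i)" w] by simp
  qed auto
  then show ?thesis by (simp add: mult_2)
qed

lemma runs_move:
  assumes "a \<noteq> b"
  shows "runs_le x (move a b) (\<sigma>, w) (4 * \<sigma> a + 1) (\<sigma>(a := 0, b := \<sigma> b + \<sigma> a), w)"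
proof -
  let ?s = "\<lambda>i. (\<sigma>(a := \<sigma> a - i, b := \<sigma> b + i), w)"
  have "runs_le x (move a b) (?s 0) (\<sigma> a * (3 + 1) + 1) (?s (\<sigma> a))"
    unfolding move_def
  proof (rule runs_While)
    fix i
    let ?m = "\<sigma>(a := \<sigma> a - Suc i, b := \<sigma> b + i)"
    have "runs_le x (Dec a) (?s i) 1 (?m, w)"
      using runs_Dec[of x a "\<sigma>(a := \<sigma> a - i, b := \<sigma> b + i)" w] assms by (simp add: fun_upd_twist)
    moreover have "runs_le x (Inc b) (?m, w) 1 (?s (Suc i))"
      using runs_Inc[of x b ?m w] assms by simp
    ultimately have "runs_le x (Dec a ;; Inc b) (?s i) (1 + 1 + 1) (?s (Suc i))"
      by (rule runs_Seq)
    then show "runs_le x (Dec a ;; Inc b) (?s i) 3 (?s (Suc i))"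
      by (rule runs_le_mono) simp
  qed (use assms in auto)
  then show ?thesis by (simp add: mult.commute)
qed

lemma runs_subtract:
  assumes "a \<noteq> b"
  shows "runs_le x (subtract a b) (\<sigma>, w) (4 * \<sigma> a + 1) (\<sigma>(a := 0, b := \<sigma> b - \<sigma> a), w)"
proof -
  let ?s = "\<lambda>i. (\<sigma>(a := \<sigma> a - i, b := \<sigma> b - i), w)"
  have "runs_le x (subtract a b) (?s 0) (\<sigma> a * (3 + 1) + 1) (?s (\<sigma> a))"
    unfolding subtract_def
  proof (rule runs_While)
    fix i
    let ?m = "\<sigma>(a := \<sigma> a - Suc i, b := \<sigma> b - i)"
    have "runs_le x (Dec a) (?s i) 1 (?m, w)"
      using runs_Dec[of x a "\<sigma>(a := \<sigma> a - i, b := \<sigma> b - i)" w] assms by (simp add: fun_upd_twist)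
    moreover have "runs_le x (Dec b) (?m, w) 1 (?s (Suc i))"
      using runs_Dec[of x b ?m w] assms by simp
    ultimately have "runs_le x (Dec a ;; Dec b) (?s i) (1 + 1 + 1) (?s (Suc i))"
      by (rule runs_Seq)
    then show "runs_le x (Dec a ;; Dec b) (?s i) 3 (?s (Suc i))"
      by (rule runs_le_mono) simp
  qed (use assms in auto)
  then show ?thesis by (simp add: mult.commute)
qed

lemma runs_copy:
  assumes "a \<noteq> b" "a \<noteq> c" "b \<noteq> c" "\<sigma> c = 0"
  shows "runs_le x (copy a b c) (\<sigma>, w) (10 * \<sigma> a + 3) (\<sigma>(b := \<sigma> b + \<sigma> a), w)"
proof -
  let ?s = "\<lambda>i. (\<sigma>(a := \<sigma> a - i, b := \<sigma> b + i, c := i), w)"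
  have "runs_le x (While (NZ a) (Dec a ;; Inc b ;; Inc c)) (?s 0) (\<sigma> a * (5 + 1) + 1) (?s (\<sigma> a))"
  proof (rule runs_While)
    fix i
    let ?m = "\<sigma>(a := \<sigma> a - Suc i, b := \<sigma> b + i, c := i)"
    let ?m' = "\<sigma>(a := \<sigma> a - Suc i, b := \<sigma> b + Suc i, c := i)"
    have "runs_le x (Dec a) (?s i) 1 (?m, w)"
      using runs_Dec[of x a "\<sigma>(a := \<sigma> a - i, b := \<sigma> b + i, c := i)" w] assms by (simp add: fun_upd_twist)
    moreover have "runs_le x (Inc b) (?m, w) 1 (?m', w)"
      using runs_Inc[of x b ?m w] assms by (simp add: fun_upd_twist)
    moreover have "runs_le x (Inc c) (?m', w) 1 (?s (Suc i))"
      using runs_Inc[of x c ?m' w] assms by simp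
    ultimately have "runs_le x (Dec a ;; Inc b ;; Inc c) (?s i) (1 + (1 + 1 + 1) + 1) (?s (Suc i))"
      by (intro runs_Seq)
    then show "runs_le x (Dec a ;; Inc b ;; Inc c) (?s i) 5 (?s (Suc i))"
      by (rule runs_le_mono) simp
  qed (use assms in auto)
  moreover have "\<sigma>(c := 0) = \<sigma>" using assms by auto
  ultimately have "runs_le x (While (NZ a) (Dec a ;; Inc b ;; Inc c)) (\<sigma>, w) (6 * \<sigma> a + 1) (?s (\<sigma> a))"
    by (simp add: mult.commute)
  from runs_Seq[OF this runs_move[of c a]] assms
  have "runs_le x (copy a b c) (\<sigma>, w) (6 * \<sigma> a + 1 + (4 * \<sigma> a + 1) + 1)
     (\<sigma>(a := 0, b := \<sigma> b + \<sigma> a, c := 0, a := \<sigma> a), w)"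
    by (simp add: copy_def)
  moreover have "\<sigma>(a := 0, b := \<sigma> b + \<sigma> a, c := 0, a := \<sigma> a) = \<sigma>(b := \<sigma> b + \<sigma> a)"
    using assms by (auto simp: fun_eq_iff)
  ultimately have "runs_le x (copy a b c) (\<sigma>, w) (6 * \<sigma> a + 1 + (4 * \<sigma> a + 1) + 1) (\<sigma>(b := \<sigma> b + \<sigma> a), w)"
    by (simp only:)
  then show ?thesis by (rule runs_le_mono) simp
qed

text \<open>From base 2 on, constants and sums are absorbed by the exponent, so no coefficients are
  needed.\<close>

definition polyb :: "(nat \<Rightarrow> nat) \<Rightarrow> bool" where
  "polyb f \<longleftrightarrow> (\<exists>c. \<forall>B\<ge>2. f B \<le> B ^ c)"

lemma polyb_const: "polyb (\<lambda>_. k)"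
  unfolding polyb_def
proof (intro exI allI impI)
  fix B :: nat assume "2 \<le> B"
  then have "2 ^ k \<le> B ^ k" by (rule power_mono) simp
  then show "k \<le> B ^ k" using less_exp[of k] by linarith
qed

lemma polyb_id: "polyb (\<lambda>B. B)"
  unfolding polyb_def by (intro exI[of _ 1]) auto

lemma polyb_mult:
  assumes "polyb f" "polyb g" shows "polyb (\<lambda>B. f B * g B)"
proof -
  obtain c d where "\<forall>B\<ge>2. f B \<le> B ^ c" "\<forall>B\<ge>2. g B \<le> B ^ d"
    using assms unfolding polyb_def by blast
  then show ?thesis unfolding polyb_def
    by (intro exI[of _ "c + d"]) (auto simp: power_add intro!: mult_le_mono)
qed

lemma polyb_add:
  assumes "polyb f" "polyb g" shows "polyb (\<lambda>B. f B + g B)"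
proof -
  obtain c d where cd: "\<forall>B\<ge>2. f B \<le> B ^ c" "\<forall>B\<ge>2. g B \<le> B ^ d"
    using assms unfolding polyb_def by blast
  show ?thesis unfolding polyb_def
  proof (intro exI allI impI)
    fix B :: nat assume B: "2 \<le> B"
    have "f B \<le> B ^ (c + d)" "g B \<le> B ^ (c + d)"
      using cd B power_increasing[of c "c + d" B] power_increasing[of d "c + d" B]
      by (meson le_add1 le_add2 le_trans one_le_numeral)+
    then have "f B + g B \<le> 2 * B ^ (c + d)" by simp
    also have "\<dots> \<le> B ^ Suc (c + d)" using B by simp
    finally show "f B + g B \<le> B ^ Suc (c + d)" .
  qed
qed

lemma polyb_comp:
  assumes "polyb f" "polyb g" "\<And>B. B \<ge> 2 \<Longrightarrow> g B \<ge> 2" shows "polyb (\<lambda>B. f (g B))"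
proof -
  obtain c d where cd: "\<forall>B\<ge>2. f B \<le> B ^ c" "\<forall>B\<ge>2. g B \<le> B ^ d"
    using assms unfolding polyb_def by blast
  show ?thesis unfolding polyb_def
  proof (intro exI allI impI)
    fix B :: nat assume B: "2 \<le> B"
    have "f (g B) \<le> g B ^ c" using cd assms(3)[OF B] by blast
    also have "\<dots> \<le> (B ^ d) ^ c" using cd B by (intro power_mono) auto
    finally show "f (g B) \<le> B ^ (d * c)" by (simp add: power_mult)
  qed
qed

lemmas polyb_intros = polyb_const polyb_id polyb_mult polyb_add

text \<open>Variable \<open>i\<close> is stored in register \<open>vs i\<close>; the registers from \<open>r\<close> on are free for use as scratch.
  Variables bound by a sum or a loop are numbered in the style of de Bruijn.\<close>
definition env_ok :: "bool list \<Rightarrow> nat \<Rightarrow> (nat \<Rightarrow> nat) \<Rightarrow> nat \<Rightarrow> (nat \<Rightarrow> nat) \<Rightarrow> bool" where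
  "env_ok x B vs r \<sigma> \<longleftrightarrow> length x \<le> B \<and> 2 \<le> B \<and> 1 \<le> r \<and> (\<forall>i. vs i < r) \<and>
    (\<forall>i\<ge>r. \<sigma> i = 0) \<and> \<sigma> 0 = 0 \<and> (\<forall>i. \<sigma> (vs i) \<le> B)"

text \<open>\<open>f\<close> bounds the running time and also the value, so that the value can be
  bound to a variable under a larger \<open>B\<close>. The result goes to the first free register,
  and everything else is restored.\<close>

definition evaluates :: "(bool list \<Rightarrow> (nat \<Rightarrow> nat) \<Rightarrow> nat) \<Rightarrow> ((nat \<Rightarrow> nat) \<Rightarrow> nat \<Rightarrow> com) \<Rightarrow> (nat \<Rightarrow> nat) \<Rightarrow> bool"
where
  "evaluates g prg f \<longleftrightarrow> polyb f \<and> (\<forall>x B vs r \<sigma> w. env_ok x B vs r \<sigma> \<longrightarrow>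
     g x (\<lambda>i. \<sigma> (vs i)) \<le> f B \<and>
     runs_le x (prg vs r) (\<sigma>, w) (f B) (\<sigma>(r := g x (\<lambda>i. \<sigma> (vs i))), w))"

definition polyfun :: "(bool list \<Rightarrow> (nat \<Rightarrow> nat) \<Rightarrow> nat) \<Rightarrow> bool" where
  "polyfun g \<longleftrightarrow> (\<exists>prg f. evaluates g prg f)"

lemma polyfun_I:
  assumes "polyb f" and "\<And>x B vs r \<sigma> w. env_ok x B vs r \<sigma> \<Longrightarrow> g x (\<lambda>i. \<sigma> (vs i)) \<le> f B"
    "\<And>x B vs r \<sigma> w. env_ok x B vs r \<sigma> \<Longrightarrow>
      runs_le x (prg vs r) (\<sigma>, w) (f B) (\<sigma>(r := g x (\<lambda>i. \<sigma> (vs i))), w)"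
  shows "polyfun g"
  using assms unfolding polyfun_def evaluates_def by blast

lemma evaluatesD:
  assumes "evaluates g prg f"
  shows "polyb f"
    "\<And>x B vs r \<sigma>. env_ok x B vs r \<sigma> \<Longrightarrow> g x (\<lambda>i. \<sigma> (vs i)) \<le> f B"
    "\<And>x B vs r \<sigma> w. env_ok x B vs r \<sigma> \<Longrightarrow>
      runs_le x (prg vs r) (\<sigma>, w) (f B) (\<sigma>(r := g x (\<lambda>i. \<sigma> (vs i))), w)"
  using assms unfolding evaluates_def by auto

lemma env_ok_push: "env_ok x B vs r \<sigma> \<Longrightarrow> env_ok x B vs (Suc r) (\<sigma>(r := v))"
  unfolding env_ok_def by (auto simp: less_Suc_eq)

lemma env_push: "env_ok x B vs r \<sigma> \<Longrightarrow> (\<lambda>i. (\<sigma>(r := v)) (vs i)) = (\<lambda>i. \<sigma> (vs i))"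
  unfolding env_ok_def by (auto simp: fun_eq_iff)

text \<open>A newly bound value may exceed \<open>B\<close>; the bound is raised to
  \<open>B'\<close> for all variables at once.\<close>

lemma env_ok_bind:
  assumes "env_ok x B vs r \<sigma>" "v \<le> B'" "B \<le> B'"
  shows "env_ok x B' (case_nat r vs) (Suc r) (\<sigma>(r := v))"
    "(\<lambda>i. (\<sigma>(r := v)) (case_nat r vs i)) = case_nat v (\<lambda>i. \<sigma> (vs i))"
    "(\<lambda>i. (\<sigma>(r := v)) (case_nat r vs (Suc i))) = (\<lambda>i. \<sigma> (vs i))"
    "(\<sigma>(r := v)) (case_nat r vs 0) = v"
proof -
  have v: "vs i \<noteq> r" "vs i < r" "\<sigma> (vs i) \<le> B" for i
    using assms unfolding env_ok_def by (auto simp: less_le)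
  show "(\<lambda>i. (\<sigma>(r := v)) (case_nat r vs (Suc i))) = (\<lambda>i. \<sigma> (vs i))" "(\<sigma>(r := v)) (case_nat r vs 0) = v"
    using v by auto
  show "(\<lambda>i. (\<sigma>(r := v)) (case_nat r vs i)) = case_nat v (\<lambda>i. \<sigma> (vs i))"
    using v by (auto simp: fun_eq_iff split: nat.split)
  show "env_ok x B' (case_nat r vs) (Suc r) (\<sigma>(r := v))"
    using assms v unfolding env_ok_def
    by (auto simp: less_Suc_eq split: nat.splits) (meson le_trans)+
qed

section \<open>Closure under arithmetic, bounded sums and binding\<close>

lemma polyfun_const: "polyfun (\<lambda>_ _. k)"
proof (rule polyfun_I[where f = "\<lambda>_. 2 * k + 1" and prg = "\<lambda>_ r. ((\<lambda>c. Inc r ;; c) ^^ k) Skip"])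
  show "polyb (\<lambda>_. 2 * k + 1)" by (rule polyb_const)
next
  fix x B vs r \<sigma> and w :: "bool list" assume ok: "env_ok x B vs r \<sigma>"
  have "runs_le x (((\<lambda>c. Inc r ;; c) ^^ k) Skip) (\<sigma>, w) (2 * k + 1) (\<sigma>(r := \<sigma> r + k), w)" for \<sigma>
  proof (induction k arbitrary: \<sigma>)
    case 0
    then show ?case using runs_Skip by simp
  next
    case (Suc k)
    from runs_Seq[OF runs_Inc Suc[of "\<sigma>(r := Suc (\<sigma> r))"]]
    show ?case by (simp cong: if_cong)
  qed
  then show "runs_le x (((\<lambda>c. Inc r ;; c) ^^ k) Skip) (\<sigma>, w) (2 * k + 1) (\<sigma>(r := k), w)"
    using ok unfolding env_ok_def by (metis add_0 order_refl)
qed auto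

lemma polyfun_var: "polyfun (\<lambda>_ \<rho>. \<rho> i)"
proof (rule polyfun_I[where f = "\<lambda>B. 10 * B + 3" and prg = "\<lambda>vs r. copy (vs i) r (Suc r)"])
  show "polyb (\<lambda>B. 10 * B + 3)" by (intro polyb_intros)
next
  fix x B vs r \<sigma> and w :: "bool list" assume ok: "env_ok x B vs r \<sigma>"
  then have "vs i < r" "\<sigma> r = 0" "\<sigma> (Suc r) = 0" "\<sigma> (vs i) \<le> B" by (auto simp: env_ok_def)
  then show "runs_le x (copy (vs i) r (Suc r)) (\<sigma>, w) (10 * B + 3) (\<sigma>(r := \<sigma> (vs i)), w)"
    using runs_copy[of "vs i" r "Suc r" \<sigma> x w] by (auto elim!: runs_le_mono)
  show "\<sigma> (vs i) \<le> 10 * B + 3" using \<open>\<sigma> (vs i) \<le> B\<close> by simp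
qed

text \<open>Only the assignment of registers to variables changes, so it costs no time. With
  \<open>Suc\<close> it moves an expression under a binder.\<close>

lemma polyfun_rename:
  assumes "polyfun g" shows "polyfun (\<lambda>x \<rho>. g x (\<lambda>i. \<rho> (h i)))"
proof -
  obtain prg f where "evaluates g prg f"
    using assms unfolding polyfun_def by blast
  note g = evaluatesD[OF this]
  have ok: "env_ok x B vs r \<sigma> \<Longrightarrow> env_ok x B (\<lambda>i. vs (h i)) r \<sigma>" for x B vs r \<sigma>
    by (auto simp: env_ok_def)
  show ?thesis
    by (rule polyfun_I[where f = f and prg = "\<lambda>vs. prg (\<lambda>i. vs (h i))", OF g(1)])
       (use g(2,3)[OF ok] in auto)
qed

lemma polyfun_binop:
  assumes a: "polyfun a" and b: "polyfun b"
    and c: "\<And>x r \<sigma> w. runs_le x (c r) (\<sigma>, w) (4 * \<sigma> (Suc r) + 1)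
       (\<sigma>(Suc r := 0, r := h (\<sigma> r) (\<sigma> (Suc r))), w)"
    and h: "\<And>a b. h a b \<le> a + b"
  shows "polyfun (\<lambda>x \<rho>. h (a x \<rho>) (b x \<rho>))"
proof -
  obtain ca fa where "evaluates a ca fa"
    using a unfolding polyfun_def by blast
  note fa = evaluatesD[OF this]
  obtain cb fb where "evaluates b cb fb"
    using b unfolding polyfun_def by blast
  note fb = evaluatesD[OF this]
  show ?thesis
  proof (rule polyfun_I[where f = "\<lambda>B. fa B + fb B + 4 * fb B + 3"
        and prg = "\<lambda>vs r. ca vs r ;; cb vs (Suc r) ;; c r"])
    show "polyb (\<lambda>B. fa B + fb B + 4 * fb B + 3)" using fa(1) fb(1) by (intro polyb_intros)
  next
    fix x B vs r \<sigma> and w :: "bool list" assume ok: "env_ok x B vs r \<sigma>"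
    let ?a = "a x (\<lambda>i. \<sigma> (vs i))" and ?b = "b x (\<lambda>i. \<sigma> (vs i))"
    let ?s = "\<sigma>(r := ?a)"
    note ok' = env_ok_push[OF ok, of ?a]
    note 1 = fa(3)[OF ok]
    note 2 = fb(3)[OF ok', unfolded env_push[OF ok], of w]
    note 3 = c[of x r "\<sigma>(r := ?a, Suc r := ?b)" w]
    have bnd: "?a \<le> fa B" "?b \<le> fb B" using fa(2)[OF ok] fb(2)[OF ok] by auto
    have "\<sigma>(r := ?a, Suc r := ?b, Suc r := 0, r := h ?a ?b) = \<sigma>(r := h ?a ?b)"
      using ok by (auto simp: fun_eq_iff env_ok_def)
    with 3 have 3: "runs_le x (c r) (\<sigma>(r := ?a, Suc r := ?b), w) (4 * ?b + 1) (\<sigma>(r := h ?a ?b), w)"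
      by simp
    show "runs_le x (ca vs r ;; cb vs (Suc r) ;; c r) (\<sigma>, w) (fa B + fb B + 4 * fb B + 3) (\<sigma>(r := h ?a ?b), w)"
      by (rule runs_le_mono[OF runs_Seq[OF 1 runs_Seq[OF 2 3]]]) (use bnd in simp)
    show "h ?a ?b \<le> fa B + fb B + 4 * fb B + 3" using h[of ?a ?b] bnd by linarith
  qed
qed

lemma polyfun_add: "polyfun a \<Longrightarrow> polyfun b \<Longrightarrow> polyfun (\<lambda>x \<rho>. a x \<rho> + b x \<rho>)"
  by (rule polyfun_binop[where c = "\<lambda>r. move (Suc r) r"]) (use runs_move in auto)

lemma polyfun_diff: "polyfun a \<Longrightarrow> polyfun b \<Longrightarrow> polyfun (\<lambda>x \<rho>. a x \<rho> - b x \<rho>)"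
  by (rule polyfun_binop[where c = "\<lambda>r. subtract (Suc r) r"]) (use runs_subtract in auto)

lemma polyfun_sum:
  assumes N: "polyfun N" and G: "polyfun (\<lambda>x \<rho>. G x (\<lambda>i. \<rho> (Suc i)) (\<rho> 0))"
  shows "polyfun (\<lambda>x \<rho>. \<Sum>i<N x \<rho>. G x \<rho> i)"
proof -
  obtain ca fa where "evaluates N ca fa"
    using N unfolding polyfun_def by blast
  note fa = evaluatesD[OF this]
  obtain cb fb where "evaluates (\<lambda>x \<rho>. G x (\<lambda>i. \<rho> (Suc i)) (\<rho> 0)) cb fb"
    using G unfolding polyfun_def by blast
  note fb = evaluatesD[OF this]
  \<comment> \<open>The summation index reaches up to \<open>fa B\<close>, so the summand is
    evaluated under the bound \<open>B + fa B\<close>.\<close>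
  define F where "F B = fb (B + fa B)" for B
  have F: "polyb F" unfolding F_def
    by (rule polyb_comp[OF fb(1)]) (auto intro!: polyb_intros fa)
  \<comment> \<open>Register \<open>r\<close> accumulates the sum, the next one counts the remaining
    rounds, the third is the index variable, and the fourth receives the summand.\<close>
  let ?prg = "\<lambda>vs r. ca vs (Suc r) ;; While (NZ (Suc r)) (Dec (Suc r) ;;
          cb (case_nat (Suc (Suc r)) vs) (Suc (Suc (Suc r))) ;; move (Suc (Suc (Suc r))) r ;;
          Inc (Suc (Suc r))) ;; clear (Suc (Suc r))"
  show ?thesis
  proof (rule polyfun_I[where f = "\<lambda>B. fa B + fa B * (5 * F B + 8) + 2 * fa B + 5 + fa B * F B"
        and prg = ?prg])
    show "polyb (\<lambda>B. fa B + fa B * (5 * F B + 8) + 2 * fa B + 5 + fa B * F B)"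
      using fa(1) F by (intro polyb_intros)
  next
    fix x B vs r \<sigma> and w :: "bool list" assume ok: "env_ok x B vs r \<sigma>"
    let ?\<rho> = "\<lambda>i. \<sigma> (vs i)"
    define n where "n = N x ?\<rho>"
    define g where "g = G x ?\<rho>"
    have n: "n \<le> fa B" using fa(2)[OF ok] by (simp add: n_def)
    have z: "\<sigma> r = 0" "\<sigma> (Suc r) = 0" "\<sigma> (Suc (Suc r)) = 0" "\<sigma> (Suc (Suc (Suc r))) = 0"
      using ok by (auto simp: env_ok_def)
    have ok1: "env_ok x B vs (Suc (Suc r)) (\<sigma>(r := a, Suc r := b))"
         and \<rho>1: "(\<lambda>i. (\<sigma>(r := a, Suc r := b)) (vs i)) = ?\<rho>" for a b
      using env_ok_push[OF env_ok_push[OF ok, of a], of b] env_push[OF env_ok_push[OF ok, of a], of b] env_push[OF ok, of a]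
      by simp_all
    let ?m = "\<lambda>a b i. \<sigma>(r := a, Suc r := b, Suc (Suc r) := i)"
    have ok2: "env_ok x (B + fa B) (case_nat (Suc (Suc r)) vs) (Suc (Suc (Suc r))) (?m a b i)"
      and \<rho>2: "(\<lambda>j. ?m a b i (case_nat (Suc (Suc r)) vs j)) = case_nat i ?\<rho>" if "i < n" for a b i
      using env_ok_bind[OF ok1[of a b], of i "B + fa B"] that n unfolding \<rho>1 by auto
    have \<rho>3: "(\<lambda>j. ?m a b i (case_nat (Suc (Suc r)) vs (Suc j))) = ?\<rho>"
        "?m a b i (case_nat (Suc (Suc r)) vs 0) = i" if "i < n" for a b i
      using env_ok_bind(3,4)[OF ok1[of a b], of i "B + fa B", unfolded \<rho>1] that n by linarith+
    have g: "g i \<le> F B" if "i < n" for i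
      using fb(2)[OF ok2[OF that]] \<rho>3[OF that] by (simp add: F_def g_def)
    let ?s = "\<lambda>i. (?m (\<Sum>j<i. g j) (n - i) i, w)"
    have s0: "(\<sigma>(Suc r := n), w) = ?s 0" using z by (auto simp: fun_eq_iff)
    have "env_ok x B vs (Suc r) \<sigma>" using ok by (auto simp: env_ok_def less_Suc_eq)
    from fa(3)[OF this, of w] s0
    have 1: "runs_le x (ca vs (Suc r)) (\<sigma>, w) (fa B) (?s 0)" unfolding n_def[symmetric] by simp
    have 2: "runs_le x (While (NZ (Suc r)) (Dec (Suc r) ;;
          cb (case_nat (Suc (Suc r)) vs) (Suc (Suc (Suc r))) ;; move (Suc (Suc (Suc r))) r ;;
          Inc (Suc (Suc r)))) (?s 0) (n * ((5 * F B + 7) + 1) + 1) (?s n)"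
    proof (rule runs_While)
      fix i assume i: "i < n"
      let ?a = "\<Sum>j<i. g j" and ?b = "n - Suc i"
      have a: "runs_le x (Dec (Suc r)) (?s i) 1 (?m ?a ?b i, w)"
        using runs_Dec[of x "Suc r" "?m ?a (n - i) i" w] by (simp add: fun_upd_twist)
      have b: "runs_le x (cb (case_nat (Suc (Suc r)) vs) (Suc (Suc (Suc r)))) (?m ?a ?b i, w) (F B)
          ((?m ?a ?b i)(Suc (Suc (Suc r)) := g i), w)"
        using fb(3)[OF ok2[OF i, of ?a ?b], of w] unfolding \<rho>3[OF i] by (simp add: F_def g_def)
      have "(?m ?a ?b i)(Suc (Suc (Suc r)) := g i, Suc (Suc (Suc r)) := 0, r := ?a + g i) = ?m (?a + g i) ?b i"
        using z by (auto simp: fun_eq_iff)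
      with runs_move[of "Suc (Suc (Suc r))" r x "(?m ?a ?b i)(Suc (Suc (Suc r)) := g i)" w]
      have c: "runs_le x (move (Suc (Suc (Suc r))) r) ((?m ?a ?b i)(Suc (Suc (Suc r)) := g i), w) (4 * g i + 1)
          (?m (?a + g i) ?b i, w)" by simp
      have d: "runs_le x (Inc (Suc (Suc r))) (?m (?a + g i) ?b i, w) 1 (?s (Suc i))"
        using runs_Inc[of x "Suc (Suc r)" "?m (?a + g i) ?b i" w] by simp
      show "runs_le x (Dec (Suc r) ;; cb (case_nat (Suc (Suc r)) vs) (Suc (Suc (Suc r))) ;;
          move (Suc (Suc (Suc r))) r ;; Inc (Suc (Suc r))) (?s i) (5 * F B + 7) (?s (Suc i))"
        by (rule runs_le_mono[OF runs_Seq[OF a runs_Seq[OF b runs_Seq[OF c d]]]]) (use g[OF i] in simp)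
    qed auto
    have "(?m (\<Sum>j<n. g j) (n - n) n)(Suc (Suc r) := 0) = \<sigma>(r := \<Sum>j<n. g j)"
      using z by (auto simp: fun_eq_iff)
    with runs_clear[of x "Suc (Suc r)" "?m (\<Sum>j<n. g j) (n - n) n" w]
    have 3: "runs_le x (clear (Suc (Suc r))) (?s n) (2 * n + 1) (\<sigma>(r := \<Sum>j<n. g j), w)"
      by simp
    have n': "n * (5 * F B + 8) \<le> fa B * (5 * F B + 8)" using n by (rule mult_le_mono1)
    have "runs_le x (?prg vs r) (\<sigma>, w)
       (fa B + fa B * (5 * F B + 8) + 2 * fa B + 5 + fa B * F B) (\<sigma>(r := \<Sum>j<n. g j), w)"
    proof (rule runs_le_mono[OF runs_Seq[OF 1 runs_Seq[OF 2 3]]])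
      have "n * ((5 * F B + 7) + 1) = n * (5 * F B + 8)" by simp
      with n' n show "fa B + (n * (5 * F B + 7 + 1) + 1 + (2 * n + 1) + 1) + 1
        \<le> fa B + fa B * (5 * F B + 8) + 2 * fa B + 5 + fa B * F B" by linarith
    qed
    then show "runs_le x (?prg vs r) (\<sigma>, w)
       (fa B + fa B * (5 * F B + 8) + 2 * fa B + 5 + fa B * F B) (\<sigma>(r := \<Sum>i<N x ?\<rho>. G x ?\<rho> i), w)"
      by (simp add: n_def g_def)
    have "(\<Sum>j<n. g j) \<le> n * F B" using sum_bounded_above[of "{..<n}" g "F B"] g by simp
    also have "\<dots> \<le> fa B * F B" using n by (rule mult_le_mono1)
    finally show "(\<Sum>i<N x ?\<rho>. G x ?\<rho> i) \<le> fa B + fa B * (5 * F B + 8) + 2 * fa B + 5 + fa B * F B"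
      by (simp add: n_def g_def)
  qed
qed

text \<open>The source of all composition rules: the argument is evaluated once and becomes variable
  0.\<close>

lemma polyfun_let:
  assumes a: "polyfun a" and h: "polyfun h"
  shows "polyfun (\<lambda>x \<rho>. h x (case_nat (a x \<rho>) \<rho>))"
proof -
  obtain ca fa where "evaluates a ca fa"
    using a unfolding polyfun_def by blast
  note fa = evaluatesD[OF this]
  obtain cb fb where "evaluates h cb fb"
    using h unfolding polyfun_def by blast
  note fb = evaluatesD[OF this]
  define F where "F B = fb (B + fa B)" for B
  have F: "polyb F" unfolding F_def
    by (rule polyb_comp[OF fb(1)]) (auto intro!: polyb_intros fa)
  show ?thesis
  proof (rule polyfun_I[where f = "\<lambda>B. 3 * fa B + 5 * F B + 5"
        and prg = "\<lambda>vs r. ca vs r ;; cb (case_nat r vs) (Suc r) ;; clear r ;; move (Suc r) r"])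
    show "polyb (\<lambda>B. 3 * fa B + 5 * F B + 5)" using fa(1) F by (intro polyb_intros)
  next
    fix x B vs r \<sigma> and w :: "bool list" assume ok: "env_ok x B vs r \<sigma>"
    define u where "u = a x (\<lambda>i. \<sigma> (vs i))"
    define v where "v = h x (case_nat u (\<lambda>i. \<sigma> (vs i)))"
    have u: "u \<le> fa B" using fa(2)[OF ok] by (simp add: u_def)
    have "env_ok x (B + fa B) (case_nat r vs) (Suc r) (\<sigma>(r := u))"
        and \<rho>: "(\<lambda>i. (\<sigma>(r := u)) (case_nat r vs i)) = case_nat u (\<lambda>i. \<sigma> (vs i))"
      using env_ok_bind[OF ok, of u "B + fa B"] u by auto
    note ok' = this(1)
    have v: "v \<le> F B" using fb(2)[OF ok'] unfolding \<rho> F_def v_def by simp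
    have z: "\<sigma> (Suc r) = 0" using ok by (auto simp: env_ok_def)
    note 1 = fa(3)[OF ok, of w, folded u_def]
    note 2 = fb(3)[OF ok', of w, unfolded \<rho>, folded v_def F_def]
    note 3 = runs_clear[of x r "\<sigma>(r := u, Suc r := v)" w]
    note 4 = runs_move[of "Suc r" r x "\<sigma>(r := u, Suc r := v, r := 0)" w]
    have eq: "\<sigma>(r := u, Suc r := v, r := 0, Suc r := 0, r := v) = \<sigma>(r := v)"
      using z by (auto simp: fun_eq_iff)
    from 4 eq have 4: "runs_le x (move (Suc r) r) (\<sigma>(r := u, Suc r := v, r := 0), w) (4 * v + 1) (\<sigma>(r := v), w)"
      by simp
    have "runs_le x (ca vs r ;; cb (case_nat r vs) (Suc r) ;; clear r ;; move (Suc r) r) (\<sigma>, w)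
       (3 * fa B + 5 * F B + 5) (\<sigma>(r := v), w)"
      by (rule runs_le_mono[OF runs_Seq[OF 1 runs_Seq[OF 2 runs_Seq[OF 3 4]]]]) (use u v in simp)
    then show "runs_le x (ca vs r ;; cb (case_nat r vs) (Suc r) ;; clear r ;; move (Suc r) r) (\<sigma>, w)
       (3 * fa B + 5 * F B + 5) (\<sigma>(r := h x (case_nat (a x (\<lambda>i. \<sigma> (vs i))) (\<lambda>i. \<sigma> (vs i)))), w)"
      by (simp add: u_def v_def)
    show "h x (case_nat (a x (\<lambda>i. \<sigma> (vs i))) (\<lambda>i. \<sigma> (vs i))) \<le> 3 * fa B + 5 * F B + 5"
      using v by (simp add: u_def v_def)
  qed
qed

lemma polyfun_length: "polyfun (\<lambda>x _. length x)"
proof (rule polyfun_I[where f = "\<lambda>B. 6 * B + 3"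
      and prg = "\<lambda>_ r. While In (Inc 0 ;; Inc r) ;; clear 0"])
  show "polyb (\<lambda>B. 6 * B + 3)" by (intro polyb_intros)
next
  fix x B vs r \<sigma> and w :: "bool list" assume ok: "env_ok x B vs r \<sigma>"
  then have z: "\<sigma> 0 = 0" "\<sigma> r = 0" "r \<noteq> 0" and B: "length x \<le> B" by (auto simp: env_ok_def)
  let ?s = "\<lambda>i. (\<sigma>(0 := i, r := i), w)"
  have "\<sigma>(0 := 0, r := 0) = \<sigma>" using z by auto
  moreover have "runs_le x (While In (Inc 0 ;; Inc r)) (?s 0) (length x * (3 + 1) + 1) (?s (length x))"
  proof (rule runs_While)
    fix i
    have "runs_le x (Inc 0) (?s i) 1 (\<sigma>(0 := Suc i, r := i), w)"
      using runs_Inc[of x 0 "\<sigma>(0 := i, r := i)" w] z by (simp add: fun_upd_twist)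
    moreover have "runs_le x (Inc r) (\<sigma>(0 := Suc i, r := i), w) 1 (?s (Suc i))"
      using runs_Inc[of x r "\<sigma>(0 := Suc i, r := i)" w] z by simp
    ultimately have "runs_le x (Inc 0 ;; Inc r) (?s i) (1 + 1 + 1) (?s (Suc i))"
      by (rule runs_Seq)
    then show "runs_le x (Inc 0 ;; Inc r) (?s i) 3 (?s (Suc i))"
      by (rule runs_le_mono) simp
  qed (use z in auto)
  ultimately have 1: "runs_le x (While In (Inc 0 ;; Inc r)) (\<sigma>, w) (length x * 4 + 1) (?s (length x))"
    by simp
  have "\<sigma>(0 := length x, r := length x, 0 := 0) = \<sigma>(r := length x)"
    using z by (auto simp: fun_eq_iff)
  with runs_clear[of x 0 "\<sigma>(0 := length x, r := length x)" w] z
  have 2: "runs_le x (clear 0) (?s (length x)) (2 * length x + 1) (\<sigma>(r := length x), w)" by simp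
  show "runs_le x (While In (Inc 0 ;; Inc r) ;; clear 0) (\<sigma>, w) (6 * B + 3) (\<sigma>(r := length x), w)"
    by (rule runs_le_mono[OF runs_Seq[OF 1 2]]) (use B in simp)
  show "length x \<le> 6 * B + 3" using B by simp
qed

text \<open>Moving the position into register 0 walks the head of the input tape to the cell in
  question; clearing the register walks it back.\<close>

lemma polyfun_bit:
  assumes a: "polyfun a" shows "polyfun (\<lambda>x \<rho>. of_bool (a x \<rho> < length x \<and> x ! a x \<rho>))"
proof -
  obtain ca fa where "evaluates a ca fa"
    using a unfolding polyfun_def by blast
  note fa = evaluatesD[OF this]
  show ?thesis
  proof (rule polyfun_I[where f = "\<lambda>B. fa B + 6 * fa B + 7"
        and prg = "\<lambda>vs r. ca vs r ;; move r 0 ;; If (Sym True) (Inc r) Skip ;; clear 0"])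
    show "polyb (\<lambda>B. fa B + 6 * fa B + 7)" using fa(1) by (intro polyb_intros)
  next
    fix x B vs r \<sigma> and w :: "bool list" assume ok: "env_ok x B vs r \<sigma>"
    then have z: "\<sigma> 0 = 0" "\<sigma> r = 0" "r \<noteq> 0" by (auto simp: env_ok_def)
    define u where "u = a x (\<lambda>i. \<sigma> (vs i))"
    define v where "v = (of_bool (u < length x \<and> x ! u) :: nat)"
    have u: "u \<le> fa B" using fa(2)[OF ok] by (simp add: u_def)
    note 1 = fa(3)[OF ok, of w, folded u_def]
    have "\<sigma>(r := u, r := 0, 0 := u) = \<sigma>(0 := u)" using z by (auto simp: fun_eq_iff)
    with runs_move[of r 0 x "\<sigma>(r := u)" w] z
    have 2: "runs_le x (move r 0) (\<sigma>(r := u), w) (4 * u + 1) (\<sigma>(0 := u), w)" by simp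
    have 3: "runs_le x (If (Sym True) (Inc r) Skip) (\<sigma>(0 := u), w) (1 + 1) (\<sigma>(0 := u, r := v), w)"
      by (rule runs_If) (use z runs_Inc[of x r "\<sigma>(0 := u)" w] runs_Skip[of x "(\<sigma>(0 := u), w)"] in
          \<open>auto simp: v_def fun_upd_idem\<close>)
    have "\<sigma>(0 := u, r := v, 0 := 0) = \<sigma>(r := v)" using z by (auto simp: fun_eq_iff)
    with runs_clear[of x 0 "\<sigma>(0 := u, r := v)" w] z
    have 4: "runs_le x (clear 0) (\<sigma>(0 := u, r := v), w) (2 * u + 1) (\<sigma>(r := v), w)" by simp
    have "runs_le x (ca vs r ;; move r 0 ;; If (Sym True) (Inc r) Skip ;; clear 0) (\<sigma>, w) (fa B + 6 * fa B + 7)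
      (\<sigma>(r := v), w)"
      by (rule runs_le_mono[OF runs_Seq[OF 1 runs_Seq[OF 2 runs_Seq[OF 3 4]]]]) (use u in simp)
    then show "runs_le x (ca vs r ;; move r 0 ;; If (Sym True) (Inc r) Skip ;; clear 0) (\<sigma>, w) (fa B + 6 * fa B + 7)
      (\<sigma>(r := of_bool (a x (\<lambda>i. \<sigma> (vs i)) < length x \<and> x ! a x (\<lambda>i. \<sigma> (vs i)))), w)"
      by (simp add: u_def v_def)
  qed auto
qed

section \<open>Programs that print, and binary output\<close>

definition prints :: "(bool list \<Rightarrow> (nat \<Rightarrow> nat) \<Rightarrow> bool list) \<Rightarrow> ((nat \<Rightarrow> nat) \<Rightarrow> nat \<Rightarrow> com) \<Rightarrow> (nat \<Rightarrow> nat) \<Rightarrow> bool"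
where
  "prints g prg f \<longleftrightarrow> polyb f \<and> (\<forall>x B vs r \<sigma> w. env_ok x B vs r \<sigma> \<longrightarrow>
     runs_le x (prg vs r) (\<sigma>, w) (f B) (\<sigma>, w @ g x (\<lambda>i. \<sigma> (vs i))))"

definition polyout :: "(bool list \<Rightarrow> (nat \<Rightarrow> nat) \<Rightarrow> bool list) \<Rightarrow> bool" where
  "polyout g \<longleftrightarrow> (\<exists>prg f. prints g prg f)"

lemma polyout_I:
  assumes "polyb f" and
    "\<And>x B vs r \<sigma> w. env_ok x B vs r \<sigma> \<Longrightarrow>
      runs_le x (prg vs r) (\<sigma>, w) (f B) (\<sigma>, w @ g x (\<lambda>i. \<sigma> (vs i)))"
  shows "polyout g"
  using assms unfolding polyout_def prints_def by blast

lemma printsD: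
  assumes "prints g prg f"
  shows "polyb f"
    "\<And>x B vs r \<sigma> w. env_ok x B vs r \<sigma> \<Longrightarrow>
      runs_le x (prg vs r) (\<sigma>, w) (f B) (\<sigma>, w @ g x (\<lambda>i. \<sigma> (vs i)))"
  using assms unfolding prints_def by auto

lemma polyout_append:
  assumes "polyout a" "polyout b" shows "polyout (\<lambda>x \<rho>. a x \<rho> @ b x \<rho>)"
proof -
  obtain ca fa where "prints a ca fa"
    using assms(1) unfolding polyout_def by blast
  note fa = printsD[OF this]
  obtain cb fb where "prints b cb fb"
    using assms(2) unfolding polyout_def by blast
  note fb = printsD[OF this]
  show ?thesis
  proof (rule polyout_I[where f = "\<lambda>B. fa B + fb B + 1" and prg = "\<lambda>vs r. ca vs r ;; cb vs r"])
    show "polyb (\<lambda>B. fa B + fb B + 1)" using fa(1) fb(1) by (intro polyb_intros)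
    show "runs_le x (ca vs r ;; cb vs r) (\<sigma>, w) (fa B + fb B + 1) (\<sigma>, w @ a x (\<lambda>i. \<sigma> (vs i)) @ b x (\<lambda>i. \<sigma> (vs i)))"
      if "env_ok x B vs r \<sigma>" for x B vs r \<sigma> w
      using runs_Seq[OF fa(2)[OF that, of w] fb(2)[OF that]] by simp
  qed
qed

lemma polyout_for:
  assumes N: "polyfun N" and G: "polyout (\<lambda>x \<rho>. G x (\<lambda>i. \<rho> (Suc i)) (\<rho> 0))"
  shows "polyout (\<lambda>x \<rho>. concat (map (G x \<rho>) [0..<N x \<rho>]))"
proof -
  obtain ca fa where "evaluates N ca fa"
    using N unfolding polyfun_def by blast
  note fa = evaluatesD[OF this]
  obtain cb fb where "prints (\<lambda>x \<rho>. G x (\<lambda>i. \<rho> (Suc i)) (\<rho> 0)) cb fb"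
    using G unfolding polyout_def by blast
  note fb = printsD[OF this]
  define F where "F B = fb (B + fa B)" for B
  have F: "polyb F" unfolding F_def
    by (rule polyb_comp[OF fb(1)]) (auto intro!: polyb_intros fa)
  let ?prg = "\<lambda>vs r. ca vs r ;; While (NZ r) (Dec r ;;
          cb (case_nat (Suc r) vs) (Suc (Suc r)) ;; Inc (Suc r)) ;; clear (Suc r)"
  show ?thesis
  proof (rule polyout_I[where f = "\<lambda>B. fa B + fa B * (F B + 5) + 2 * fa B + 4" and prg = ?prg])
    show "polyb (\<lambda>B. fa B + fa B * (F B + 5) + 2 * fa B + 4)"
      using fa(1) F by (intro polyb_intros)
  next
    fix x B vs r \<sigma> and w :: "bool list" assume ok: "env_ok x B vs r \<sigma>"
    let ?\<rho> = "\<lambda>i. \<sigma> (vs i)"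
    define n where "n = N x ?\<rho>"
    define g where "g = G x ?\<rho>"
    have n: "n \<le> fa B" using fa(2)[OF ok] by (simp add: n_def)
    have z: "\<sigma> r = 0" "\<sigma> (Suc r) = 0"
      using ok by (auto simp: env_ok_def)
    let ?m = "\<lambda>b i. \<sigma>(r := b, Suc r := i)"
    have ok2: "env_ok x (B + fa B) (case_nat (Suc r) vs) (Suc (Suc r)) (?m b i)"
      and \<rho>2: "(\<lambda>j. ?m b i (case_nat (Suc r) vs j)) = case_nat i ?\<rho>" if "i < n" for b i
      using env_ok_bind[OF env_ok_push[OF ok, of b], of i "B + fa B"] that n
      unfolding env_push[OF ok] by auto
    have \<rho>3: "(\<lambda>j. ?m b i (case_nat (Suc r) vs (Suc j))) = ?\<rho>"
        "?m b i (case_nat (Suc r) vs 0) = i" if "i < n" for b i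
      using env_ok_bind(3,4)[OF env_ok_push[OF ok, of b], of i "B + fa B", unfolded env_push[OF ok]] that n by linarith+
    let ?s = "\<lambda>i. (?m (n - i) i, w @ concat (map g [0..<i]))"
    have s0: "(\<sigma>(r := n), w) = ?s 0" using z by (auto simp: fun_eq_iff)
    from fa(3)[OF ok, of w] s0
    have 1: "runs_le x (ca vs r) (\<sigma>, w) (fa B) (?s 0)" unfolding n_def[symmetric] by simp
    have 2: "runs_le x (While (NZ r) (Dec r ;;
          cb (case_nat (Suc r) vs) (Suc (Suc r)) ;; Inc (Suc r))) (?s 0) (n * ((F B + 4) + 1) + 1) (?s n)"
    proof (rule runs_While)
      fix i assume i: "i < n"
      let ?w = "w @ concat (map g [0..<i])"
      have a: "runs_le x (Dec r) (?s i) 1 (?m (n - Suc i) i, ?w)"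
        using runs_Dec[of x r "?m (n - i) i" ?w] by (simp add: fun_upd_twist)
      have b: "runs_le x (cb (case_nat (Suc r) vs) (Suc (Suc r))) (?m (n - Suc i) i, ?w) (F B)
          (?m (n - Suc i) i, ?w @ g i)"
        using fb(2)[OF ok2[OF i, of "n - Suc i"], of ?w] unfolding \<rho>3[OF i] by (simp add: F_def g_def)
      have d: "runs_le x (Inc (Suc r)) (?m (n - Suc i) i, ?w @ g i) 1 (?s (Suc i))"
        using runs_Inc[of x "Suc r" "?m (n - Suc i) i" "?w @ g i"] by simp
      show "runs_le x (Dec r ;; cb (case_nat (Suc r) vs) (Suc (Suc r)) ;; Inc (Suc r)) (?s i) (F B + 4) (?s (Suc i))"
        by (rule runs_le_mono[OF runs_Seq[OF a runs_Seq[OF b d]]]) simp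
    qed auto
    have "(?m (n - n) n)(Suc r := 0) = \<sigma>"
      using z by (auto simp: fun_eq_iff)
    with runs_clear[of x "Suc r" "?m (n - n) n" "w @ concat (map g [0..<n])"]
    have 3: "runs_le x (clear (Suc r)) (?s n) (2 * n + 1) (\<sigma>, w @ concat (map g [0..<n]))"
      by simp
    have n': "n * (F B + 5) \<le> fa B * (F B + 5)" using n by (rule mult_le_mono1)
    have "runs_le x (?prg vs r) (\<sigma>, w) (fa B + fa B * (F B + 5) + 2 * fa B + 4) (\<sigma>, w @ concat (map g [0..<n]))"
    proof (rule runs_le_mono[OF runs_Seq[OF 1 runs_Seq[OF 2 3]]])
      have "n * ((F B + 4) + 1) = n * (F B + 5)" by simp
      with n' n show "fa B + (n * (F B + 4 + 1) + 1 + (2 * n + 1) + 1) + 1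
        \<le> fa B + fa B * (F B + 5) + 2 * fa B + 4" by linarith
    qed
    then show "runs_le x (?prg vs r) (\<sigma>, w) (fa B + fa B * (F B + 5) + 2 * fa B + 4)
      (\<sigma>, w @ concat (map (G x ?\<rho>) [0..<N x ?\<rho>]))"
      by (simp add: n_def g_def)
  qed
qed

definition "halve r = While (NZ r) (Dec r ;; If (NZ r) (Dec r ;; Inc (Suc r)) (Inc (Suc (Suc r))))"

lemma runs_halve:
  "runs_le x (halve r) (\<sigma>, w) (7 * \<sigma> r + 1)
    (\<sigma>(r := 0, Suc r := \<sigma> (Suc r) + \<sigma> r div 2, Suc (Suc r) := \<sigma> (Suc (Suc r)) + \<sigma> r mod 2), w)"
proof (induction "\<sigma> r" arbitrary: \<sigma> rule: less_induct)
  case less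
  show ?case
  proof (cases "\<sigma> r = 0")
    case True
    then have "\<sigma>(r := 0) = \<sigma>" by auto
    with True show ?thesis
      using runs_While_False[of x "(\<sigma>, w)" "NZ r"] by (simp add: halve_def fun_upd_idem)
  next
    case False
    let ?d = "\<sigma>(r := \<sigma> r - 1)"
    let ?e = "if \<sigma> r = 1 then ?d(Suc (Suc r) := Suc (\<sigma> (Suc (Suc r)))) else \<sigma>(r := \<sigma> r - 2, Suc r := Suc (\<sigma> (Suc r)))"
    have 2: "runs_le x (If (NZ r) (Dec r ;; Inc (Suc r)) (Inc (Suc (Suc r)))) (?d, w) (3 + 1) (?e, w)"
    proof (rule runs_If)
      have a: "runs_le x (Inc (Suc (Suc r))) (?d, w) 3 (?d(Suc (Suc r) := Suc (\<sigma> (Suc (Suc r)))), w)"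
        using runs_Inc[of x "Suc (Suc r)" ?d w] by (auto elim!: runs_le_mono)
      have "runs_le x (Dec r) (?d, w) 1 (\<sigma>(r := \<sigma> r - 2), w)"
        using runs_Dec[of x r ?d w] by (simp add: numeral_2_eq_2)
      moreover have "runs_le x (Inc (Suc r)) (\<sigma>(r := \<sigma> r - 2), w) 1 (\<sigma>(r := \<sigma> r - 2, Suc r := Suc (\<sigma> (Suc r))), w)"
        using runs_Inc[of x "Suc r" "\<sigma>(r := \<sigma> r - 2)" w] by simp
      ultimately have b: "runs_le x (Dec r ;; Inc (Suc r)) (?d, w) (1 + 1 + 1) (\<sigma>(r := \<sigma> r - 2, Suc r := Suc (\<sigma> (Suc r))), w)"
        by (rule runs_Seq)
      show "if holds x (fst (?d, w)) (NZ r) then runs_le x (Dec r ;; Inc (Suc r)) (?d, w) 3 (?e, w)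
        else runs_le x (Inc (Suc (Suc r))) (?d, w) 3 (?e, w)"
        using a b False by (auto simp: numeral_3_eq_3)
    qed
    have body: "runs_le x (Dec r ;; If (NZ r) (Dec r ;; Inc (Suc r)) (Inc (Suc (Suc r)))) (\<sigma>, w) (1 + (3 + 1) + 1) (?e, w)"
      using runs_Dec 2 by (rule runs_Seq)
    have "?e r < \<sigma> r" using False by auto
    from less[of ?e, OF this]
    have "runs_le x (halve r) (?e, w) (7 * ?e r + 1)
      (?e(r := 0, Suc r := ?e (Suc r) + ?e r div 2, Suc (Suc r) := ?e (Suc (Suc r)) + ?e r mod 2), w)" .
    also have "?e(r := 0, Suc r := ?e (Suc r) + ?e r div 2, Suc (Suc r) := ?e (Suc (Suc r)) + ?e r mod 2) =
      \<sigma>(r := 0, Suc r := \<sigma> (Suc r) + \<sigma> r div 2, Suc (Suc r) := \<sigma> (Suc (Suc r)) + \<sigma> r mod 2)"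
    proof (cases "\<sigma> r = 1")
      case False
      with \<open>\<sigma> r \<noteq> 0\<close> obtain k where "\<sigma> r = k + 2" by (metis One_nat_def Suc_1 add.commute add_2_eq_Suc' not0_implies_Suc)
      then show ?thesis by (auto simp: fun_eq_iff)
    qed (auto simp: fun_eq_iff)
    finally have "runs_le x (halve r) (?e, w) (7 * ?e r + 1)
      (\<sigma>(r := 0, Suc r := \<sigma> (Suc r) + \<sigma> r div 2, Suc (Suc r) := \<sigma> (Suc (Suc r)) + \<sigma> r mod 2), w)" .
    from runs_While_True[OF _ body this[unfolded halve_def]] False
    have "runs_le x (halve r) (\<sigma>, w) (1 + (3 + 1) + 1 + (7 * ?e r + 1) + 1)
      (\<sigma>(r := 0, Suc r := \<sigma> (Suc r) + \<sigma> r div 2, Suc (Suc r) := \<sigma> (Suc (Suc r)) + \<sigma> r mod 2), w)"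
      by (simp add: halve_def)
    then show ?thesis by (rule runs_le_mono) (use \<open>?e r < \<sigma> r\<close> in linarith)
  qed
qed

text \<open>Each bit is preceded by \<open>True\<close>, as in \<open>self_delimiting\<close>;
  repeated halving yields the least significant bit first, as in \<open>binary\<close>. The closing
  \<open>False\<close> is left to the caller.\<close>

definition "out_bits r = While (NZ r) (Out True ;; halve r ;;
    If (NZ (Suc (Suc r))) (Dec (Suc (Suc r)) ;; Out True) (Out False) ;; move (Suc r) r)"

lemma runs_out_bits:
  assumes "\<sigma> (Suc r) = 0" "\<sigma> (Suc (Suc r)) = 0"
  shows "runs_le x (out_bits r) (\<sigma>, w) (\<sigma> r * (11 * \<sigma> r + 11) + 1)
    (\<sigma>(r := 0), w @ concat (map (\<lambda>x. [True, x]) (binary (\<sigma> r))))"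
  using assms
proof (induction "\<sigma> r" arbitrary: \<sigma> w rule: less_induct)
  case less
  show ?case
  proof (cases "\<sigma> r = 0")
    case True
    then have "\<sigma>(r := 0) = \<sigma>" by auto
    with True show ?thesis
      using runs_While_False[of x "(\<sigma>, w)" "NZ r"] by (simp add: out_bits_def binary.simps)
  next
    case False
    let ?v = "\<sigma> r"
    let ?h = "\<sigma>(r := 0, Suc r := ?v div 2, Suc (Suc r) := ?v mod 2)"
    let ?h' = "\<sigma>(r := 0, Suc r := ?v div 2)"
    note 1 = runs_Out[of x True \<sigma> w]
    have 2: "runs_le x (halve r) (\<sigma>, w @ [True]) (7 * ?v + 1) (?h, w @ [True])"
      using runs_halve[of x r \<sigma> "w @ [True]"] less.prems by simp
    have 3: "runs_le x (If (NZ (Suc (Suc r))) (Dec (Suc (Suc r)) ;; Out True) (Out False)) (?h, w @ [True]) (3 + 1)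
        (?h', w @ [True, odd ?v])"
    proof (rule runs_If)
      have h: "?h(Suc (Suc r) := 0) = ?h'" using less.prems by (auto simp: fun_eq_iff)
      have "runs_le x (Dec (Suc (Suc r))) (?h, w @ [True]) 1 (?h', w @ [True])" if "odd ?v"
        using runs_Dec[of x "Suc (Suc r)" ?h "w @ [True]"] that h by (simp add: odd_iff_mod_2_eq_one)
      from runs_Seq[OF this runs_Out, of True]
      have a: "runs_le x (Dec (Suc (Suc r)) ;; Out True) (?h, w @ [True]) 3 (?h', w @ [True, True])" if "odd ?v"
        using that by (simp add: numeral_3_eq_3)
      have "?h = ?h'" if "even ?v" using less.prems that by (auto simp: fun_eq_iff even_iff_mod_2_eq_zero)
      then have b: "runs_le x (Out False) (?h, w @ [True]) 3 (?h', w @ [True, False])" if "even ?v"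
        using that runs_le_mono[OF runs_Out[of x False ?h' "w @ [True]"], of 3] by simp
      show "if holds x (fst (?h, w @ [True])) (NZ (Suc (Suc r)))
        then runs_le x (Dec (Suc (Suc r)) ;; Out True) (?h, w @ [True]) 3 (?h', w @ [True, odd ?v])
        else runs_le x (Out False) (?h, w @ [True]) 3 (?h', w @ [True, odd ?v])"
        using a b by (cases "odd ?v") (auto simp: odd_iff_mod_2_eq_one)
    qed
    have e: "?h'(Suc r := 0, r := ?v div 2) = \<sigma>(r := ?v div 2)"
      using less.prems by (auto simp: fun_eq_iff)
    have 4: "runs_le x (move (Suc r) r) (?h', w @ [True, odd ?v]) (4 * (?v div 2) + 1) (\<sigma>(r := ?v div 2), w @ [True, odd ?v])"
      using runs_move[of "Suc r" r x ?h' "w @ [True, odd ?v]"] e by simp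
    note body = runs_Seq[OF 1 runs_Seq[OF 2 runs_Seq[OF 3 4]]]
    have "runs_le x (out_bits r) (\<sigma>(r := ?v div 2), w @ [True, odd ?v]) (?v div 2 * (11 * (?v div 2) + 11) + 1)
      (\<sigma>(r := 0), (w @ [True, odd ?v]) @ concat (map (\<lambda>x. [True, x]) (binary (?v div 2))))"
      using less.hyps[of "\<sigma>(r := ?v div 2)" "w @ [True, odd ?v]"] less.prems False by simp
    from runs_While_True[OF _ body this[unfolded out_bits_def]] False
    have "runs_le x (out_bits r) (\<sigma>, w) (1 + (7 * ?v + 1 + (3 + 1 + (4 * (?v div 2) + 1) + 1) + 1) + 1
        + (?v div 2 * (11 * (?v div 2) + 11) + 1) + 1)
      (\<sigma>(r := 0), w @ concat (map (\<lambda>x. [True, x]) (binary ?v)))"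
      by (simp add: out_bits_def binary.simps[of ?v])
    then show ?thesis
    proof (rule runs_le_mono)
      \<comment> \<open>It suffices to bound half of the value by its predecessor: the quadratic
        then drops by 22 times the value, while one round costs at most 9 times the value plus
        12.\<close>
      obtain u where u: "?v = Suc u" using False by (cases ?v) auto
      have "?v div 2 \<le> u" using u by simp
      then have "?v div 2 * (11 * (?v div 2) + 11) \<le> u * (11 * u + 11)" by (intro mult_le_mono) auto
      moreover have "4 * (?v div 2) \<le> 2 * ?v" by simp
      moreover have "?v * (11 * ?v + 11) = u * (11 * u + 11) + 22 * u + 22" by (simp add: u algebra_simps)
      ultimately show "1 + (7 * ?v + 1 + (3 + 1 + (4 * (?v div 2) + 1) + 1) + 1) + 1
        + (?v div 2 * (11 * (?v div 2) + 11) + 1) + 1 \<le> ?v * (11 * ?v + 11) + 1"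
        using u by linarith
    qed
  qed
qed

lemma polyout_encode_nat:
  assumes "polyfun a" shows "polyout (\<lambda>x \<rho>. encode_nat (a x \<rho>))"
proof -
  obtain ca fa where "evaluates a ca fa"
    using assms unfolding polyfun_def by blast
  note fa = evaluatesD[OF this]
  show ?thesis
  proof (rule polyout_I[where f = "\<lambda>B. fa B + fa B * (11 * fa B + 11) + 4" and prg = "\<lambda>vs r. ca vs r ;; out_bits r ;; Out False"])
    show "polyb (\<lambda>B. fa B + fa B * (11 * fa B + 11) + 4)" using fa(1) by (intro polyb_intros)
  next
    fix x B vs r \<sigma> and w :: "bool list" assume ok: "env_ok x B vs r \<sigma>"
    define u where "u = a x (\<lambda>i. \<sigma> (vs i))"
    have u: "u \<le> fa B" using fa(2)[OF ok] by (simp add: u_def)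
    then have u2: "u * (11 * u + 11) \<le> fa B * (11 * fa B + 11)" by (intro mult_le_mono) auto
    note 1 = fa(3)[OF ok, of w, folded u_def]
    have "\<sigma>(r := 0) = \<sigma>" using ok by (auto simp: env_ok_def)
    then have 2: "runs_le x (out_bits r) (\<sigma>(r := u), w) (u * (11 * u + 11) + 1) (\<sigma>, w @ concat (map (\<lambda>x. [True, x]) (binary u)))"
      using runs_out_bits[of "\<sigma>(r := u)" r x w] ok by (simp add: env_ok_def)
    have "runs_le x (ca vs r ;; out_bits r ;; Out False) (\<sigma>, w) (fa B + fa B * (11 * fa B + 11) + 4) (\<sigma>, w @ encode_nat u)"
      using runs_le_mono[OF runs_Seq[OF 1 runs_Seq[OF 2 runs_Out[of x False]]], of "fa B + fa B * (11 * fa B + 11) + 4"] u2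
      by (simp add: encode_nat_def self_delimiting_def)
    then show "runs_le x (ca vs r ;; out_bits r ;; Out False) (\<sigma>, w) (fa B + fa B * (11 * fa B + 11) + 4) (\<sigma>, w @ encode_nat (a x (\<lambda>i. \<sigma> (vs i))))"
      by (simp add: u_def)
  qed
qed

text \<open>The polynomial \<open>[:2, 1:] ^ c\<close> is the \<open>c\<close>-th power of the input
  length plus 2, and this base is an admissible \<open>B\<close> at the start.\<close>

theorem polytime_computable_polyout:
  assumes "polyout (\<lambda>x _. g x)" shows "polytime_computable g"
proof -
  obtain prg f where "prints (\<lambda>x _. g x) prg f"
    using assms unfolding polyout_def by blast
  note f = printsD[OF this]
  then obtain c where c: "\<And>B. B \<ge> 2 \<Longrightarrow> f B \<le> B ^ c" unfolding polyb_def by blast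
  show ?thesis
  proof (rule polytime_computable_com[where p = "[:2, 1:] ^ c" and c = "prg (\<lambda>_. 0) 1"])
    fix x :: "bool list"
    have "env_ok x (length x + 2) (\<lambda>_. 0) 1 (\<lambda>_. 0)" by (auto simp: env_ok_def)
    from f(2)[OF this, of "[]"] obtain t where "t \<le> f (length x + 2)" "runs x (prg (\<lambda>_. 0) 1) (\<lambda>_. 0, []) t (\<lambda>_. 0, g x)"
      unfolding runs_le_def by auto
    moreover have "f (length x + 2) \<le> poly ([:2, 1:] ^ c) (length x)"
      using c[of "length x + 2"] by (simp add: add.commute)
    ultimately show "\<exists>t\<le>poly ([:2, 1:] ^ c) (length x). \<exists>\<sigma>. runs x (prg (\<lambda>_. 0) 1) (\<lambda>_. 0, []) t (\<sigma>, g x)"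
      by (meson le_trans)
  qed
qed

section \<open>Derived arithmetic, comparisons and case distinctions\<close>

lemma polyfun_mult:
  assumes a: "polyfun a" and b: "polyfun b" shows "polyfun (\<lambda>x \<rho>. a x \<rho> * b x \<rho>)"
  using polyfun_sum[OF a, of "\<lambda>x \<rho> _. b x \<rho>"] polyfun_rename[OF b] by simp

lemma polyfun_Suc: "polyfun a \<Longrightarrow> polyfun (\<lambda>x \<rho>. Suc (a x \<rho>))"
  using polyfun_add[OF _ polyfun_const[of 1]] by simp

lemma polyfun_less:
  assumes "polyfun a" "polyfun b" shows "polyfun (\<lambda>x \<rho>. of_bool (a x \<rho> < b x \<rho>))"
proof -
  have "(of_bool (p < q) :: nat) = 1 - (1 - (q - p))" for p q :: nat by auto
  then show ?thesis using assms by (simp only:) (intro polyfun_diff polyfun_const)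
qed

lemma polyfun_not:
  assumes "polyfun (\<lambda>x \<rho>. of_bool (P x \<rho>))" shows "polyfun (\<lambda>x \<rho>. of_bool (\<not> P x \<rho>))"
proof -
  have "(of_bool (\<not> p) :: nat) = 1 - of_bool p" for p by simp
  then show ?thesis using polyfun_diff[OF polyfun_const[of 1] assms] by (simp only:)
qed

lemma polyfun_conj:
  assumes "polyfun (\<lambda>x \<rho>. of_bool (P x \<rho>))" "polyfun (\<lambda>x \<rho>. of_bool (Q x \<rho>))"
  shows "polyfun (\<lambda>x \<rho>. of_bool (P x \<rho> \<and> Q x \<rho>))"
  using polyfun_mult[OF assms] by (simp add: of_bool_conj)

lemma polyfun_disj:
  assumes "polyfun (\<lambda>x \<rho>. of_bool (P x \<rho>))" "polyfun (\<lambda>x \<rho>. of_bool (Q x \<rho>))"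
  shows "polyfun (\<lambda>x \<rho>. of_bool (P x \<rho> \<or> Q x \<rho>))"
  using polyfun_not[OF polyfun_conj[OF polyfun_not[OF assms(1)] polyfun_not[OF assms(2)]]] by simp

lemma polyfun_le:
  assumes "polyfun a" "polyfun b" shows "polyfun (\<lambda>x \<rho>. of_bool (a x \<rho> \<le> b x \<rho>))"
  using polyfun_not[OF polyfun_less[OF assms(2,1)]] by (simp add: not_less)

lemma polyfun_eq:
  assumes "polyfun a" "polyfun b" shows "polyfun (\<lambda>x \<rho>. of_bool (a x \<rho> = b x \<rho>))"
  using polyfun_conj[OF polyfun_le[OF assms] polyfun_le[OF assms(2,1)]] by (simp add: eq_iff)

lemma polyfun_if:
  assumes "polyfun (\<lambda>x \<rho>. of_bool (P x \<rho>))" "polyfun a" "polyfun b"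
  shows "polyfun (\<lambda>x \<rho>. if P x \<rho> then a x \<rho> else b x \<rho>)"
proof -
  have "(if p then u else v) = of_bool p * u + (1 - of_bool p) * v" for p and u v :: nat by simp
  then show ?thesis using assms by (simp only:) (intro polyfun_add polyfun_mult polyfun_diff polyfun_const)
qed

lemma polyfun_comp1:
  assumes "polyfun (\<lambda>x \<rho>. h x (\<rho> 0))" "polyfun a" shows "polyfun (\<lambda>x \<rho>. h x (a x \<rho>))"
  using polyfun_let[OF assms(2,1)] by simp

text \<open>Reduces an expression with arbitrary arguments to one in plain variables; the renaming
  shifts \<open>a\<close> past the variable that holds \<open>b\<close>.\<close>

lemma polyfun_comp2:
  assumes h: "polyfun (\<lambda>x \<rho>. h x (\<rho> 0) (\<rho> (Suc 0)))" and a: "polyfun a" and b: "polyfun b"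
  shows "polyfun (\<lambda>x \<rho>. h x (a x \<rho>) (b x \<rho>))"
  using polyfun_let[OF b polyfun_let[OF polyfun_rename[OF a, of Suc] h]] by simp

lemma polyfun_comp3:
  assumes h: "polyfun (\<lambda>x \<rho>. h x (\<rho> 0) (\<rho> (Suc 0)) (\<rho> (Suc (Suc 0))))" and a: "polyfun a" and b: "polyfun b" and c: "polyfun c"
  shows "polyfun (\<lambda>x \<rho>. h x (a x \<rho>) (b x \<rho>) (c x \<rho>))"
  using polyfun_let[OF c polyfun_let[OF polyfun_rename[OF b, of Suc] polyfun_let[OF polyfun_rename[OF a, of "\<lambda>i. Suc (Suc i)"] h]]] by simp

text \<open>The quotient counts the positive multiples of \<open>b\<close> up to
  \<open>a\<close>.\<close>

lemma div_as_sum: "0 < b \<Longrightarrow> (\<Sum>q<a. of_bool (Suc q * b \<le> a)) = a div (b :: nat)"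
proof -
  assume b: "0 < b"
  have "(\<Sum>q<a. of_bool (Suc q * b \<le> a)) = card {q. q < a \<and> Suc q * b \<le> a}"
    by (simp add: Collect_conj_eq Int_commute lessThan_def)
  also have "{q. q < a \<and> Suc q * b \<le> a} = {..<a div b}"
  proof -
    have "q < a \<and> Suc q * b \<le> a \<longleftrightarrow> q < a div b" for q
      using b less_eq_div_iff_mult_less_eq[of b "Suc q" a] div_le_dividend[of a b] by linarith
    then show ?thesis by auto
  qed
  finally show ?thesis by simp
qed

lemma polyfun_div:
  assumes a: "polyfun a" and b: "polyfun b" shows "polyfun (\<lambda>x \<rho>. a x \<rho> div b x \<rho>)"
proof (rule polyfun_comp2[OF _ a b])
  have "p div q = (if q = 0 then 0 else (\<Sum>i<p. of_bool (Suc i * q \<le> p)))" for p q :: nat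
    by (auto simp only: div_as_sum div_by_0 neq0_conv split: if_split)
  then show "polyfun (\<lambda>x \<rho>. \<rho> 0 div \<rho> (Suc 0))"
    by (simp only:) (intro polyfun_if polyfun_eq polyfun_sum polyfun_le polyfun_mult polyfun_Suc polyfun_var polyfun_const)
qed

lemma polyfun_mod:
  assumes a: "polyfun a" and b: "polyfun b" shows "polyfun (\<lambda>x \<rho>. a x \<rho> mod b x \<rho>)"
  using polyfun_diff[OF a polyfun_mult[OF polyfun_div[OF a b] b]] by (simp add: minus_div_mult_eq_mod)

lemma polyfun_poly:
  fixes p :: "nat poly" assumes "polyfun a" shows "polyfun (\<lambda>x \<rho>. poly p (a x \<rho>))"
proof (induction p)
  case (pCons c p)
  then show ?case using assms by (simp add: polyfun_add polyfun_mult polyfun_const)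
qed (simp add: polyfun_const)

lemma polyfun_mem:
  assumes "finite F" "polyfun a" shows "polyfun (\<lambda>x \<rho>. of_bool (a x \<rho> \<in> F))"
  using assms(1)
proof (induction F rule: finite_induct)
  case (insert c F)
  then show ?case unfolding insert_iff using assms(2) by (intro polyfun_disj polyfun_eq polyfun_const)
qed (simp add: polyfun_const)

text \<open>Each case may have a program of its own, because \<open>N\<close> is fixed and the
  distinction is unrolled. It serves to select one of the finitely many rules of a machine.\<close>

lemma polyfun_cases:
  assumes g: "\<And>c. c < N \<Longrightarrow> polyfun (g c)" and a: "polyfun a"
  shows "polyfun (\<lambda>x \<rho>. if a x \<rho> < N then g (a x \<rho>) x \<rho> else 0)"
proof -
  have "polyfun (\<lambda>x \<rho>. \<Sum>c<k. of_bool (a x \<rho> = c) * g c x \<rho>)" if "k \<le> N" for k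
    using that
  proof (induction k)
    case (Suc k)
    then have "polyfun (g k)" using g by simp
    then show ?case using Suc a by simp (intro polyfun_add polyfun_mult polyfun_eq polyfun_const, auto)
  qed (simp add: polyfun_const)
  from this[of N] have "polyfun (\<lambda>x \<rho>. \<Sum>c<N. of_bool (a x \<rho> = c) * g c x \<rho>)" by simp
  moreover have "(\<Sum>c<N. of_bool (k = c) * h c) = (if k < N then h k else (0 :: nat))" for k h
  proof (cases "k < N")
    case True
    then have "(\<Sum>c<N. of_bool (k = c) * h c) = (\<Sum>c\<in>{k}. of_bool (k = c) * h c)"
      by (intro sum.mono_neutral_right) auto
    then show ?thesis using True by simp
  qed (auto intro!: sum.neutral)
  ultimately show ?thesis by simp
qed

lemmas polyfun_intros = polyfun_const polyfun_var polyfun_length polyfun_add polyfun_diff polyfun_mult polyfun_Suc polyfun_div polyfun_mod polyfun_poly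
  polyfun_if polyfun_not polyfun_conj polyfun_disj polyfun_less polyfun_le polyfun_eq polyfun_sum

text \<open>Instances may differ in irrelevant values and share a code, so membership only yields
  some instance \<open>J\<close> with this code. Faithfulness of the encoding carries its schedule
  over to \<open>I\<close>.\<close>

lemma Min_Age_iff:
  assumes "valid_instance I"
  shows "encode_instance I Q \<in> Min_Age \<longleftrightarrow> (\<exists>S. feasible I S \<and> Age I S \<le> int Q)"
proof
  assume "encode_instance I Q \<in> Min_Age"
  then obtain J R S where e: "encode_instance I Q = encode_instance J R" and S: "feasible J S" "Age J S \<le> int R"
    unfolding Min_Age_def by blast
  note eq = encode_instance_inject[OF e]
  have m: "i \<in> {1..senders I} \<Longrightarrow> msgs I i = msgs J i" for i using eq(4) by blast
  have b: "i \<in> {1..senders I} \<Longrightarrow> j \<le> msgs I i \<Longrightarrow> birthday I i j = birthday J i j" for i j using eq(4) by blast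
  have t: "total_msgs I = total_msgs J" unfolding total_msgs_def eq(1)[symmetric] using m by (intro sum.cong) auto
  have ms: "messages I = messages J" unfolding messages_def eq(1)[symmetric] using m by (intro Sigma_cong) auto
  have f: "feasible I S" using S(1) unfolding feasible_def ms t eq(1,2) using m eq(1) by auto
  have lm: "lm I S i t = lm J S i t" "lm I S i t \<le> msgs I i" if "i \<in> {1..senders I}" for i t
  proof -
    show "lm I S i t = lm J S i t" using m[OF that] by (simp add: lm_def)
    have "lm I S i t \<in> {j. j \<le> msgs I i \<and> (j = 0 \<or> S (i, j) \<le> t)}"
      unfolding lm_def by (rule Max_in) (auto intro: finite_subset[of _ "{..msgs I i}"])
    then show "lm I S i t \<le> msgs I i" by simp
  qed
  have a: "age I S i t = age J S i t" if "i \<in> {1..senders I}" for i t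
    using lm[OF that, of t] m[OF that] b[OF that lm(2)[OF that], of t] by (simp add: age_def)
  have "Age I S = Age J S" unfolding Age_def eq(2)[symmetric] t[symmetric] eq(1)[symmetric]
    using a by (intro sum.cong refl) auto
  then show "\<exists>S. feasible I S \<and> Age I S \<le> int Q" using f S(2) eq(3) by auto
next
  assume "\<exists>S. feasible I S \<and> Age I S \<le> int Q"
  then show "encode_instance I Q \<in> Min_Age" using assms unfolding Min_Age_def by blast
qed

section \<open>Polynomial-time computability of the reduction to Min-Age\<close>

locale poly_chains =
  fixes n K :: "bool list \<Rightarrow> nat" and l :: "bool list \<Rightarrow> nat \<Rightarrow> nat \<Rightarrow> nat" and d :: "bool list \<Rightarrow> nat \<Rightarrow> nat"
  assumes n: "polyfun (\<lambda>x \<rho>. n x)" and K: "polyfun (\<lambda>x \<rho>. K x)"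
    and l0: "polyfun (\<lambda>x \<rho>. l x (\<rho> 0) (\<rho> (Suc 0)))" and d0: "polyfun (\<lambda>x \<rho>. d x (\<rho> 0))"
begin

lemmas l = polyfun_comp2[OF l0] and d = polyfun_comp1[OF d0]

lemma pre: "polyfun a \<Longrightarrow> polyfun b \<Longrightarrow> polyfun (\<lambda>x \<rho>. chains.pre (l x) (a x \<rho>) (b x \<rho>))"
  by (rule polyfun_comp2) (auto simp only: chains.pre_def intro!: polyfun_intros l)

lemma len: "polyfun a \<Longrightarrow> polyfun (\<lambda>x \<rho>. chains.len (K x) (l x) (a x \<rho>))"
  unfolding chains.len_def by (intro pre polyfun_intros K)

lemma total: "polyfun (\<lambda>x \<rho>. chains.total (n x) (K x) (l x))"
  unfolding chains.total_def by (intro len polyfun_intros n)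

lemma finished: "polyfun a \<Longrightarrow> polyfun b \<Longrightarrow> polyfun (\<lambda>x \<rho>. chains.finished (K x) (l x) (a x \<rho>) (b x \<rho>))"
  by (rule polyfun_comp2) (auto simp only: chains.finished_def intro!: polyfun_intros l pre K)

lemma bday: "polyfun a \<Longrightarrow> polyfun b \<Longrightarrow> polyfun (\<lambda>x \<rho>. chains.bday (n x) (K x) (l x) (d x) (a x \<rho>) (b x \<rho>))"
  unfolding chains.bday_def by (intro polyfun_intros d len total finished)

lemma tri: "polyfun a \<Longrightarrow> polyfun (\<lambda>x \<rho>. tri (a x \<rho>))"
  unfolding tri_def by (intro polyfun_intros)

lemma bound: "polyfun (\<lambda>x \<rho>. chains.bound (n x) (K x) (l x) (d x))"
  unfolding chains.bound_def by (intro polyfun_intros total tri n K l d)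

lemma polytime: "polytime_computable (\<lambda>x. encode_instance (chains.inst (n x) (K x) (l x) (d x)) (chains.bound (n x) (K x) (l x) (d x)))"
proof (rule polytime_computable_polyout)
  have "encode_instance (chains.inst (n x) (K x) (l x) (d x)) (chains.bound (n x) (K x) (l x) (d x)) =
    encode_nat (n x) @ encode_nat (Suc (chains.total (n x) (K x) (l x)) * chains.total (n x) (K x) (l x)) @
    encode_nat (chains.bound (n x) (K x) (l x) (d x)) @
    concat (map (\<lambda>i. encode_nat (chains.len (K x) (l x) i) @
      concat (map (\<lambda>j. encode_nat (chains.bday (n x) (K x) (l x) (d x) i j)) [0..<Suc (chains.len (K x) (l x) i)])) [0..<n x])" for x
    by (simp add: encode_instance_def chains.inst_def map_Suc_upt[symmetric] o_def del: upt_Suc)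
  then show "polyout (\<lambda>x \<rho>. encode_instance (chains.inst (n x) (K x) (l x) (d x)) (chains.bound (n x) (K x) (l x) (d x)))"
    by (simp only:) (intro polyout_append polyout_encode_nat polyout_for polyfun_intros n total bound len bday)
qed

end

locale poly_clauses =
  fixes V D m :: "bool list \<Rightarrow> nat" and C :: "bool list \<Rightarrow> nat \<Rightarrow> nat \<Rightarrow> nat \<Rightarrow> bool"
  assumes V: "polyfun (\<lambda>x \<rho>. V x)" and D: "polyfun (\<lambda>x \<rho>. D x)" and m: "polyfun (\<lambda>x \<rho>. m x)"
    and C0: "polyfun (\<lambda>x \<rho>. of_bool (C x (\<rho> 0) (\<rho> (Suc 0)) (\<rho> (Suc (Suc 0)))))"
begin

lemma C: "polyfun a \<Longrightarrow> polyfun b \<Longrightarrow> polyfun c \<Longrightarrow> polyfun (\<lambda>x \<rho>. of_bool (C x (a x \<rho>) (b x \<rho>) (c x \<rho>)))"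
  using C0 by (rule polyfun_comp3)

lemma size: "polyfun a \<Longrightarrow> polyfun (\<lambda>x \<rho>. clauses.size (V x) (m x) (a x \<rho>))"
  unfolding clauses.size_def by (intro polyfun_intros V m)

lemma items: "polyfun (\<lambda>x \<rho>. clauses.items (V x) (D x) (m x))"
  unfolding clauses.items_def by (intro polyfun_intros V D m)

lemma bins: "polyfun (\<lambda>x \<rho>. clauses.bins (V x) (m x))"
  unfolding clauses.bins_def by (intro polyfun_intros V m)

lemma big: "polyfun (\<lambda>x \<rho>. clauses.big (V x) (m x))"
  unfolding clauses.big_def by (intro polyfun_intros V m bins)

lemma letter: "polyfun a \<Longrightarrow> polyfun (\<lambda>x \<rho>. clauses.letter (V x) (a x \<rho>))"
  unfolding clauses.letter_def by (intro polyfun_intros V)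

lemma blen: "polyfun a \<Longrightarrow> polyfun b \<Longrightarrow> polyfun (\<lambda>x \<rho>. clauses.blen (V x) (D x) (m x) (C x) (a x \<rho>) (b x \<rho>))"
  unfolding clauses.blen_def by (intro polyfun_intros V D m C size items big)

lemma load: "polyfun (\<lambda>x \<rho>. clauses.load (V x) (D x) (m x) (C x))"
  unfolding clauses.load_def by (intro polyfun_intros items m blen)

lemma target: "polyfun a \<Longrightarrow> polyfun (\<lambda>x \<rho>. clauses.target (V x) (D x) (m x) (C x) (a x \<rho>))"
  by (rule polyfun_comp1) (auto simp only: clauses.target_def intro!: polyfun_intros items bins load size letter)

sublocale poly_chains "\<lambda>x. clauses.items (V x) (D x) (m x) + clauses.bins (V x) (m x)" "\<lambda>x. m x + 2"
  "\<lambda>x. clauses.blen (V x) (D x) (m x) (C x)" "\<lambda>x. clauses.target (V x) (D x) (m x) (C x)"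
  by unfold_locales (intro polyfun_intros items bins m blen target)+

theorem reducible_Min_Age:
  assumes V1: "\<And>x. 1 \<le> V x" and D1: "\<And>x. 1 \<le> D x"
    and L: "\<And>x. x \<in> L \<longleftrightarrow> msat (V x) (D x) (m x) (C x)"
  shows "polytime_reducible L Min_Age"
  unfolding polytime_reducible_def
proof (intro exI conjI allI)
  fix x
  interpret pos_clauses "V x" "D x" "m x" "C x" using V1 D1 by unfold_locales
  show "x \<in> L \<longleftrightarrow> encode_instance inst bound \<in> Min_Age"
    unfolding Min_Age_iff[OF valid] L
    using placed_if_msat msat_if_placed placed_if_bounded bounded_if_placed by blast
qed (rule polytime)

end

section \<open>The tableau of a computation\<close>

text \<open>In the halting state the symbols are written back and the heads stay, so a computation
  can be followed for a fixed time beyond its end.\<close>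

definition delta :: "tm \<Rightarrow> nat \<times> nat list \<Rightarrow> nat \<times> (nat \<times> direction) list" where
  "delta M = (\<lambda>(q, ss). if q = 1 then (1, map (\<lambda>s. (s, Stay)) ss) else trans M q ss)"

lemma step_delta:
  "step M (q, ts) = (fst (delta M (q, map read_tape ts)), map2 act_tape (snd (delta M (q, map read_tape ts))) ts)"
proof -
  have "map2 act_tape (map (\<lambda>s. (s, Stay)) (map read_tape ts)) ts = ts"
    by (induction ts) auto
  then show ?thesis by (auto simp: delta_def split: prod.split)
qed

datatype rule = Init_Sit | Init_Head nat | Init_Cell nat | Init_Gap | Next nat
  | Read nat nat | Move nat nat | Write nat nat | Keep nat nat | Accept

text \<open>One more than the offset, so that clauses about natural head positions need no
  subtraction.\<close>

fun shift :: "direction \<Rightarrow> nat" where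
  "shift Go_Left = 0" | "shift Stay = 1" | "shift Go_Right = 2"

lemma int_shift: "int (shift dir) = offset dir + 1" by (cases dir) auto

text \<open>The guard brings it into the form that \<open>polyfun_bit\<close> computes.\<close>

definition given :: "bool list \<Rightarrow> nat \<Rightarrow> bool" where
  "given x j \<longleftrightarrow> j < length x \<and> x ! j"

text \<open>The symbols that cell \<open>p\<close> (that is, position \<open>p - \<tau>\<close>) of tape \<open>i\<close> may contain initially, when the
  input is \<open>x\<close> paired with an unknown word of length at most \<open>N\<close>.\<close>
definition initial :: "bool list \<Rightarrow> nat \<Rightarrow> nat \<Rightarrow> nat \<Rightarrow> nat \<Rightarrow> nat \<Rightarrow> bool" where
  "initial x N \<tau> i p s \<longleftrightarrow>
    (i = 0 \<and> \<tau> \<le> p \<and> p - \<tau> < 2 * length x \<and>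
      ((p - \<tau>) mod 2 = 0 \<and> s = 2 \<or> (p - \<tau>) mod 2 = 1 \<and> (given x ((p - \<tau>) div 2) \<and> s = 2 \<or> \<not> given x ((p - \<tau>) div 2) \<and> s = 1))) \<or>
    (i = 0 \<and> p = \<tau> + 2 * length x \<and> s = 1) \<or>
    (i = 0 \<and> \<tau> + 2 * length x < p \<and> p \<le> \<tau> + 2 * length x + N \<and> s < 3) \<or>
    ((i \<noteq> 0 \<or> p < \<tau> \<or> \<tau> + 2 * length x + N < p) \<and> s = 0)"

text \<open>The cells of the unknown word that have a right neighbour in its zone. A blank there
  must be followed by a blank, or else the guessed symbols would not form a word.\<close>

definition gap :: "bool list \<Rightarrow> nat \<Rightarrow> nat \<Rightarrow> nat \<Rightarrow> bool" where
  "gap x N \<tau> p \<longleftrightarrow> \<tau> + 2 * length x < p \<and> p < \<tau> + 2 * length x + N"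

section \<open>The input paired with a guessed certificate\<close>

lemma self_delimiting_Cons: "self_delimiting (a # x) = True # a # self_delimiting x"
  by (simp add: self_delimiting_def)

lemma length_self_delimiting: "length (self_delimiting x) = Suc (2 * length x)"
  by (induction x) (auto simp: self_delimiting_Cons self_delimiting_def[of "[]"])

lemma nth_self_delimiting:
  "j \<le> 2 * length x \<Longrightarrow> self_delimiting x ! j = (j < 2 * length x \<and> (even j \<or> x ! (j div 2)))"
proof (induction x arbitrary: j)
  case Nil
  then show ?case by (simp add: self_delimiting_def)
next
  case (Cons a x)
  consider "j = 0" | "j = 1" | j' where "j = Suc (Suc j')" by (metis One_nat_def not0_implies_Suc)
  then show ?case using Cons by cases (auto simp: self_delimiting_Cons)
qed

text \<open>In the self-delimiting prefix, even positions hold the marker \<open>True\<close>, odd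
  ones the bits of \<open>x\<close>, and position \<open>2 * length x\<close> the final
  \<open>False\<close>; then \<open>y\<close> starts.\<close>

lemma word_tape_pair:
  "fst (word_tape (encode_pair x y)) (int p - int \<tau>) =
    (if p < \<tau> then 0
     else if p - \<tau> < 2 * length x then (if even (p - \<tau>) \<or> x ! ((p - \<tau>) div 2) then 2 else 1)
     else if p = \<tau> + 2 * length x then 1
     else if p - Suc (\<tau> + 2 * length x) < length y then bit_symbol (y ! (p - Suc (\<tau> + 2 * length x))) else 0)"
proof (cases "p < \<tau>")
  case False
  then have e: "int p - int \<tau> = int (p - \<tau>)" by simp
  show ?thesis
    unfolding e word_tape_nat using False
    by (auto simp: encode_pair_def nth_append length_self_delimiting nth_self_delimiting bit_symbol_def)
qed (simp add: word_tape_def)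

lemma initial_word:
  assumes "length y \<le> N"
  shows "initial x N \<tau> i p (fst (word_tape (if i = 0 then encode_pair x y else [])) (int p - int \<tau>))"
proof (cases "i = 0")
  case True
  have "(p - \<tau>) div 2 < length x" if "p - \<tau> < 2 * length x" using that by (simp add: less_mult_imp_div_less mult.commute)
  then show ?thesis using True assms
    unfolding initial_def word_tape_pair given_def if_P[OF True]
    by (auto simp: bit_symbol_def even_iff_mod_2_eq_zero)
qed (simp add: initial_def word_tape_def)

lemma word_if_initial:
  assumes u: "\<And>p. p < P \<Longrightarrow> initial x N \<tau> 0 p (u p)" and g: "\<And>p. p < P \<Longrightarrow> gap x N \<tau> p \<Longrightarrow> u p = 0 \<Longrightarrow> u (Suc p) = 0"
    and P: "\<tau> + 2 * length x + N < P"
  shows "\<exists>y. length y \<le> N \<and> (\<forall>p<P. u p = fst (word_tape (encode_pair x y)) (int p - int \<tau>))"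
proof -
  define b where "b = Suc (\<tau> + 2 * length x)"
  \<comment> \<open>The length of the certificate: up to the first blank of its zone, or the full
    \<open>N\<close>.\<close>
  define e where "e = (LEAST e. N \<le> e \<or> u (b + e) = 0)"
  have e1: "N \<le> e \<or> u (b + e) = 0" unfolding e_def by (rule LeastI[of _ N]) simp
  have e2: "e \<le> N" unfolding e_def by (rule Least_le) simp
  have e3: "u (b + j) \<noteq> 0" if "j < e" for j using not_less_Least[of j "\<lambda>e. N \<le> e \<or> u (b + e) = 0"] that by (simp add: e_def)
  have e4: "u (b + j) = 0" if "e \<le> j" "j < N" for j
    using that
  proof (induction j)
    case 0
    then show ?case using e1 by auto
  next
    case (Suc j)
    show ?case
    proof (cases "e = Suc j")
      case True
      then show ?thesis using e1 Suc by auto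
    next
      case False
      then have "u (b + j) = 0" using Suc by simp
      then have "u (Suc (b + j)) = 0" using Suc P by (intro g) (auto simp: gap_def b_def)
      then show ?thesis by simp
    qed
  qed
  define y where "y = map (\<lambda>j. u (b + j) = 2) [0..<e]"
  have "u p = fst (word_tape (encode_pair x y)) (int p - int \<tau>)" if p: "p < P" for p
  proof (cases "\<tau> + 2 * length x < p \<and> p \<le> \<tau> + 2 * length x + N")
    case True
    define j where "j = p - b"
    have j: "p = b + j" "j < N" using True by (auto simp: j_def b_def)
    have "u p < 3" using u[OF p] True by (auto simp: initial_def)
    moreover have "fst (word_tape (encode_pair x y)) (int p - int \<tau>) = (if j < e then bit_symbol (u (b + j) = 2) else 0)"
      unfolding word_tape_pair using True j by (auto simp: b_def y_def)
    ultimately show ?thesis using e3[of j] e4[of j] j by (auto simp: bit_symbol_def)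
  next
    case False
    have "(p - \<tau>) div 2 < length x" if "p - \<tau> < 2 * length x" using that by (simp add: less_mult_imp_div_less mult.commute)
    then show ?thesis using u[OF p] False e2
      unfolding initial_def word_tape_pair given_def by (auto simp: y_def even_iff_mod_2_eq_zero)
  qed
  then show ?thesis using e2 by (intro exI[of _ y]) (auto simp: y_def)
qed

section \<open>Clauses of the tableau and configurations of the machine\<close>

locale tableau =
  fixes M :: tm and dec :: "nat \<Rightarrow> nat \<times> nat list" and S :: nat
  assumes wf: "wf_tm M"
    and dec: "bij_betw dec {..<S} {(q, ss). q < states M \<and> length ss = tapes M \<and> set ss \<subseteq> {..<symbols M}}"
begin

abbreviation "k \<equiv> tapes M"

definition sits :: "nat \<Rightarrow> nat set" where "sits q = {d. d < S \<and> fst (dec d) = q}"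

text \<open>The variables of the tableau for time \<open>t\<close>: number 0 at cell 0 is the situation (the state and
  the symbols that are read), number \<open>Suc i\<close> at cell 0 is the position of head \<open>i\<close>, and number
  \<open>Suc k + i\<close> at cell \<open>p\<close> is the contents of cell \<open>p\<close> of tape \<open>i\<close>.\<close>
fun lit :: "bool list \<Rightarrow> nat \<Rightarrow> nat \<Rightarrow> rule \<Rightarrow> nat \<Rightarrow> nat \<Rightarrow> nat \<Rightarrow> nat \<Rightarrow> nat \<Rightarrow> nat \<Rightarrow> bool" where
  "lit x N \<tau> Init_Sit t p t' p' c d \<longleftrightarrow> t' = 0 \<and> p' = 0 \<and> c = 0 \<and> d \<in> sits 0"
| "lit x N \<tau> (Init_Head i) t p t' p' c d \<longleftrightarrow> t' = 0 \<and> p' = 0 \<and> c = Suc i \<and> d = \<tau>"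
| "lit x N \<tau> (Init_Cell i) t p t' p' c d \<longleftrightarrow> t' = 0 \<and> p' = p \<and> c = Suc k + i \<and> initial x N \<tau> i p d"
| "lit x N \<tau> Init_Gap t p t' p' c d \<longleftrightarrow> \<not> gap x N \<tau> p \<or> t' = 0 \<and> p' = p \<and> c = Suc k \<and> \<not> d = 0 \<or>
     t' = 0 \<and> p' = Suc p \<and> c = Suc k \<and> d = 0"
| "lit x N \<tau> (Next \<sigma>) t p t' p' c d \<longleftrightarrow> t = \<tau> \<or> t' = t \<and> p' = 0 \<and> c = 0 \<and> \<not> d = \<sigma> \<or>
     t' = Suc t \<and> p' = 0 \<and> c = 0 \<and> d \<in> sits (fst (delta M (dec \<sigma>)))"
| "lit x N \<tau> (Read i \<sigma>) t p t' p' c d \<longleftrightarrow> t' = t \<and> p' = 0 \<and> c = Suc i \<and> \<not> d = p \<or>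
     t' = t \<and> p' = 0 \<and> c = 0 \<and> \<not> d = \<sigma> \<or> t' = t \<and> p' = p \<and> c = Suc k + i \<and> d = snd (dec \<sigma>) ! i"
| "lit x N \<tau> (Move i \<sigma>) t p t' p' c d \<longleftrightarrow> t = \<tau> \<or> t' = t \<and> p' = 0 \<and> c = Suc i \<and> \<not> d = p \<or>
     t' = t \<and> p' = 0 \<and> c = 0 \<and> \<not> d = \<sigma> \<or>
     t' = Suc t \<and> p' = 0 \<and> c = Suc i \<and> Suc d = p + shift (snd (snd (delta M (dec \<sigma>)) ! i))"
| "lit x N \<tau> (Write i \<sigma>) t p t' p' c d \<longleftrightarrow> t = \<tau> \<or> t' = t \<and> p' = 0 \<and> c = Suc i \<and> \<not> d = p \<or>
     t' = t \<and> p' = 0 \<and> c = 0 \<and> \<not> d = \<sigma> \<or>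
     t' = Suc t \<and> p' = p \<and> c = Suc k + i \<and> d = fst (snd (delta M (dec \<sigma>)) ! i)"
| "lit x N \<tau> (Keep i s) t p t' p' c d \<longleftrightarrow> t = \<tau> \<or> t' = t \<and> p' = 0 \<and> c = Suc i \<and> d = p \<or>
     t' = t \<and> p' = p \<and> c = Suc k + i \<and> \<not> d = s \<or> t' = Suc t \<and> p' = p \<and> c = Suc k + i \<and> d = s"
| "lit x N \<tau> Accept t p t' p' c d \<longleftrightarrow> t' = \<tau> \<and> p' = \<tau> \<and> c = Suc k + (k - 1) \<and> d = 2"

text \<open>All data that depend only on the machine are unrolled into this finite set; time and
  cell remain as parameters of a clause.\<close>

definition rules :: "rule set" where
  "rules = {Init_Sit, Init_Gap, Accept} \<union> Init_Head ` {..<k} \<union> Init_Cell ` {..<k} \<union> Next ` {..<S} \<union>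
    case_prod Read ` ({..<k} \<times> {..<S}) \<union> case_prod Move ` ({..<k} \<times> {..<S}) \<union>
    case_prod Write ` ({..<k} \<times> {..<S}) \<union> case_prod Keep ` ({..<k} \<times> {..<symbols M})"

text \<open>Each rule yields a clause for every time and cell, even if it mentions neither. The
  repetitions make the clauses a full grid, which is easy to number.\<close>

definition solves :: "bool list \<Rightarrow> nat \<Rightarrow> nat \<Rightarrow> nat \<Rightarrow> (nat \<Rightarrow> nat \<Rightarrow> nat \<Rightarrow> nat) \<Rightarrow> bool" where
  "solves x N \<tau> P a \<longleftrightarrow> (\<forall>r\<in>rules. \<forall>t\<le>\<tau>. \<forall>p<P. \<exists>t'\<le>\<tau>. \<exists>p'<P. \<exists>c<Suc (2 * k). lit x N \<tau> r t p t' p' c (a t' p' c))"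

lemma k_pos: "1 \<le> k" "3 \<le> symbols M" "2 \<le> states M" using wf by (auto simp: wf_tm_def)

definition cfg :: "bool list \<Rightarrow> nat \<Rightarrow> config" where "cfg w t = (step M ^^ t) (start_config M w)"

definition sit :: "bool list \<Rightarrow> nat \<Rightarrow> nat \<times> nat list" where
  "sit w t = (fst (cfg w t), map read_tape (snd (cfg w t)))"

lemma read_tape_eq: "read_tape tp = fst tp (snd tp)" by (cases tp) simp

lemma delta_wf:
  assumes "q < states M" "length ss = k" "set ss \<subseteq> {..<symbols M}"
  shows "fst (delta M (q, ss)) < states M" "length (snd (delta M (q, ss))) = k"
    "i < k \<Longrightarrow> fst (snd (delta M (q, ss)) ! i) < symbols M"
proof -
  have "fst (delta M (q, ss)) < states M \<and> length (snd (delta M (q, ss))) = k \<and>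
     fst ` set (snd (delta M (q, ss))) \<subseteq> {..<symbols M}"
  proof (cases "q = 1")
    case True
    then show ?thesis using assms k_pos by (auto simp: delta_def image_image)
  next
    case False
    then show ?thesis using assms wf by (simp add: delta_def wf_tm_def)
  qed
  then show "fst (delta M (q, ss)) < states M" "length (snd (delta M (q, ss))) = k"
    "i < k \<Longrightarrow> fst (snd (delta M (q, ss)) ! i) < symbols M"
    by (auto dest!: subsetD[of _ _ "fst (snd (delta M (q, ss)) ! i)"] intro!: imageI nth_mem)
qed

text \<open>Heads move by at most one cell per step, so in time \<open>\<tau>\<close> they stay
  within \<open>2 * \<tau> + 1\<close> cells.\<close>

lemma cfg_wf:
  "fst (cfg w t) < states M \<and> length (snd (cfg w t)) = k \<and>
    (\<forall>i<k. (\<forall>z. fst (snd (cfg w t) ! i) z < symbols M) \<and> \<bar>snd (snd (cfg w t) ! i)\<bar> \<le> int t)"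
proof (induction t)
  case 0
  have "fst (word_tape v) z < symbols M" "snd (word_tape v) = 0" for v z
    using word_tape_le[of v z] k_pos by (auto simp: word_tape_def)
  moreover have "(word_tape w # replicate (k - 1) (word_tape [])) ! i = word_tape (if i = 0 then w else [])" if "i < k" for i
    using that by (cases i) auto
  ultimately show ?case using k_pos by (simp add: cfg_def start_config_def)
next
  case (Suc t)
  obtain q ts where c: "cfg w t = (q, ts)" by (rule prod.exhaust)
  have c': "cfg w (Suc t) = step M (q, ts)" using c by (simp add: cfg_def)
  let ?d = "delta M (q, map read_tape ts)"
  have ss: "set (map read_tape ts) \<subseteq> {..<symbols M}"
    using Suc c by (auto simp: read_tape_eq in_set_conv_nth) (metis fst_conv)
  note dw = delta_wf[OF _ _ ss, of q]
  have l: "length ts = k" "q < states M" using Suc c by auto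
  have "fst (act_tape (s, dir) tp) z < symbols M \<and> \<bar>snd (act_tape (s, dir) tp)\<bar> \<le> 1 + int t"
    if "\<forall>z. fst tp z < symbols M" "\<bar>snd tp\<bar> \<le> int t" "s < symbols M" for tp s dir z
    using that by (cases tp; cases dir) auto
  then have "fst (act_tape ac tp) z < symbols M \<and> \<bar>snd (act_tape ac tp)\<bar> \<le> 1 + int t"
    if "\<forall>z. fst tp z < symbols M" "\<bar>snd tp\<bar> \<le> int t" "fst ac < symbols M" for tp ac z
    using that by (cases ac) auto
  then show ?case using Suc c l dw unfolding c' step_delta by simp
qed

lemma sit_wf: "sit w t \<in> {(q, ss). q < states M \<and> length ss = k \<and> set ss \<subseteq> {..<symbols M}}"
  using cfg_wf[of w t] by (auto simp: sit_def read_tape_eq in_set_conv_nth) (metis fst_conv)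

lemma cfg_Suc:
  "fst (cfg w (Suc t)) = fst (delta M (sit w t))"
  "i < k \<Longrightarrow> snd (cfg w (Suc t)) ! i = act_tape (snd (delta M (sit w t)) ! i) (snd (cfg w t) ! i)"
proof -
  obtain q ts where c: "cfg w t = (q, ts)" by (rule prod.exhaust)
  have c': "cfg w (Suc t) = step M (q, ts)" using c by (simp add: cfg_def)
  have s: "sit w t = (q, map read_tape ts)" using c by (simp add: sit_def)
  show "fst (cfg w (Suc t)) = fst (delta M (sit w t))" unfolding c' s step_delta by simp
  show "snd (cfg w (Suc t)) ! i = act_tape (snd (delta M (sit w t)) ! i) (snd (cfg w t) ! i)" if "i < k"
    using that delta_wf(2)[of q "map read_tape ts"] sit_wf[of w t] cfg_wf[of w t] c s
    unfolding c' step_delta by simp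
qed

lemma fst_act_tape: "fst (act_tape ac tp) z = (if z = snd tp then fst ac else fst tp z)"
  by (cases ac; cases tp) auto

lemma snd_act_tape: "snd (act_tape ac tp) = snd tp + offset (snd ac)"
  by (cases ac; cases tp) auto

lemma cfg_0: "fst (cfg w 0) = 0" "i < k \<Longrightarrow> snd (cfg w 0) ! i = word_tape (if i = 0 then w else [])"
  by (cases i; auto simp: cfg_def start_config_def)+

text \<open>The halting configuration persists until time \<open>\<tau>\<close>, and the answer is
  the single bit in cell 0 of the last tape, where symbol 2 means \<open>True\<close>.\<close>

lemma accepts_iff:
  assumes "computes_in_time M (\<lambda>x. [x \<in> A]) f" "f (length w) \<le> \<tau>"
  shows "w \<in> A \<longleftrightarrow> fst (snd (cfg w \<tau>) ! (k - 1)) 0 = 2"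
proof -
  obtain t ts where t: "t \<le> f (length w)" "cfg w t = (1, ts)" "tape_output (last ts) [w \<in> A]"
    using assms(1) unfolding computes_in_time_def cfg_def by blast
  have "cfg w (t + s) = (1, ts)" for s
    by (induction s) (use t(2) in \<open>auto simp: cfg_def\<close>)
  from this[of "\<tau> - t"] t assms(2) have c: "cfg w \<tau> = (1, ts)" by simp
  have "length ts = k" using cfg_wf[of w \<tau>] c by simp
  then have "last ts = ts ! (k - 1)" using k_pos by (subst last_conv_nth) auto
  then have "fst (ts ! (k - 1)) 0 = bit_symbol (w \<in> A)" using t(3) by (auto simp: tape_output_def)
  then show ?thesis using c by (auto simp: bit_symbol_def)
qed

end

section \<open>Solutions of the tableau and accepting computations\<close>

context tableau
begin

lemma rules_iff [simp]:
  "Init_Sit \<in> rules" "Init_Gap \<in> rules" "Accept \<in> rules" "Init_Head i \<in> rules \<longleftrightarrow> i < k"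
  "Init_Cell i \<in> rules \<longleftrightarrow> i < k" "Next \<sigma> \<in> rules \<longleftrightarrow> \<sigma> < S" "Read i \<sigma> \<in> rules \<longleftrightarrow> i < k \<and> \<sigma> < S"
  "Move i \<sigma> \<in> rules \<longleftrightarrow> i < k \<and> \<sigma> < S" "Write i \<sigma> \<in> rules \<longleftrightarrow> i < k \<and> \<sigma> < S"
  "Keep i s \<in> rules \<longleftrightarrow> i < k \<and> s < symbols M"
  by (auto simp: rules_def image_iff)

text \<open>The domain size \<open>D\<close> accommodates all three sorts of values: situations
  below \<open>S\<close>, head positions below \<open>P\<close>, and tape symbols.\<close>

lemma solves_if_accepts:
  assumes y: "length y \<le> N" and \<tau>: "2 * length x + N < \<tau>" and P: "2 * \<tau> < P" and D: "S + P + symbols M \<le> D"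
    and acc: "fst (snd (cfg (encode_pair x y) \<tau>) ! (k - 1)) 0 = 2"
  shows "\<exists>a. (\<forall>t\<le>\<tau>. \<forall>p<P. \<forall>c<Suc (2 * k). a t p c < D) \<and> solves x N \<tau> P a"
proof -
  define w where "w = encode_pair x y"
  define enc where "enc = inv_into {..<S} dec"
  define tp where "tp t i = snd (cfg w t) ! i" for t i
  \<comment> \<open>Position 0 of a tape is cell \<open>\<tau>\<close>, the middle of the
    window.\<close>
  define a where "a t p c = (if c = 0 then enc (sit w t) else if c \<le> k then nat (snd (tp t (c - 1)) + int \<tau>)
     else fst (tp t (c - Suc k)) (int p - int \<tau>))" for t p c
  have enc: "enc (sit w t) < S" "dec (enc (sit w t)) = sit w t" for t
  proof -
    show "enc (sit w t) < S"
      using bspec[OF bij_betwE[OF bij_betw_inv_into[OF dec]] sit_wf[of w t]] unfolding enc_def by simp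
    show "dec (enc (sit w t)) = sit w t"
      unfolding enc_def by (rule bij_betw_inv_into_right[OF dec sit_wf])
  qed
  have a0: "a t p 0 = enc (sit w t)" for t p by (simp add: a_def)
  have ah: "a t p (Suc i) = nat (snd (tp t i) + int \<tau>)" if "i < k" for t p i using that by (simp add: a_def)
  have ac: "a t p (Suc k + i) = fst (tp t i) (int p - int \<tau>)" for t p i by (simp add: a_def)
  have pos: "\<bar>snd (tp t i)\<bar> \<le> int t" "fst (tp t i) z < symbols M" if "i < k" for t i z
    using cfg_wf[of w t] that by (auto simp: tp_def)
  have hd: "int (a t p (Suc i)) = snd (tp t i) + int \<tau>" if "i < k" "t \<le> \<tau>" for t p i
    using pos(1)[OF that(1), of t] that by (simp add: ah)
  have tp0: "tp 0 i = word_tape (if i = 0 then w else [])" if "i < k" for i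
    using cfg_0(2)[OF that] by (simp add: tp_def)
  have tpS: "tp (Suc t) i = act_tape (snd (delta M (sit w t)) ! i) (tp t i)" if "i < k" for t i
    using cfg_Suc(2)[OF that] by (simp add: tp_def)
  have rd: "snd (sit w t) ! i = fst (tp t i) (snd (tp t i))" if "i < k" for t i
    using cfg_wf[of w t] that by (simp add: sit_def tp_def read_tape_eq)
  have bound: "a t p c < D" if "t \<le> \<tau>" "p < P" "c < Suc (2 * k)" for t p c
  proof -
    have "c = 0 \<or> c - 1 < k \<and> c = Suc (c - 1) \<or> c - Suc k < k \<and> c = Suc k + (c - Suc k)"
      using that(3) by linarith
    then consider "c = 0" | i where "i < k" "c = Suc i" | i where "i < k" "c = Suc k + i" by blast
    then show ?thesis
    proof cases
      case 1
      then show ?thesis using enc(1)[of t] D by (simp add: a0)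
    next
      case 2
      then show ?thesis using hd[OF 2(1) that(1), of p] pos(1)[OF 2(1), of t] that P D by simp
    next
      case 3
      then show ?thesis using pos(2)[OF 3(1), of t "int p - int \<tau>"] D ac[of t p i] by simp
    qed
  qed
  have sits: "enc (sit w t) \<in> sits (fst (cfg w t))" for t
    using enc[of t] by (simp add: sits_def) (simp add: sit_def)
  have kp: "0 < Suc (2 * k)" "i < k \<Longrightarrow> Suc i < Suc (2 * k)" "i < k \<Longrightarrow> Suc k + i < Suc (2 * k)" for i by auto
  have P0: "0 < P" "\<tau> < P" using P by auto
  have "solves x N \<tau> P a"
    unfolding solves_def
  proof (intro ballI allI impI)
    fix r t p assume r: "r \<in> rules" and t: "t \<le> \<tau>" and p: "p < P"
    define ok where "ok t' p' c \<longleftrightarrow> lit x N \<tau> r t p t' p' c (a t' p' c)" for t' p' c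
    have "\<exists>t' p' c. t' \<le> \<tau> \<and> p' < P \<and> c < Suc (2 * k) \<and> ok t' p' c"
    proof (cases r)
      case Init_Sit
      have "ok 0 0 0" using sits[of 0] Init_Sit by (simp add: ok_def a0 cfg_0)
      then show ?thesis using P0 kp by blast
    next
      case (Init_Head i)
      then have i: "i < k" using r by simp
      have "ok 0 0 (Suc i)" using Init_Head i by (simp add: ok_def ah tp0 word_tape_def)
      then show ?thesis using P0 kp i by blast
    next
      case (Init_Cell i)
      then have i: "i < k" using r by simp
      have "ok 0 p (Suc k + i)"
        unfolding ok_def Init_Cell lit.simps ac tp0[OF i] w_def using initial_word[OF y, of x \<tau> i p] by blast
      then show ?thesis using p kp i by blast
    next
      case Init_Gap
      show ?thesis
      proof (cases "gap x N \<tau> p")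
        case False
        then have "ok 0 0 0" using Init_Gap by (simp add: ok_def)
        then show ?thesis using P0 kp by blast
      next
        case True
        have k0: "0 < k" using k_pos by simp
        have u: "a 0 q (Suc k) = fst (word_tape (encode_pair x y)) (int q - int \<tau>)" for q
          using ac[of 0 q 0] tp0[OF k0] by (simp add: w_def)
        show ?thesis
        proof (cases "a 0 p (Suc k) = 0")
          case False
          then have "ok 0 p (Suc k)" using Init_Gap by (simp add: ok_def)
          then show ?thesis using p k0 by (intro exI[of _ 0] exI[of _ p] exI[of _ "Suc k"]) simp
        next
          case z: True
          have "a 0 (Suc p) (Suc k) = 0"
            using z True unfolding u word_tape_pair gap_def by (auto simp: bit_symbol_def split: if_splits)
          then have "ok 0 (Suc p) (Suc k)" using Init_Gap by (simp add: ok_def)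
          moreover have "Suc p < P" using True \<tau> P by (simp add: gap_def)
          ultimately show ?thesis using k0 by (intro exI[of _ 0] exI[of _ "Suc p"] exI[of _ "Suc k"]) simp
        qed
      qed
    next
      case (Next \<sigma>)
      show ?thesis
      proof (cases "t = \<tau>")
        case True
        then have "ok 0 0 0" using Next by (simp add: ok_def)
        then show ?thesis using P0 kp by blast
      next
        case False
        then have St: "Suc t \<le> \<tau>" using t by simp
        show ?thesis
        proof (cases "enc (sit w t) = \<sigma>")
          case True
          then have "ok (Suc t) 0 0" using Next sits[of "Suc t"] enc(2)[of t] cfg_Suc(1)[of w t] by (simp add: ok_def a0)
          then show ?thesis using P0 kp St by blast
        next
          case False
          then have "ok t 0 0" using Next by (simp add: ok_def a0)
          then show ?thesis using P0 kp t by blast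
        qed
      qed
    next
      case (Read i \<sigma>)
      then have i: "i < k" using r by simp
      consider "a t 0 (Suc i) \<noteq> p" | "enc (sit w t) \<noteq> \<sigma>" | "a t 0 (Suc i) = p" "enc (sit w t) = \<sigma>" by blast
      then show ?thesis
      proof cases
        case 1
        then have "ok t 0 (Suc i)" using Read by (simp add: ok_def)
        then show ?thesis using P0 kp t i by blast
      next
        case 2
        then have "ok t 0 0" using Read by (simp add: ok_def a0)
        then show ?thesis using P0 kp t by blast
      next
        case 3
        have "int p - int \<tau> = snd (tp t i)" using hd[OF i t, of 0] 3 by simp
        then have "ok t p (Suc k + i)" using Read 3 enc(2)[of t] rd[OF i, of t] by (simp add: ok_def ac del: add_Suc)
        then show ?thesis using p kp t i by blast
      qed
    next
      case (Move i \<sigma>)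
      then have i: "i < k" using r by simp
      consider "t = \<tau>" | "a t 0 (Suc i) \<noteq> p" | "enc (sit w t) \<noteq> \<sigma>" | "t < \<tau>" "a t 0 (Suc i) = p" "enc (sit w t) = \<sigma>"
        using t by linarith
      then show ?thesis
      proof cases
        case 1
        then have "ok 0 0 0" using Move by (simp add: ok_def)
        then show ?thesis using P0 kp by blast
      next
        case 2
        then have "ok t 0 (Suc i)" using Move by (simp add: ok_def)
        then show ?thesis using P0 kp t i by blast
      next
        case 3
        then have "ok t 0 0" using Move by (simp add: ok_def a0)
        then show ?thesis using P0 kp t by blast
      next
        case 4
        then have St: "Suc t \<le> \<tau>" by simp
        have "int (Suc (a (Suc t) 0 (Suc i))) = int (p + shift (snd (snd (delta M (dec \<sigma>)) ! i)))"
          using hd[OF i t, of 0] hd[OF i St, of 0] 4 enc(2)[of t] tpS[OF i, of t] by (auto simp: snd_act_tape int_shift)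
        then have "ok (Suc t) 0 (Suc i)" using Move unfolding of_nat_eq_iff by (simp add: ok_def)
        then show ?thesis using P0 kp St i by blast
      qed
    next
      case (Write i \<sigma>)
      then have i: "i < k" using r by simp
      consider "t = \<tau>" | "a t 0 (Suc i) \<noteq> p" | "enc (sit w t) \<noteq> \<sigma>" | "t < \<tau>" "a t 0 (Suc i) = p" "enc (sit w t) = \<sigma>"
        using t by linarith
      then show ?thesis
      proof cases
        case 1
        then have "ok 0 0 0" using Write by (simp add: ok_def)
        then show ?thesis using P0 kp by blast
      next
        case 2
        then have "ok t 0 (Suc i)" using Write by (simp add: ok_def)
        then show ?thesis using P0 kp t i by blast
      next
        case 3
        then have "ok t 0 0" using Write by (simp add: ok_def a0)
        then show ?thesis using P0 kp t by blast
      next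
        case 4
        then have St: "Suc t \<le> \<tau>" by simp
        have "a (Suc t) p (Suc k + i) = fst (snd (delta M (dec \<sigma>)) ! i)"
          using hd[OF i t, of 0] 4 enc(2)[of t] tpS[OF i, of t] unfolding ac by (auto simp: fst_act_tape)
        then have "ok (Suc t) p (Suc k + i)" using Write by (simp add: ok_def)
        then show ?thesis using p kp St i by blast
      qed
    next
      case (Keep i s)
      then have i: "i < k" using r by simp
      consider "t = \<tau>" | "a t 0 (Suc i) = p" | "a t p (Suc k + i) \<noteq> s" | "t < \<tau>" "a t 0 (Suc i) \<noteq> p" "a t p (Suc k + i) = s"
        using t by linarith
      then show ?thesis
      proof cases
        case 1
        then have "ok 0 0 0" using Keep by (simp add: ok_def)
        then show ?thesis using P0 kp by blast
      next
        case 2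
        then have "ok t 0 (Suc i)" using Keep by (simp add: ok_def)
        then show ?thesis using P0 kp t i by blast
      next
        case 3
        then have "ok t p (Suc k + i)" using Keep by (simp add: ok_def)
        then show ?thesis using p kp t i by blast
      next
        case 4
        then have St: "Suc t \<le> \<tau>" by simp
        have "int p - int \<tau> \<noteq> snd (tp t i)" using hd[OF i t, of 0] 4 by auto
        then have "a (Suc t) p (Suc k + i) = s"
          using 4(3) tpS[OF i, of t] unfolding ac by (auto simp: fst_act_tape)
        then have "ok (Suc t) p (Suc k + i)" using Keep by (simp add: ok_def)
        then show ?thesis using p kp St i by blast
      qed
    next
      case Accept
      have i: "k - 1 < k" using k_pos by simp
      have "a \<tau> \<tau> (Suc k + (k - 1)) = 2" unfolding ac using acc by (simp add: tp_def w_def)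
      then have "ok \<tau> \<tau> (Suc k + (k - 1))" using Accept by (simp add: ok_def)
      then show ?thesis using P0 kp(3)[OF i] by blast
    qed
    then show "\<exists>t'\<le>\<tau>. \<exists>p'<P. \<exists>c<Suc (2 * k). lit x N \<tau> r t p t' p' c (a t' p' c)" unfolding ok_def by blast
  qed
  then show ?thesis using bound by blast
qed

text \<open>The initial rules fix a certificate \<open>y\<close>. From there the clauses, read as
  implications, force the variables of each time step to describe the configuration reached on
  \<open>x\<close> and \<open>y\<close>.\<close>

lemma accepts_if_solves:
  assumes s: "solves x N \<tau> P a" and \<tau>: "2 * length x + N < \<tau>" and P: "2 * \<tau> < P"
  shows "\<exists>y. length y \<le> N \<and> fst (snd (cfg (encode_pair x y) \<tau>) ! (k - 1)) 0 = 2"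
proof -
  have e: "\<exists>t' p' c. lit x N \<tau> r t p t' p' c (a t' p' c)" if "r \<in> rules" "t \<le> \<tau>" "p < P" for r t p
    using s that unfolding solves_def by blast
  have P0: "0 < P" "\<tau> < P" using P by auto
  have next_sit: "a (Suc t) 0 0 \<in> sits (fst (delta M (dec (a t 0 0))))" if "t < \<tau>" "a t 0 0 < S" for t
    using e[of "Next (a t 0 0)" t 0] that P0 by auto
  have read: "a t (a t 0 (Suc i)) (Suc k + i) = snd (dec (a t 0 0)) ! i"
    if "t \<le> \<tau>" "a t 0 0 < S" "i < k" "a t 0 (Suc i) < P" for t i
    using e[of "Read i (a t 0 0)" t "a t 0 (Suc i)"] that by auto
  have move: "Suc (a (Suc t) 0 (Suc i)) = a t 0 (Suc i) + shift (snd (snd (delta M (dec (a t 0 0))) ! i))"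
    if "t < \<tau>" "a t 0 0 < S" "i < k" "a t 0 (Suc i) < P" for t i
    using e[of "Move i (a t 0 0)" t "a t 0 (Suc i)"] that by auto
  have overwrite: "a (Suc t) (a t 0 (Suc i)) (Suc k + i) = fst (snd (delta M (dec (a t 0 0))) ! i)"
    if "t < \<tau>" "a t 0 0 < S" "i < k" "a t 0 (Suc i) < P" for t i
    using e[of "Write i (a t 0 0)" t "a t 0 (Suc i)"] that by auto
  have keep: "a (Suc t) p (Suc k + i) = a t p (Suc k + i)"
    if "t < \<tau>" "i < k" "p < P" "a t 0 (Suc i) \<noteq> p" "a t p (Suc k + i) < symbols M" for t i p
    using e[of "Keep i (a t p (Suc k + i))" t p] that by auto
  have init: "initial x N \<tau> i p (a 0 p (Suc k + i))" if "i < k" "p < P" for i p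
    using e[of "Init_Cell i" 0 p] that by auto
  have "\<exists>y. length y \<le> N \<and> (\<forall>p<P. a 0 p (Suc k) = fst (word_tape (encode_pair x y)) (int p - int \<tau>))"
  proof (rule word_if_initial)
    show "initial x N \<tau> 0 p (a 0 p (Suc k))" if "p < P" for p using init[of 0 p] that k_pos by simp
    show "a 0 (Suc p) (Suc k) = 0" if "p < P" "gap x N \<tau> p" "a 0 p (Suc k) = 0" for p
      using e[of Init_Gap 0 p] that by auto
    show "\<tau> + 2 * length x + N < P" using \<tau> P by simp
  qed
  then obtain y where y: "length y \<le> N" "\<And>p. p < P \<Longrightarrow> a 0 p (Suc k) = fst (word_tape (encode_pair x y)) (int p - int \<tau>)"
    by blast
  define w where "w = encode_pair x y"
  define tp where "tp t i = snd (cfg w t) ! i" for t i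
  have tpS: "tp (Suc t) i = act_tape (snd (delta M (sit w t)) ! i) (tp t i)" if "i < k" for t i
    using cfg_Suc(2)[OF that] by (simp add: tp_def)
  have pos: "\<bar>snd (tp t i)\<bar> \<le> int t" "fst (tp t i) z < symbols M" if "i < k" for t i z
    using cfg_wf[of w t] that by (auto simp: tp_def)
  have inv: "a t 0 0 \<in> sits (fst (cfg w t)) \<and> (\<forall>i<k. int (a t 0 (Suc i)) = snd (tp t i) + int \<tau>) \<and>
     (\<forall>i<k. \<forall>p<P. a t p (Suc k + i) = fst (tp t i) (int p - int \<tau>))" if "t \<le> \<tau>" for t
    using that
  proof (induction t)
    case 0
    have tp0: "tp 0 i = word_tape (if i = 0 then w else [])" if "i < k" for i
      using cfg_0(2)[OF that] by (simp add: tp_def)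
    have "a 0 p (Suc k + i) = fst (tp 0 i) (int p - int \<tau>)" if "i < k" "p < P" for i p
    proof (cases "i = 0")
      case True
      then show ?thesis using y(2)[OF that(2)] tp0[OF that(1)] by (simp add: w_def)
    next
      case False
      then show ?thesis using init[OF that] tp0[OF that(1)] by (simp add: initial_def word_tape_def)
    qed
    moreover have "a 0 0 0 \<in> sits 0" using e[of Init_Sit 0 0] P0 by auto
    moreover have "int (a 0 0 (Suc i)) = snd (tp 0 i) + int \<tau>" if "i < k" for i
      using e[of "Init_Head i" 0 0] that P0 tp0[OF that] by (auto simp: word_tape_def)
    ultimately show ?case by (simp add: cfg_0)
  next
    case (Suc t)
    then have t: "t < \<tau>" by simp
    note IH = Suc.IH[OF less_imp_le[OF t]]
    have h: "int (a t 0 (Suc i)) = snd (tp t i) + int \<tau>"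
      and c: "\<And>p. p < P \<Longrightarrow> a t p (Suc k + i) = fst (tp t i) (int p - int \<tau>)" if "i < k" for i
      using IH that by blast+
    \<comment> \<open>The head is still inside the window, so the clauses for its cell are
      present.\<close>
    have hP: "a t 0 (Suc i) < P" if i: "i < k" for i
      using h[OF i] pos(1)[OF i, of t] t P by linarith
    have \<sigma>: "a t 0 0 < S" "fst (dec (a t 0 0)) = fst (cfg w t)" using IH by (simp_all add: sits_def)
    \<comment> \<open>A \<open>Next\<close> clause determines only the state within the new
      situation; the symbols in it are guessed, and the \<open>Read\<close> clauses tie them to the
      tapes.\<close>
    have ds: "dec (a t 0 0) = sit w t"
    proof (rule prod_eqI)
      show "fst (dec (a t 0 0)) = fst (sit w t)" using \<sigma>(2) by (simp add: sit_def)
      have "dec (a t 0 0) \<in> {(q, ss). q < states M \<and> length ss = k \<and> set ss \<subseteq> {..<symbols M}}"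
        by (rule bspec[OF bij_betwE[OF dec]]) (simp add: \<sigma>(1))
      then have l: "length (snd (dec (a t 0 0))) = k" by auto
      show "snd (dec (a t 0 0)) = snd (sit w t)"
      proof (rule nth_equalityI)
        show "length (snd (dec (a t 0 0))) = length (snd (sit w t))" using l cfg_wf[of w t] by (simp add: sit_def)
        fix i assume "i < length (snd (dec (a t 0 0)))"
        then have i: "i < k" using l by simp
        have "snd (sit w t) ! i = fst (tp t i) (snd (tp t i))"
          using cfg_wf[of w t] i by (simp add: sit_def tp_def read_tape_eq)
        moreover have "int (a t 0 (Suc i)) - int \<tau> = snd (tp t i)" using h[OF i] by simp
        ultimately show "snd (dec (a t 0 0)) ! i = snd (sit w t) ! i"
          using read[OF less_imp_le[OF t] \<sigma>(1) i hP[OF i]] c[OF i hP[OF i]] by simp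
      qed
    qed
    have "a (Suc t) 0 0 \<in> sits (fst (cfg w (Suc t)))"
      using next_sit[OF t \<sigma>(1)] unfolding ds cfg_Suc(1) .
    moreover have "int (a (Suc t) 0 (Suc i)) = snd (tp (Suc t) i) + int \<tau>" if i: "i < k" for i
    proof -
      have "int (Suc (a (Suc t) 0 (Suc i))) = int (a t 0 (Suc i)) + int (shift (snd (snd (delta M (sit w t)) ! i)))"
        unfolding move[OF t \<sigma>(1) i hP[OF i]] ds by simp
      then show ?thesis using h[OF i] by (simp add: int_shift tpS[OF i] snd_act_tape)
    qed
    moreover have "a (Suc t) p (Suc k + i) = fst (tp (Suc t) i) (int p - int \<tau>)" if i: "i < k" and p: "p < P" for i p
    proof (cases "a t 0 (Suc i) = p")
      case True
      then have "a (Suc t) p (Suc k + i) = fst (snd (delta M (sit w t)) ! i)"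
        using overwrite[OF t \<sigma>(1) i hP[OF i]] ds by simp
      moreover have "int p - int \<tau> = snd (tp t i)" using h[OF i] True by simp
      ultimately show ?thesis by (simp add: tpS[OF i] fst_act_tape)
    next
      case False
      have "a t p (Suc k + i) < symbols M" unfolding c[OF i p] by (rule pos(2)[OF i])
      from keep[OF t i p False this] have "a (Suc t) p (Suc k + i) = fst (tp t i) (int p - int \<tau>)"
        using c[OF i p] by simp
      moreover have "int p - int \<tau> \<noteq> snd (tp t i)" using h[OF i] False by auto
      ultimately show ?thesis by (simp add: tpS[OF i] fst_act_tape)
    qed
    ultimately show ?case by blast
  qed
  have "a \<tau> \<tau> (Suc k + (k - 1)) = 2" using e[of Accept 0 0] P0 by auto
  moreover have "a \<tau> \<tau> (Suc k + (k - 1)) = fst (tp \<tau> (k - 1)) (int \<tau> - int \<tau>)"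
  proof -
    have "k - 1 < k" using k_pos(1) by simp
    then show ?thesis using inv[OF order_refl] P0(2) by blast
  qed
  ultimately show ?thesis using y(1) by (auto simp: tp_def w_def)
qed

lemma finite_rules: "finite rules" by (simp add: rules_def)

text \<open>The rule is fixed, so \<open>sits\<close> and the values of \<open>delta\<close> are
  constants built into the program.\<close>

lemma polyfun_lit:
  assumes N: "polyfun (\<lambda>x \<rho>. N x)" and \<tau>: "polyfun (\<lambda>x \<rho>. \<tau> x)"
    and a: "polyfun t" "polyfun p" "polyfun t'" "polyfun p'" "polyfun c" "polyfun d"
  shows "polyfun (\<lambda>x \<rho>. of_bool (lit x (N x) (\<tau> x) r (t x \<rho>) (p x \<rho>) (t' x \<rho>) (p' x \<rho>) (c x \<rho>) (d x \<rho>)))"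
proof -
  have sits: "finite (sits q)" for q by (simp add: sits_def)
  have given: "polyfun u \<Longrightarrow> polyfun (\<lambda>x \<rho>. of_bool (given x (u x \<rho>)))" for u unfolding given_def by (rule polyfun_bit)
  have gap: "polyfun u \<Longrightarrow> polyfun (\<lambda>x \<rho>. of_bool (gap x (N x) (\<tau> x) (u x \<rho>)))" for u
    unfolding gap_def by (intro polyfun_intros N \<tau>)
  have initial: "polyfun u \<Longrightarrow> polyfun v \<Longrightarrow> polyfun (\<lambda>x \<rho>. of_bool (initial x (N x) (\<tau> x) i (u x \<rho>) (v x \<rho>)))" for u v i
    unfolding initial_def by (intro polyfun_intros N \<tau> given)
  show ?thesis
    by (cases r; simp only: lit.simps; intro polyfun_intros N \<tau> gap initial polyfun_mem[OF sits] a)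
qed

end

section \<open>Numbering of the grid of variables and clauses\<close>

lemma radix:
  fixes P N :: nat
  assumes "p < P" "c < N"
  shows "((t * P + p) * N + c) div N div P = t" "((t * P + p) * N + c) div N mod P = p" "((t * P + p) * N + c) mod N = c"
    "t \<le> \<tau> \<Longrightarrow> (t * P + p) * N + c < Suc \<tau> * P * N"
proof -
  have 1: "((t * P + p) * N + c) div N = t * P + p" "((t * P + p) * N + c) mod N = c" using assms by auto
  then show "((t * P + p) * N + c) div N div P = t" "((t * P + p) * N + c) div N mod P = p" "((t * P + p) * N + c) mod N = c"
    using assms by auto
  assume t: "t \<le> \<tau>"
  have "t * P + p < Suc t * P" using assms by simp
  also have "\<dots> \<le> Suc \<tau> * P" using t by (intro mult_le_mono1) simp
  finally have "Suc (t * P + p) * N \<le> Suc \<tau> * P * N" by (intro mult_le_mono1) simp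
  then show "(t * P + p) * N + c < Suc \<tau> * P * N" using assms by simp
qed

lemma radix_less:
  fixes P N :: nat
  assumes "v < Suc \<tau> * P * N"
  shows "v div N div P \<le> \<tau>" "v div N mod P < P" "v mod N < N" "(v div N div P * P + v div N mod P) * N + v mod N = v"
proof -
  have "v div N < Suc \<tau> * P" using assms by (rule less_mult_imp_div_less)
  then have "v div N div P < Suc \<tau>" by (rule less_mult_imp_div_less)
  then show "v div N div P \<le> \<tau>" by simp
  have "0 < P" "0 < N" using assms by (auto intro: gr0I)
  then show "v div N mod P < P" "v mod N < N" by auto
  show "(v div N div P * P + v div N mod P) * N + v mod N = v" by simp
qed

text \<open>Variables are triples of time, cell and number in mixed radix; clauses are numbered
  likewise, with the rule in the last place.\<close>

lemma msat_grid:
  assumes "0 < R"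
  shows "msat (Suc \<tau> * P * N) D (Suc \<tau> * P * R)
     (\<lambda>j v d. \<Phi> (j mod R) (j div R div P) (j div R mod P) (v div N div P) (v div N mod P) (v mod N) d) \<longleftrightarrow>
   (\<exists>a. (\<forall>t\<le>\<tau>. \<forall>p<P. \<forall>c<N. a t p c < D) \<and>
     (\<forall>r<R. \<forall>t\<le>\<tau>. \<forall>p<P. \<exists>t'\<le>\<tau>. \<exists>p'<P. \<exists>c<N. \<Phi> r t p t' p' c (a t' p' c)))" (is "?L \<longleftrightarrow> ?R")
proof
  assume ?L
  then obtain \<alpha> where "(\<forall>v<Suc \<tau> * P * N. \<alpha> v < D) \<and>
    (\<forall>j<Suc \<tau> * P * R. \<exists>v<Suc \<tau> * P * N. \<Phi> (j mod R) (j div R div P) (j div R mod P) (v div N div P) (v div N mod P) (v mod N) (\<alpha> v))"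
    unfolding msat_def by (elim exE)
  note \<alpha> = conjunct1[OF this, rule_format] conjunct2[OF this, rule_format]
  show ?R
  proof (intro exI[of _ "\<lambda>t p c. \<alpha> ((t * P + p) * N + c)"] conjI allI impI)
    fix t p c assume "t \<le> \<tau>" "p < P" "c < N"
    then show "\<alpha> ((t * P + p) * N + c) < D" by (intro \<alpha>(1) radix(4))
  next
    fix r t p assume r: "r < R" and t: "t \<le> \<tau>" and p: "p < P"
    from \<alpha>(2)[OF radix(4)[OF p r t], unfolded radix(1-3)[OF p r]] obtain v where
      v: "v < Suc \<tau> * P * N" "\<Phi> r t p (v div N div P) (v div N mod P) (v mod N) (\<alpha> v)" by blast
    have "\<Phi> r t p (v div N div P) (v div N mod P) (v mod N) (\<alpha> ((v div N div P * P + v div N mod P) * N + v mod N))"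
      unfolding radix_less(4)[OF v(1)] by (rule v(2))
    then show "\<exists>t'\<le>\<tau>. \<exists>p'<P. \<exists>c<N. \<Phi> r t p t' p' c (\<alpha> ((t' * P + p') * N + c))"
      using radix_less(1-3)[OF v(1)] by blast
  qed
next
  assume ?R
  then obtain a where "(\<forall>t\<le>\<tau>. \<forall>p<P. \<forall>c<N. a t p c < D) \<and>
     (\<forall>r<R. \<forall>t\<le>\<tau>. \<forall>p<P. \<exists>t'\<le>\<tau>. \<exists>p'<P. \<exists>c<N. \<Phi> r t p t' p' c (a t' p' c))" by (elim exE)
  note a = conjunct1[OF this, rule_format] conjunct2[OF this, rule_format]
  show ?L
    unfolding msat_def
  proof (intro exI[of _ "\<lambda>v. a (v div N div P) (v div N mod P) (v mod N)"] conjI allI impI)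
    fix v assume "v < Suc \<tau> * P * N"
    from radix_less[OF this] show "a (v div N div P) (v div N mod P) (v mod N) < D" by (intro a(1))
  next
    fix j assume "j < Suc \<tau> * P * R"
    from a(2)[OF radix_less(3,1,2)[OF this]] obtain t' p' c where
      c: "t' \<le> \<tau>" "p' < P" "c < N" "\<Phi> (j mod R) (j div R div P) (j div R mod P) t' p' c (a t' p' c)" by blast
    show "\<exists>v<Suc \<tau> * P * N. \<Phi> (j mod R) (j div R div P) (j div R mod P) (v div N div P) (v div N mod P) (v mod N)
        (a (v div N div P) (v div N mod P) (v mod N))"
      by (intro exI[of _ "(t' * P + p') * N + c"]) (simp only: radix[OF c(2,3)] c simp_thms)
  qed
qed

lemma poly_nat_mono:
  fixes p :: "nat poly" shows "a \<le> b \<Longrightarrow> poly p a \<le> poly p b"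
  by (induction p) (auto intro!: add_mono mult_mono)

theorem theorem4: "NP_hard Min_Age"
  unfolding NP_hard_def
proof
  fix L assume "L \<in> class_NP"
  then obtain A and p :: "nat poly" where A: "A \<in> class_P"
    and L: "\<And>x. x \<in> L \<longleftrightarrow> (\<exists>y. length y \<le> poly p (length x) \<and> encode_pair x y \<in> A)"
    unfolding class_NP_def by blast
  obtain M and q :: "nat poly" where M: "wf_tm M" "computes_in_time M (\<lambda>x. [x \<in> A]) (poly q)"
    using A unfolding class_P_def polytime_computable_def by blast
  let ?Sit = "{(s, ss). s < states M \<and> length ss = tapes M \<and> set ss \<subseteq> {..<symbols M}}"
  have "?Sit = {..<states M} \<times> {ss. set ss \<subseteq> {..<symbols M} \<and> length ss = tapes M}" by auto
  then have "finite ?Sit" by (simp add: finite_lists_length_eq)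
  then obtain dec where "bij_betw dec {0..<card ?Sit} ?Sit" using ex_bij_betw_nat_finite by blast
  then have dec: "bij_betw dec {..<card ?Sit} ?Sit" by (simp add: lessThan_atLeast0)
  define S where "S = card ?Sit"
  interpret tableau M dec S using M(1) dec by unfold_locales (simp_all add: S_def)
  obtain rs where rs: "set rs = rules" using finite_list[OF finite_rules] by blast
  define R where "R = length rs"
  have "Init_Sit \<in> set rs" by (simp add: rs)
  then have R: "0 < R" unfolding R_def by (rule length_pos_if_in_set)
  define N where "N x = poly p (length x)" for x :: "bool list"
  \<comment> \<open>The paired word has length at most \<open>2 * length x + 1 + N x\<close>, so the
    first summand bounds the running time. The rest makes \<open>\<tau>\<close> exceed every
    position of that word, which then lies inside the window.\<close>
  define \<tau> where "\<tau> x = poly q (2 * length x + 1 + N x) + 2 * length x + N x + 1" for x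
  define P where "P x = 2 * \<tau> x + 1" for x
  define C where "C x j v d \<longleftrightarrow> lit x (N x) (\<tau> x) (rs ! (j mod R)) (j div R div P x) (j div R mod P x)
     (v div Suc (2 * k) div P x) (v div Suc (2 * k) mod P x) (v mod Suc (2 * k)) d" for x j v d
  have N: "polyfun (\<lambda>x \<rho>. N x)" unfolding N_def by (intro polyfun_intros)
  have \<tau>: "polyfun (\<lambda>x \<rho>. \<tau> x)" unfolding \<tau>_def by (intro polyfun_intros N)
  have P: "polyfun (\<lambda>x \<rho>. P x)" unfolding P_def by (intro polyfun_intros \<tau>)
  interpret poly_clauses "\<lambda>x. Suc (\<tau> x) * P x * Suc (2 * k)" "\<lambda>x. S + P x + symbols M" "\<lambda>x. Suc (\<tau> x) * P x * R" C
  proof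
    \<comment> \<open>The guard has the form required by \<open>polyfun_cases\<close>; it always
      holds, as \<open>R\<close> is positive.\<close>
    have "polyfun (\<lambda>x \<rho>. if \<rho> 0 mod R < R then of_bool (lit x (N x) (\<tau> x) (rs ! (\<rho> 0 mod R)) (\<rho> 0 div R div P x) (\<rho> 0 div R mod P x)
      (\<rho> (Suc 0) div Suc (2 * k) div P x) (\<rho> (Suc 0) div Suc (2 * k) mod P x) (\<rho> (Suc 0) mod Suc (2 * k)) (\<rho> (Suc (Suc 0)))) else 0)"
      by (rule polyfun_cases[where g = "\<lambda>c x \<rho>. of_bool (lit x (N x) (\<tau> x) (rs ! c) (\<rho> 0 div R div P x) (\<rho> 0 div R mod P x)
      (\<rho> (Suc 0) div Suc (2 * k) div P x) (\<rho> (Suc 0) div Suc (2 * k) mod P x) (\<rho> (Suc 0) mod Suc (2 * k)) (\<rho> (Suc (Suc 0))))"])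
         (intro polyfun_lit polyfun_intros N \<tau> P)+
    then show "polyfun (\<lambda>x \<rho>. of_bool (C x (\<rho> 0) (\<rho> (Suc 0)) (\<rho> (Suc (Suc 0)))))"
      using R by (simp add: C_def)
  qed (intro polyfun_intros \<tau> P)+
  show "polytime_reducible L Min_Age"
  proof (rule reducible_Min_Age)
    fix x
    show "1 \<le> Suc (\<tau> x) * P x * Suc (2 * k)" "1 \<le> S + P x + symbols M" by (simp_all add: P_def)
    have \<tau>x: "2 * length x + N x < \<tau> x" and Px: "2 * \<tau> x < P x" by (simp_all add: \<tau>_def P_def)
    have acc: "encode_pair x y \<in> A \<longleftrightarrow> fst (snd (cfg (encode_pair x y) (\<tau> x)) ! (k - 1)) 0 = 2" if "length y \<le> N x" for y
    proof (rule accepts_iff[OF M(2)])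
      have "length (encode_pair x y) \<le> 2 * length x + 1 + N x" using that by (simp add: encode_pair_def length_self_delimiting)
      from poly_nat_mono[OF this, of q] show "poly q (length (encode_pair x y)) \<le> \<tau> x" by (simp add: \<tau>_def)
    qed
    have "msat (Suc (\<tau> x) * P x * Suc (2 * k)) (S + P x + symbols M) (Suc (\<tau> x) * P x * R) (C x) \<longleftrightarrow>
      (\<exists>a. (\<forall>t\<le>\<tau> x. \<forall>p<P x. \<forall>c<Suc (2 * k). a t p c < S + P x + symbols M) \<and> solves x (N x) (\<tau> x) (P x) a)"
      unfolding C_def[abs_def] msat_grid[OF R, where \<Phi> = "\<lambda>r. lit x (N x) (\<tau> x) (rs ! r)"] solves_def rs[symmetric]
      by (auto simp: all_set_conv_all_nth R_def)
    also have "\<dots> \<longleftrightarrow> (\<exists>y. length y \<le> N x \<and> encode_pair x y \<in> A)"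
      using solves_if_accepts[OF _ \<tau>x Px order_refl] accepts_if_solves[OF _ \<tau>x Px] acc by blast
    finally show "x \<in> L \<longleftrightarrow> msat (Suc (\<tau> x) * P x * Suc (2 * k)) (S + P x + symbols M) (Suc (\<tau> x) * P x * R) (C x)"
      by (simp add: L N_def)
  qed
qed

end
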